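(* Let $\mathfrak w=\mathfrak w_q^{\mathsf d}(\mathfrak g)$, $w_q=\mathfrak wJ$ and $\overline w_q=\mathfrak w(1-J)$. As algebras, $\mathfrak w=w_q\oplus\overline w_q$. Moreover, $w_q\cong U_q(\mathfrak g)$ as Hopf algebras.
   Context: Setting. $k$ is a field of characteristic $0$; $\mathfrak g$ is a finite-dimensional simple Lie algebra with root system $R$, simple roots $\alpha_1,\dots,\alpha_n$, Cartan matrix $(a_{ij})_{n\times n}$; $(\,,\,)$ is the Weyl-group-invariant scalar product with $(\alpha,\alpha)=2$ for all short roots; $d_i=(\alpha_i,\alpha_i)/2$, so $(\alpha_i,\alpha_j)=d_ia_{ij}=d_ja_{ji}$. $q\in k$, $q_i=q^{d_i}$, and $q_i\neq 0,\pm1$ for all $i$. $[m]_x=\frac{x^m-x^{-m}}{x-x^{-1}}$, $[m]!_x=[m]_x\cdots[1]_x$, $[0]!_x=1$, $\left[{m\atop s}\right]_x=\frac{[m]!_x}{[s]!_x[m-s]!_x}$ (a Laurent polynomial in $x$, evaluated at $x=q_i$ below). The algebra. Fix a binary sequence $\mathsf d=(\kappa_1,\dots,\kappa_n\,|\,\bar\kappa_1,\dots,\bar\kappa_n)\in\{0,1\}^{2n}$. $E_i$ is called type 1 if $\kappa_i=1$ and type 2 if $\kappa_i=0$; $F_i$ is type 1 if $\bar\kappa_i=1$ and type 2 if $\bar\kappa_i=0$. $\mathfrak w=\mathfrak w_q^{\mathsf d}(\mathfrak g)$ is the unital $k$-algebra generated by $E_i,F_i,K_i,\overline K_i$ ($1\le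 i\le n$) and $J$ with relations, for all $1\le i,j\le n$: $J=K_i\overline K_i$; $K_i\overline K_j=\overline K_jK_i$, $K_iK_j=K_jK_i$, $\overline K_i\overline K_j=\overline K_j\overline K_i$; $JK_i=K_i$, $J\overline K_i=\overline K_i$; if $E_i$ is type 1: $K_jE_i=q_i^{a_{ij}}E_iK_j$ and $E_i\overline K_j=q_i^{a_{ij}}\overline K_jE_i$; if $E_i$ is type 2: $K_jE_i\overline K_j=q_i^{a_{ij}}E_i$; the same for $F_i$ with $a_{ij}$ replaced by $-a_{ij}$; $E_iF_j-F_jE_i=\delta_{ij}\frac{K_i-\overline K_i}{q_i-q_i^{-1}}$; for $i\ne j$: $\sum_{s=0}^{1-a_{ij}}(-1)^s\left[{1-a_{ij}\atop s}\right]_{q_i}E_i^{1-a_{ij}-s}E_jE_i^s=0$ and the same relation with $F$ in place of $E$. The element $J$ is a central idempotent, so $w_q$ and $\overline w_q$ are two-sided ideals; $w_q$ is an algebra with identity $J$ and $\overline w_q$ an algebra with identity $1-J$. The Hopf algebra structure on $w_q$ is given on its generators $E_iJ,F_iJ,K_i,\overline K_i$ by $\Delta(E_iJ)=J\otimes E_iJ+E_iJ\otimes K_i$, $\Delta(F_iJ)=F_iJ\otimes J+\overline K_i\otimes F_iJ$, $\Delta(K_i)=K_i\otimes K_i$, $\Delta(\overline K_i)=\overline K_i\otimes\overline K_i$; $\varepsilon(E_iJ)=\varepsilon(F_iJ)=0$, $\varepsilon(K_i)=\varepsilon(\overline K_i)=1$; $S(E_iJ)=-(E_iJ)\overline K_i$,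 $S(F_iJ)=-K_i(F_iJ)$, $S(K_i)=\overline K_i$, $S(\overline K_i)=K_i$. $U_q(\mathfrak g)$ is the $k$-algebra generated by $e_i,f_i,k_i,k_i^{-1}$ ($1\le i\le n$) with relations $k_ik_j=k_jk_i$, $k_ik_i^{-1}=k_i^{-1}k_i=1$, $k_ie_jk_i^{-1}=q_i^{a_{ij}}e_j$, $k_if_jk_i^{-1}=q_i^{-a_{ij}}f_j$, $e_if_j-f_je_i=\delta_{ij}\frac{k_i-k_i^{-1}}{q_i-q_i^{-1}}$, and for $i\ne j$ the quantum Serre relations $\sum_{s=0}^{1-a_{ij}}(-1)^s\left[{1-a_{ij}\atop s}\right]_{q_i}e_i^{1-a_{ij}-s}e_je_i^s=0$ and the same with $f$ in place of $e$. Its Hopf structure is $\Delta(k_i)=k_i\otimes k_i$, $\Delta(e_i)=1\otimes e_i+e_i\otimes k_i$, $\Delta(f_i)=f_i\otimes1+k_i^{-1}\otimes f_i$, $\varepsilon(k_i)=1$, $\varepsilon(e_i)=\varepsilon(f_i)=0$, $S(k_i)=k_i^{-1}$, $S(e_i)=-e_ik_i^{-1}$, $S(f_i)=-k_if_i$. *)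

theory Defs
  imports
    "HOL-Algebra.Module"
    "HOL-Algebra.QuotRing"
    "HOL-Algebra.Chinese_Remainder"
    "HOL-Library.Poly_Mapping"
    "HOL-Computational_Algebra.Formal_Laurent_Series"
    "HOL-Analysis.Euclidean_Space"
begin

unbundle inner_syntax
hide_const (open) Multiset.mult Polynomial.smult

section \<open>Root systems and Cartan matrices\<close>

text \<open>
  A finite-dimensional simple Lie algebra enters only through its root system \<open>R\<close>, a reduced
  irreducible root system, together with simple roots \<open>\<alpha> i\<close>; the index set is the finite type \<open>'i\<close>.
  The Weyl-group-invariant scalar product is the inner product of the ambient Euclidean space:
  the generating reflections are orthogonal with respect to it.
\<close>

definition reduced_root_system :: "'v::euclidean_space set \<Rightarrow> bool" where
  "reduced_root_system R \<longleftrightarrow>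
     finite R \<and> 0 \<notin> R \<and> span R = UNIV \<and>
     (\<forall>\<beta>\<in>R. \<forall>\<gamma>\<in>R. \<gamma> - (2 * (\<beta> \<bullet> \<gamma>) / (\<beta> \<bullet> \<beta>)) *\<^sub>R \<beta> \<in> R) \<and>
     (\<forall>\<beta>\<in>R. \<forall>\<gamma>\<in>R. 2 * (\<beta> \<bullet> \<gamma>) / (\<beta> \<bullet> \<beta>) \<in> \<int>) \<and>
     (\<forall>\<beta>\<in>R. \<forall>c. c *\<^sub>R \<beta> \<in> R \<longrightarrow> c = 1 \<or> c = -1)"

definition irreducible_root_system :: "'v::euclidean_space set \<Rightarrow> bool" where
  "irreducible_root_system R \<longleftrightarrow>
     R \<noteq> {} \<and>
     (\<forall>R1 R2. R1 \<union> R2 = R \<and> (\<forall>\<beta>\<in>R1. \<forall>\<gamma>\<in>R2. \<beta> \<bullet> \<gamma> = 0) \<longrightarrow> R1 = {} \<or> R2 = {})"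

definition simple_roots :: "'v::euclidean_space set \<Rightarrow> ('i::finite \<Rightarrow> 'v) \<Rightarrow> bool" where
  "simple_roots R \<alpha> \<longleftrightarrow>
     inj \<alpha> \<and> range \<alpha> \<subseteq> R \<and> independent (range \<alpha>) \<and>
     (\<forall>\<beta>\<in>R. \<exists>c::'i \<Rightarrow> nat.
        \<beta> = (\<Sum>i\<in>UNIV. real (c i) *\<^sub>R \<alpha> i) \<or> \<beta> = - (\<Sum>i\<in>UNIV. real (c i) *\<^sub>R \<alpha> i))"

definition short_roots_normalized :: "'v::euclidean_space set \<Rightarrow> bool" where
  "short_roots_normalized R \<longleftrightarrow>
     (\<forall>\<beta>\<in>R. (\<forall>\<gamma>\<in>R. \<beta> \<bullet> \<beta> \<le> \<gamma> \<bullet> \<gamma>) \<longrightarrow> \<beta> \<bullet> \<beta> = 2)"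

definition simple_root_data :: "'v::euclidean_space set \<Rightarrow> ('i::finite \<Rightarrow> 'v) \<Rightarrow> bool" where
  "simple_root_data R \<alpha> \<longleftrightarrow>
     reduced_root_system R \<and> irreducible_root_system R \<and> simple_roots R \<alpha> \<and>
     short_roots_normalized R"

text \<open>
  For simple root data the arguments of the floor functions below are integers, so that
  \<open>\<alpha> i \<bullet> \<alpha> j = d i * a i j\<close> with \<open>a = cartan \<alpha>\<close>, \<open>d = half_norm \<alpha>\<close>.
\<close>

definition cartan :: "('i \<Rightarrow> 'v::euclidean_space) \<Rightarrow> 'i \<Rightarrow> 'i \<Rightarrow> int" where
  "cartan \<alpha> i j = \<lfloor>2 * (\<alpha> i \<bullet> \<alpha> j) / (\<alpha> i \<bullet> \<alpha> i)\<rfloor>"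

definition half_norm :: "('i \<Rightarrow> 'v::euclidean_space) \<Rightarrow> 'i \<Rightarrow> nat" where
  "half_norm \<alpha> i = nat \<lfloor>(\<alpha> i \<bullet> \<alpha> i) / 2\<rfloor>"

definition qpar :: "('i \<Rightarrow> 'v::euclidean_space) \<Rightarrow> 'k::field \<Rightarrow> 'i \<Rightarrow> 'k" where
  "qpar \<alpha> q i = q ^ half_norm \<alpha> i"


section \<open>Gaussian binomial coefficients\<close>

text \<open>
  \<open>q\<close> may be a root of unity, so the quotient of factorials must be formed for an indeterminate
  and only the resulting Laurent polynomial may be evaluated.  The computation takes place in
  the field of formal Laurent series.
\<close>

definition qint :: "nat \<Rightarrow> 'k::field fls" where
  "qint m = (fls_X ^ m - fls_X_inv ^ m) / (fls_X - fls_X_inv)"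

definition qfact :: "nat \<Rightarrow> 'k::field fls" where
  "qfact m = (\<Prod>r=1..m. qint r)"

definition qbinom :: "nat \<Rightarrow> nat \<Rightarrow> 'k::field fls" where
  "qbinom m s = qfact m / (qfact s * qfact (m - s))"

text \<open>Meaningful for series with finite support.\<close>

definition laurent_eval :: "'k::field fls \<Rightarrow> 'k \<Rightarrow> 'k" where
  "laurent_eval f x = (\<Sum>r | fls_nth f r \<noteq> 0. fls_nth f r * x powi r)"


section \<open>Associative algebras over a field\<close>

text \<open>
  Algebras are records of type \<^typ>\<open>('k, 'a) module\<close>; the library's locale \<open>algebra\<close> is
  restricted to commutative multiplication.
\<close>

definition scalars :: "('k::field, 'k) module" where
  "scalars = \<lparr>carrier = UNIV, mult = (*), one = 1, zero = 0, add = (+), smult = (*)\<rparr>"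

locale k_algebra = Module.module scalars A + A?: ring A
  for A :: "('k::field, 'a) module" (structure) +
  assumes smult_mult_left:
      "\<lbrakk>x \<in> carrier A; y \<in> carrier A\<rbrakk> \<Longrightarrow> (c \<odot> x) \<otimes> y = c \<odot> (x \<otimes> y)"
    and smult_mult_right:
      "\<lbrakk>x \<in> carrier A; y \<in> carrier A\<rbrakk> \<Longrightarrow> x \<otimes> (c \<odot> y) = c \<odot> (x \<otimes> y)"

definition linear_maps ::
  "('k, 'a) module \<Rightarrow> ('k, 'b) module \<Rightarrow> ('a \<Rightarrow> 'b) set" where
  "linear_maps A B =
     {h \<in> carrier A \<rightarrow> carrier B.
        (\<forall>x\<in>carrier A. \<forall>y\<in>carrier A. h (x \<oplus>\<^bsub>A\<^esub> y) = h x \<oplus>\<^bsub>B\<^esub> h y) \<and>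
        (\<forall>c. \<forall>x\<in>carrier A. h (c \<odot>\<^bsub>A\<^esub> x) = c \<odot>\<^bsub>B\<^esub> h x)}"

definition alg_hom ::
  "('k, 'a) module \<Rightarrow> ('k, 'b) module \<Rightarrow> ('a \<Rightarrow> 'b) set" where
  "alg_hom A B = ring_hom A B \<inter> linear_maps A B"

definition alg_iso ::
  "('k, 'a) module \<Rightarrow> ('k, 'b) module \<Rightarrow> ('a \<Rightarrow> 'b) set" where
  "alg_iso A B = {h \<in> alg_hom A B. bij_betw h (carrier A) (carrier B)}"

definition alg_prod ::
  "('k, 'a) module \<Rightarrow> ('k, 'b) module \<Rightarrow> ('k, 'a \<times> 'b) module" where
  "alg_prod A B =
     ring.extend (RDirProd A B) (module.fields (\<lambda>c (x, y). (c \<odot>\<^bsub>A\<^esub> x, c \<odot>\<^bsub>B\<^esub> y)))"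

text \<open>For a linear subspace \<open>I\<close> that is a two-sided ideal.\<close>

definition alg_quot :: "('k, 'a) module \<Rightarrow> 'a set \<Rightarrow> ('k, 'a set) module" where
  "alg_quot A I =
     ring.extend (A Quot I) (module.fields (\<lambda>c X. \<Union>x\<in>X. I +>\<^bsub>A\<^esub> (c \<odot>\<^bsub>A\<^esub> x)))"

text \<open>The algebra \<open>A e\<close> with identity \<open>e\<close>, for a central idempotent \<open>e\<close>.\<close>

definition idem_component :: "('k, 'a) module \<Rightarrow> 'a \<Rightarrow> ('k, 'a) module" where
  "idem_component A e = A\<lparr>carrier := {x \<otimes>\<^bsub>A\<^esub> e | x. x \<in> carrier A}, one := e\<rparr>"

text \<open>\<open>A = B \<oplus> C\<close> as algebras, for \<open>B\<close>, \<open>C\<close> with the operations, but not the identity, of \<open>A\<close>.\<close>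

definition alg_direct_sum ::
  "('k::field, 'a) module \<Rightarrow> ('k, 'a) module \<Rightarrow> ('k, 'a) module \<Rightarrow> bool" where
  "alg_direct_sum A B C \<longleftrightarrow>
     k_algebra A \<and> k_algebra B \<and> k_algebra C \<and>
     ideal (carrier B) A \<and> ideal (carrier C) A \<and>
     (\<lambda>(x, y). x \<oplus>\<^bsub>A\<^esub> y) \<in> alg_iso (alg_prod B C) A"


section \<open>Algebras given by generators and relations\<close>

text \<open>The free monoid, written additively as required for the monoid algebra \<^typ>\<open>'m \<Rightarrow>\<^sub>0 'k\<close>.\<close>

datatype 'x fword = FWord (letters: "'x list")

instantiation fword :: (type) monoid_add
begin

definition zero_fword :: "'a fword" where
  "0 = FWord []"

definition plus_fword :: "'a fword \<Rightarrow> 'a fword \<Rightarrow> 'a fword" where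
  "u + v = FWord (letters u @ letters v)"

instance
  by standard (simp_all add: zero_fword_def plus_fword_def)

end

definition pm_scale :: "'k::field \<Rightarrow> ('m \<Rightarrow>\<^sub>0 'k) \<Rightarrow> ('m \<Rightarrow>\<^sub>0 'k)" where
  "pm_scale c f = Poly_Mapping.map ((*) c) f"

lemma lookup_pm_scale [simp]: "Poly_Mapping.lookup (pm_scale c f) x = c * Poly_Mapping.lookup f x"
  unfolding pm_scale_def by transfer (simp add: Poly_Mapping.when_def)

global_interpretation pm: vector_space "pm_scale :: 'k::field \<Rightarrow> ('m \<Rightarrow>\<^sub>0 'k) \<Rightarrow> ('m \<Rightarrow>\<^sub>0 'k)"
  by standard (auto intro!: poly_mapping_eqI simp: Poly_Mapping.lookup_add algebra_simps)

definition free_algebra :: "('k::field, 'x fword \<Rightarrow>\<^sub>0 'k) module" where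
  "free_algebra =
     \<lparr>carrier = UNIV, mult = (*), one = 1, zero = 0, add = (+), smult = pm_scale\<rparr>"

definition letter :: "'x \<Rightarrow> ('x fword \<Rightarrow>\<^sub>0 'k::field)" where
  "letter x = Poly_Mapping.single (FWord [x]) 1"

definition presented_algebra ::
  "('x fword \<Rightarrow>\<^sub>0 'k::field) set \<Rightarrow> ('k, ('x fword \<Rightarrow>\<^sub>0 'k) set) module" where
  "presented_algebra P = alg_quot free_algebra (Idl\<^bsub>free_algebra\<^esub> P)"

definition presented_gen ::
  "('x fword \<Rightarrow>\<^sub>0 'k::field) set \<Rightarrow> 'x \<Rightarrow> ('x fword \<Rightarrow>\<^sub>0 'k) set" where
  "presented_gen P x = Idl\<^bsub>free_algebra\<^esub> P +>\<^bsub>free_algebra\<^esub> letter x"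


section \<open>Tensor products\<close>

text \<open>
  \<open>A \<otimes> B\<close> is the free vector space on \<open>carrier A \<times> carrier B\<close> modulo the span of the bilinearity
  relations; the multiplication extends \<open>(a, b) (a', b') = (a a', b b')\<close>.
\<close>

definition pair_algebra ::
  "('k::field, 'a) module \<Rightarrow> ('k, 'b) module \<Rightarrow> ('k, 'a \<times> 'b \<Rightarrow>\<^sub>0 'k) module" where
  "pair_algebra A B =
     \<lparr>carrier = {f. Poly_Mapping.keys f \<subseteq> carrier A \<times> carrier B},
      mult = (\<lambda>f g. \<Sum>(a, b)\<in>Poly_Mapping.keys f. \<Sum>(a', b')\<in>Poly_Mapping.keys g.
        Poly_Mapping.single (a \<otimes>\<^bsub>A\<^esub> a', b \<otimes>\<^bsub>B\<^esub> b')
          (Poly_Mapping.lookup f (a, b) * Poly_Mapping.lookup g (a', b'))),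
      one = Poly_Mapping.single (\<one>\<^bsub>A\<^esub>, \<one>\<^bsub>B\<^esub>) 1,
      zero = 0, add = (+), smult = pm_scale\<rparr>"

inductive_set bilinear_rels ::
  "('k::field, 'a) module \<Rightarrow> ('k, 'b) module \<Rightarrow> ('a \<times> 'b \<Rightarrow>\<^sub>0 'k) set"
  for A :: "('k, 'a) module" and B :: "('k, 'b) module" where
  "\<lbrakk>a \<in> carrier A; a' \<in> carrier A; b \<in> carrier B\<rbrakk> \<Longrightarrow>
     Poly_Mapping.single (a \<oplus>\<^bsub>A\<^esub> a', b) 1
       - (Poly_Mapping.single (a, b) 1 + Poly_Mapping.single (a', b) 1) \<in> bilinear_rels A B"
| "\<lbrakk>a \<in> carrier A; b \<in> carrier B; b' \<in> carrier B\<rbrakk> \<Longrightarrow>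
     Poly_Mapping.single (a, b \<oplus>\<^bsub>B\<^esub> b') 1
       - (Poly_Mapping.single (a, b) 1 + Poly_Mapping.single (a, b') 1) \<in> bilinear_rels A B"
| "\<lbrakk>a \<in> carrier A; b \<in> carrier B\<rbrakk> \<Longrightarrow>
     Poly_Mapping.single (c \<odot>\<^bsub>A\<^esub> a, b) 1 - Poly_Mapping.single (a, b) c \<in> bilinear_rels A B"
| "\<lbrakk>a \<in> carrier A; b \<in> carrier B\<rbrakk> \<Longrightarrow>
     Poly_Mapping.single (a, c \<odot>\<^bsub>B\<^esub> b) 1 - Poly_Mapping.single (a, b) c \<in> bilinear_rels A B"

definition tensor ::
  "('k::field, 'a) module \<Rightarrow> ('k, 'b) module \<Rightarrow> ('k, ('a \<times> 'b \<Rightarrow>\<^sub>0 'k) set) module" where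
  "tensor A B = alg_quot (pair_algebra A B) (pm.span (bilinear_rels A B))"

definition tens ::
  "('k::field, 'a) module \<Rightarrow> ('k, 'b) module \<Rightarrow> 'a \<Rightarrow> 'b \<Rightarrow> ('a \<times> 'b \<Rightarrow>\<^sub>0 'k) set" where
  "tens A B a b = pm.span (bilinear_rels A B) +>\<^bsub>pair_algebra A B\<^esub> Poly_Mapping.single (a, b) 1"

text \<open>
  The linear map \<open>A \<otimes> B \<rightarrow> C\<close> induced by a bilinear \<open>h\<close>, computed on an arbitrary
  representative of the coset \<open>X\<close>.
\<close>

definition tensor_lift ::
  "('k::field, 'c) module \<Rightarrow> ('a \<Rightarrow> 'b \<Rightarrow> 'c) \<Rightarrow> ('a \<times> 'b \<Rightarrow>\<^sub>0 'k) set \<Rightarrow> 'c" where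
  "tensor_lift C h X =
     (let f = (SOME f. f \<in> X) in
      \<Oplus>\<^bsub>C\<^esub>p\<in>Poly_Mapping.keys f. Poly_Mapping.lookup f p \<odot>\<^bsub>C\<^esub> h (fst p) (snd p))"

text \<open>\<open>g \<otimes> h\<close>, where \<open>C\<close> and \<open>D\<close> are the codomains of \<open>g\<close> and \<open>h\<close>.\<close>

definition tensor_map ::
  "('k::field, 'c) module \<Rightarrow> ('k, 'd) module \<Rightarrow> ('a \<Rightarrow> 'c) \<Rightarrow> ('b \<Rightarrow> 'd)
     \<Rightarrow> ('a \<times> 'b \<Rightarrow>\<^sub>0 'k) set \<Rightarrow> ('c \<times> 'd \<Rightarrow>\<^sub>0 'k) set" where
  "tensor_map C D g h = tensor_lift (tensor C D) (\<lambda>a b. tens C D (g a) (h b))"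

text \<open>The canonical map \<open>(A \<otimes> B) \<otimes> C \<rightarrow> A \<otimes> (B \<otimes> C)\<close>.\<close>

definition tensor_assoc ::
  "('k::field, 'a) module \<Rightarrow> ('k, 'b) module \<Rightarrow> ('k, 'c) module
     \<Rightarrow> (('a \<times> 'b \<Rightarrow>\<^sub>0 'k) set \<times> 'c \<Rightarrow>\<^sub>0 'k) set
     \<Rightarrow> ('a \<times> ('b \<times> 'c \<Rightarrow>\<^sub>0 'k) set \<Rightarrow>\<^sub>0 'k) set" where
  "tensor_assoc A B C =
     tensor_lift (tensor A (tensor B C))
       (\<lambda>t c. tensor_lift (tensor A (tensor B C))
                (\<lambda>a b. tens A (tensor B C) a (tens B C b c)) t)"


section \<open>Hopf algebras\<close>

locale hopf_algebra = k_algebra A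
  for A :: "('k::field, 'a) module" (structure) +
  fixes comult :: "'a \<Rightarrow> ('a \<times> 'a \<Rightarrow>\<^sub>0 'k) set"
    and counit :: "'a \<Rightarrow> 'k"
    and antipode :: "'a \<Rightarrow> 'a"
  assumes comult_hom: "comult \<in> alg_hom A (tensor A A)"
    and counit_hom: "counit \<in> alg_hom A scalars"
    and antipode_linear: "antipode \<in> linear_maps A A"
    and coassoc: "x \<in> carrier A \<Longrightarrow>
      tensor_assoc A A A (tensor_map (tensor A A) A comult id (comult x))
        = tensor_map A (tensor A A) id comult (comult x)"
    and counit_left: "x \<in> carrier A \<Longrightarrow>
      tensor_lift A (\<lambda>a b. counit a \<odot> b) (comult x) = x"
    and counit_right: "x \<in> carrier A \<Longrightarrow>
      tensor_lift A (\<lambda>a b. counit b \<odot> a) (comult x) = x"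
    and antipode_left: "x \<in> carrier A \<Longrightarrow>
      tensor_lift A (\<lambda>a b. antipode a \<otimes> b) (comult x) = counit x \<odot> \<one>"
    and antipode_right: "x \<in> carrier A \<Longrightarrow>
      tensor_lift A (\<lambda>a b. a \<otimes> antipode b) (comult x) = counit x \<odot> \<one>"

definition hopf_iso ::
  "('k::field, 'a) module \<Rightarrow> ('a \<Rightarrow> ('a \<times> 'a \<Rightarrow>\<^sub>0 'k) set) \<Rightarrow> ('a \<Rightarrow> 'k) \<Rightarrow> ('a \<Rightarrow> 'a)
   \<Rightarrow> ('k, 'b) module \<Rightarrow> ('b \<Rightarrow> ('b \<times> 'b \<Rightarrow>\<^sub>0 'k) set) \<Rightarrow> ('b \<Rightarrow> 'k) \<Rightarrow> ('b \<Rightarrow> 'b)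
   \<Rightarrow> ('a \<Rightarrow> 'b) set" where
  "hopf_iso A \<Delta> \<epsilon> S B \<Delta>' \<epsilon>' S' =
     {\<phi> \<in> alg_iso A B. \<forall>x\<in>carrier A.
        \<Delta>' (\<phi> x) = tensor_map B B \<phi> \<phi> (\<Delta> x) \<and> \<epsilon>' (\<phi> x) = \<epsilon> x \<and> S' (\<phi> x) = \<phi> (S x)}"


section \<open>Quantum groups and weak quantum algebras\<close>

text \<open>The left-hand side of the quantum Serre relation for \<open>x = E i\<close>, \<open>y = E j\<close>, \<open>m = 1 - a i j\<close>.\<close>

definition serre :: "'k::field \<Rightarrow> nat \<Rightarrow> ('x fword \<Rightarrow>\<^sub>0 'k) \<Rightarrow> ('x fword \<Rightarrow>\<^sub>0 'k) \<Rightarrow> ('x fword \<Rightarrow>\<^sub>0 'k)"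
  where
  "serre c m x y =
     (\<Sum>s=0..m. pm_scale ((-1) ^ s * laurent_eval (qbinom m s) c) (x ^ (m - s) * y * x ^ s))"

datatype 'i ugen = Ue 'i | Uf 'i | Uk 'i | Ukinv 'i

inductive_set Uq_rels ::
  "('i \<Rightarrow> 'v::euclidean_space) \<Rightarrow> 'k::field \<Rightarrow> ('i ugen fword \<Rightarrow>\<^sub>0 'k) set"
  for \<alpha> :: "'i \<Rightarrow> 'v" and q :: 'k where
  "letter (Uk i) * letter (Uk j) - letter (Uk j) * letter (Uk i) \<in> Uq_rels \<alpha> q"
| "letter (Uk i) * letter (Ukinv i) - 1 \<in> Uq_rels \<alpha> q"
| "letter (Ukinv i) * letter (Uk i) - 1 \<in> Uq_rels \<alpha> q"
| "letter (Uk i) * letter (Ue j) * letter (Ukinv i)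
     - pm_scale (qpar \<alpha> q i powi cartan \<alpha> i j) (letter (Ue j)) \<in> Uq_rels \<alpha> q"
| "letter (Uk i) * letter (Uf j) * letter (Ukinv i)
     - pm_scale (qpar \<alpha> q i powi (- cartan \<alpha> i j)) (letter (Uf j)) \<in> Uq_rels \<alpha> q"
| "letter (Ue i) * letter (Uf j) - letter (Uf j) * letter (Ue i)
     - pm_scale (if i = j then 1 / (qpar \<alpha> q i - inverse (qpar \<alpha> q i)) else 0)
         (letter (Uk i) - letter (Ukinv i)) \<in> Uq_rels \<alpha> q"
| "i \<noteq> j \<Longrightarrow>
   serre (qpar \<alpha> q i) (nat (1 - cartan \<alpha> i j)) (letter (Ue i)) (letter (Ue j)) \<in> Uq_rels \<alpha> q"
| "i \<noteq> j \<Longrightarrow>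
   serre (qpar \<alpha> q i) (nat (1 - cartan \<alpha> i j)) (letter (Uf i)) (letter (Uf j)) \<in> Uq_rels \<alpha> q"

abbreviation Uq ::
  "('i \<Rightarrow> 'v::euclidean_space) \<Rightarrow> 'k::field \<Rightarrow> ('k, ('i ugen fword \<Rightarrow>\<^sub>0 'k) set) module" where
  "Uq \<alpha> q \<equiv> presented_algebra (Uq_rels \<alpha> q)"

datatype 'i wgen = WE 'i | WF 'i | WK 'i | WKbar 'i | WJ

text \<open>
  The defining binary sequence is given by \<open>\<kappa>\<close> and \<open>\<kappa>'\<close>, with \<^const>\<open>True\<close> for 1: \<open>E i\<close> is of type 1
  iff \<open>\<kappa> i\<close>, and \<open>F i\<close> is of type 1 iff \<open>\<kappa>' i\<close>.
\<close>

inductive_set weak_rels ::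
  "('i \<Rightarrow> 'v::euclidean_space) \<Rightarrow> 'k::field \<Rightarrow> ('i \<Rightarrow> bool) \<Rightarrow> ('i \<Rightarrow> bool)
     \<Rightarrow> ('i wgen fword \<Rightarrow>\<^sub>0 'k) set"
  for \<alpha> :: "'i \<Rightarrow> 'v" and q :: 'k and \<kappa> \<kappa>' :: "'i \<Rightarrow> bool" where
  "letter WJ - letter (WK i) * letter (WKbar i) \<in> weak_rels \<alpha> q \<kappa> \<kappa>'"
| "letter (WK i) * letter (WKbar j) - letter (WKbar j) * letter (WK i) \<in> weak_rels \<alpha> q \<kappa> \<kappa>'"
| "letter (WK i) * letter (WK j) - letter (WK j) * letter (WK i) \<in> weak_rels \<alpha> q \<kappa> \<kappa>'"
| "letter (WKbar i) * letter (WKbar j) - letter (WKbar j) * letter (WKbar i)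
     \<in> weak_rels \<alpha> q \<kappa> \<kappa>'"
| "letter WJ * letter (WK i) - letter (WK i) \<in> weak_rels \<alpha> q \<kappa> \<kappa>'"
| "letter WJ * letter (WKbar i) - letter (WKbar i) \<in> weak_rels \<alpha> q \<kappa> \<kappa>'"
| "\<kappa> i \<Longrightarrow>
   letter (WK j) * letter (WE i)
     - pm_scale (qpar \<alpha> q i powi cartan \<alpha> i j) (letter (WE i) * letter (WK j))
     \<in> weak_rels \<alpha> q \<kappa> \<kappa>'"
| "\<kappa> i \<Longrightarrow>
   letter (WE i) * letter (WKbar j)
     - pm_scale (qpar \<alpha> q i powi cartan \<alpha> i j) (letter (WKbar j) * letter (WE i))
     \<in> weak_rels \<alpha> q \<kappa> \<kappa>'"
| "\<not> \<kappa> i \<Longrightarrow>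
   letter (WK j) * letter (WE i) * letter (WKbar j)
     - pm_scale (qpar \<alpha> q i powi cartan \<alpha> i j) (letter (WE i)) \<in> weak_rels \<alpha> q \<kappa> \<kappa>'"
| "\<kappa>' i \<Longrightarrow>
   letter (WK j) * letter (WF i)
     - pm_scale (qpar \<alpha> q i powi (- cartan \<alpha> i j)) (letter (WF i) * letter (WK j))
     \<in> weak_rels \<alpha> q \<kappa> \<kappa>'"
| "\<kappa>' i \<Longrightarrow>
   letter (WF i) * letter (WKbar j)
     - pm_scale (qpar \<alpha> q i powi (- cartan \<alpha> i j)) (letter (WKbar j) * letter (WF i))
     \<in> weak_rels \<alpha> q \<kappa> \<kappa>'"
| "\<not> \<kappa>' i \<Longrightarrow>
   letter (WK j) * letter (WF i) * letter (WKbar j)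
     - pm_scale (qpar \<alpha> q i powi (- cartan \<alpha> i j)) (letter (WF i)) \<in> weak_rels \<alpha> q \<kappa> \<kappa>'"
| "letter (WE i) * letter (WF j) - letter (WF j) * letter (WE i)
     - pm_scale (if i = j then 1 / (qpar \<alpha> q i - inverse (qpar \<alpha> q i)) else 0)
         (letter (WK i) - letter (WKbar i)) \<in> weak_rels \<alpha> q \<kappa> \<kappa>'"
| "i \<noteq> j \<Longrightarrow>
   serre (qpar \<alpha> q i) (nat (1 - cartan \<alpha> i j)) (letter (WE i)) (letter (WE j))
     \<in> weak_rels \<alpha> q \<kappa> \<kappa>'"
| "i \<noteq> j \<Longrightarrow>
   serre (qpar \<alpha> q i) (nat (1 - cartan \<alpha> i j)) (letter (WF i)) (letter (WF j))
     \<in> weak_rels \<alpha> q \<kappa> \<kappa>'"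

abbreviation weak_alg ::
  "('i \<Rightarrow> 'v::euclidean_space) \<Rightarrow> 'k::field \<Rightarrow> ('i \<Rightarrow> bool) \<Rightarrow> ('i \<Rightarrow> bool)
     \<Rightarrow> ('k, ('i wgen fword \<Rightarrow>\<^sub>0 'k) set) module" where
  "weak_alg \<alpha> q \<kappa> \<kappa>' \<equiv> presented_algebra (weak_rels \<alpha> q \<kappa> \<kappa>')"

abbreviation weak_gen ::
  "('i \<Rightarrow> 'v::euclidean_space) \<Rightarrow> 'k::field \<Rightarrow> ('i \<Rightarrow> bool) \<Rightarrow> ('i \<Rightarrow> bool)
     \<Rightarrow> 'i wgen \<Rightarrow> ('i wgen fword \<Rightarrow>\<^sub>0 'k) set" where
  "weak_gen \<alpha> q \<kappa> \<kappa>' \<equiv> presented_gen (weak_rels \<alpha> q \<kappa> \<kappa>')"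

definition wq ::
  "('i \<Rightarrow> 'v::euclidean_space) \<Rightarrow> 'k::field \<Rightarrow> ('i \<Rightarrow> bool) \<Rightarrow> ('i \<Rightarrow> bool)
     \<Rightarrow> ('k, ('i wgen fword \<Rightarrow>\<^sub>0 'k) set) module" where
  "wq \<alpha> q \<kappa> \<kappa>' = idem_component (weak_alg \<alpha> q \<kappa> \<kappa>') (weak_gen \<alpha> q \<kappa> \<kappa>' WJ)"

definition wq_bar ::
  "('i \<Rightarrow> 'v::euclidean_space) \<Rightarrow> 'k::field \<Rightarrow> ('i \<Rightarrow> bool) \<Rightarrow> ('i \<Rightarrow> bool)
     \<Rightarrow> ('k, ('i wgen fword \<Rightarrow>\<^sub>0 'k) set) module" where
  "wq_bar \<alpha> q \<kappa> \<kappa>' =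
     idem_component (weak_alg \<alpha> q \<kappa> \<kappa>')
       (\<one>\<^bsub>weak_alg \<alpha> q \<kappa> \<kappa>'\<^esub> \<ominus>\<^bsub>weak_alg \<alpha> q \<kappa> \<kappa>'\<^esub> weak_gen \<alpha> q \<kappa> \<kappa>' WJ)"

text \<open>
  A Hopf algebra structure on a presented algebra is determined by its values on generators; the
  following two predicates single out the structures meant in the statement.
\<close>

definition Uq_hopf_structure ::
  "('i \<Rightarrow> 'v::euclidean_space) \<Rightarrow> 'k::field
   \<Rightarrow> (('i ugen fword \<Rightarrow>\<^sub>0 'k) set
        \<Rightarrow> (('i ugen fword \<Rightarrow>\<^sub>0 'k) set \<times> ('i ugen fword \<Rightarrow>\<^sub>0 'k) set \<Rightarrow>\<^sub>0 'k) set)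
   \<Rightarrow> (('i ugen fword \<Rightarrow>\<^sub>0 'k) set \<Rightarrow> 'k)
   \<Rightarrow> (('i ugen fword \<Rightarrow>\<^sub>0 'k) set \<Rightarrow> ('i ugen fword \<Rightarrow>\<^sub>0 'k) set) \<Rightarrow> bool" where
  "Uq_hopf_structure \<alpha> q \<Delta> \<epsilon> S \<longleftrightarrow>
     (let U = Uq \<alpha> q; T = tensor U U; t = tens U U;
          e = (\<lambda>i. presented_gen (Uq_rels \<alpha> q) (Ue i));
          f = (\<lambda>i. presented_gen (Uq_rels \<alpha> q) (Uf i));
          k = (\<lambda>i. presented_gen (Uq_rels \<alpha> q) (Uk i));
          k' = (\<lambda>i. presented_gen (Uq_rels \<alpha> q) (Ukinv i))
      in hopf_algebra U \<Delta> \<epsilon> S \<and>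
         (\<forall>i. \<Delta> (k i) = t (k i) (k i) \<and>
              \<Delta> (e i) = t \<one>\<^bsub>U\<^esub> (e i) \<oplus>\<^bsub>T\<^esub> t (e i) (k i) \<and>
              \<Delta> (f i) = t (f i) \<one>\<^bsub>U\<^esub> \<oplus>\<^bsub>T\<^esub> t (k' i) (f i) \<and>
              \<epsilon> (k i) = 1 \<and> \<epsilon> (e i) = 0 \<and> \<epsilon> (f i) = 0 \<and>
              S (k i) = k' i \<and>
              S (e i) = \<ominus>\<^bsub>U\<^esub> (e i \<otimes>\<^bsub>U\<^esub> k' i) \<and>
              S (f i) = \<ominus>\<^bsub>U\<^esub> (k i \<otimes>\<^bsub>U\<^esub> f i)))"

definition wq_hopf_structure ::
  "('i \<Rightarrow> 'v::euclidean_space) \<Rightarrow> 'k::field \<Rightarrow> ('i \<Rightarrow> bool) \<Rightarrow> ('i \<Rightarrow> bool)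
   \<Rightarrow> (('i wgen fword \<Rightarrow>\<^sub>0 'k) set
        \<Rightarrow> (('i wgen fword \<Rightarrow>\<^sub>0 'k) set \<times> ('i wgen fword \<Rightarrow>\<^sub>0 'k) set \<Rightarrow>\<^sub>0 'k) set)
   \<Rightarrow> (('i wgen fword \<Rightarrow>\<^sub>0 'k) set \<Rightarrow> 'k)
   \<Rightarrow> (('i wgen fword \<Rightarrow>\<^sub>0 'k) set \<Rightarrow> ('i wgen fword \<Rightarrow>\<^sub>0 'k) set) \<Rightarrow> bool" where
  "wq_hopf_structure \<alpha> q \<kappa> \<kappa>' \<Delta> \<epsilon> S \<longleftrightarrow>
     (let W = wq \<alpha> q \<kappa> \<kappa>'; T = tensor W W; t = tens W W;
          J = weak_gen \<alpha> q \<kappa> \<kappa>' WJ;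
          EJ = (\<lambda>i. weak_gen \<alpha> q \<kappa> \<kappa>' (WE i) \<otimes>\<^bsub>weak_alg \<alpha> q \<kappa> \<kappa>'\<^esub> J);
          FJ = (\<lambda>i. weak_gen \<alpha> q \<kappa> \<kappa>' (WF i) \<otimes>\<^bsub>weak_alg \<alpha> q \<kappa> \<kappa>'\<^esub> J);
          K = (\<lambda>i. weak_gen \<alpha> q \<kappa> \<kappa>' (WK i));
          K' = (\<lambda>i. weak_gen \<alpha> q \<kappa> \<kappa>' (WKbar i))
      in hopf_algebra W \<Delta> \<epsilon> S \<and>
         (\<forall>i. \<Delta> (EJ i) = t J (EJ i) \<oplus>\<^bsub>T\<^esub> t (EJ i) (K i) \<and>
              \<Delta> (FJ i) = t (FJ i) J \<oplus>\<^bsub>T\<^esub> t (K' i) (FJ i) \<and>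
              \<Delta> (K i) = t (K i) (K i) \<and>
              \<Delta> (K' i) = t (K' i) (K' i) \<and>
              \<epsilon> (EJ i) = 0 \<and> \<epsilon> (FJ i) = 0 \<and> \<epsilon> (K i) = 1 \<and> \<epsilon> (K' i) = 1 \<and>
              S (EJ i) = \<ominus>\<^bsub>W\<^esub> (EJ i \<otimes>\<^bsub>W\<^esub> K' i) \<and>
              S (FJ i) = \<ominus>\<^bsub>W\<^esub> (K i \<otimes>\<^bsub>W\<^esub> FJ i) \<and>
              S (K i) = K' i \<and>
              S (K' i) = K i))"

end

theory Submission
  imports Defs
begin

text \<open>Write \<open>w\<close> for the weak algebra and \<open>U\<close> for the quantum group.  The relations say that
  \<open>J = K i * Kbar i\<close> acts as identity on all \<open>K i\<close> and \<open>Kbar i\<close>.  If \<open>E i\<close> is of type 1, it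
  twist-commutes with \<open>K j\<close> and \<open>Kbar j\<close> with cancelling factors; if it is of type 2, it is a multiple of
  \<open>K j * E i * Kbar j\<close>.  Either way it commutes with \<open>J\<close>, so \<open>J\<close> is a central idempotent, and the
  decomposition of \<open>w\<close> is the Peirce decomposition (\<open>direct_sum\<close>).

  For the isomorphism both algebras are compared through their presentations.  A family
  \<open>E, F, K, K'\<close> of elements of an algebra \<open>B\<close> that satisfies the relations of \<open>U\<close>
  (locale \<open>uq_tuple\<close>) is the same as a homomorphism \<open>U \<rightarrow> B\<close>, and it also yields a homomorphism
  \<open>w \<rightarrow> B\<close> with \<open>J \<mapsto> 1\<close>.  On \<open>wJ\<close> the two types of generators satisfy the same conjugation formula, so
  \<open>E i J, F i J, K i, Kbar i\<close> is such a family in \<open>wJ\<close>.  The resulting maps between \<open>wJ\<close> and \<open>U\<close> are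
  inverse to each other on generators (\<open>W_iso_U\<close>).  Comparing the relations requires
  \<open>q i ^ a i j = q j ^ a j i\<close>, that is, the symmetry of \<open>d i * a i j\<close>; the norms of the roots have to be
  shown to be even integers for this (\<open>half_norm_eq\<close>).

  The Hopf structures have to be constructed.  Comultiplication, counit and antipode are homomorphisms from
  \<open>U\<close> to \<open>B \<otimes> B\<close>, to the field and to the opposite algebra of \<open>B\<close>, so each of them is given by a family in
  the respective target that again satisfies the relations of \<open>U\<close>.  This is done for an arbitrary family in
  \<open>B\<close>, which covers \<open>U\<close> and \<open>wJ\<close> at once.  The Hopf axioms then follow from their validity on generators,
  each of which is grouplike or skew primitive (\<open>hopf_on_generators\<close>).

  The only hard relations are the quantum Serre relations for the comultiplied generators.  By the
  \<open>q\<close>-binomial theorem (\<open>qad_free_gauss\<close>) the Serre operator \<open>y \<mapsto> \<Sum>\<plusminus>[m s] x ^ (m - s) * y * x ^ s\<close> is a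
  product of \<open>m\<close> commuting twisted commutators \<open>y \<mapsto> x * y - t r * y * x\<close>, with \<open>t r\<close> running through
  \<open>q i ^ (1 - m), q i ^ (3 - m), \<dots>, q i ^ (m - 1)\<close>, in either direction.  Now \<open>\<Delta>(E i) = a + b\<close> and
  \<open>\<Delta>(E j) = y + z\<close>, where \<open>a = 1 \<otimes> E i\<close> and \<open>b = E i \<otimes> K i\<close> commute up to the factor \<open>q i ^ 2\<close>, and
  likewise \<open>y = 1 \<otimes> E j\<close> and \<open>z = E j \<otimes> K j\<close> with \<open>b\<close> and \<open>a\<close> up to \<open>q i ^ a i j\<close>.  If the factors are
  applied to \<open>y\<close> in increasing order, the contribution of \<open>b\<close> vanishes at each step; if they are applied to
  \<open>z\<close> in decreasing order, that of \<open>a\<close> does (\<open>qad_absorb\<close>, \<open>qad_sum_zero\<close>).  What remains are the Serre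
  relations for \<open>(a, y)\<close> and \<open>(b, z)\<close>, which hold because they hold for \<open>(E i, E j)\<close>.  No coefficient is
  expanded, and the argument is valid at roots of unity.\<close>

section \<open>Norms of roots and the Cartan matrix\<close>

lemma simple_rootD:
  assumes "simple_root_data R \<alpha>"
  shows "\<alpha> i \<in> R" "\<alpha> i \<noteq> 0"
proof -
  show "\<alpha> i \<in> R" using assms by (auto simp: simple_root_data_def simple_roots_def)
  then show "\<alpha> i \<noteq> 0" using assms by (auto simp: simple_root_data_def reduced_root_system_def)
qed

lemma cartan_eq:
  assumes "simple_root_data R \<alpha>"
  shows "of_int (cartan \<alpha> i j) = 2 * (\<alpha> i \<bullet> \<alpha> j) / (\<alpha> i \<bullet> \<alpha> i)"
proof -
  have "2 * (\<alpha> i \<bullet> \<alpha> j) / (\<alpha> i \<bullet> \<alpha> i) \<in> \<int>"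
    using assms simple_rootD[OF assms]
    by (auto simp: simple_root_data_def reduced_root_system_def)
  then show ?thesis
    unfolding cartan_def by (metis Ints_cases floor_of_int)
qed

lemma cartan_diag:
  assumes "simple_root_data R \<alpha>"
  shows "cartan \<alpha> i i = 2"
  using cartan_eq[OF assms, of i i] simple_rootD(2)[OF assms, of i] by simp

text \<open>Reflecting \<open>\<alpha> j\<close> in \<open>\<alpha> i\<close> would otherwise give a root with coefficients of both signs.\<close>

lemma cartan_nonpos:
  fixes \<alpha> :: "'i::finite \<Rightarrow> 'v::euclidean_space"
  assumes R: "simple_root_data R \<alpha>" and "i \<noteq> j"
  shows "cartan \<alpha> i j \<le> 0"
proof (rule ccontr)
  assume "\<not> ?thesis"
  then have pos: "cartan \<alpha> i j > 0" by simp
  have sr: "simple_roots R \<alpha>" and rr: "reduced_root_system R"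
    using R by (auto simp: simple_root_data_def)
  have inj: "inj \<alpha>" and ind: "independent (range \<alpha>)"
    using sr by (auto simp: simple_roots_def)
  define \<beta> where "\<beta> = \<alpha> j - of_int (cartan \<alpha> i j) *\<^sub>R \<alpha> i"
  have "\<beta> \<in> R"
    using rr simple_rootD(1)[OF R] unfolding \<beta>_def cartan_eq[OF R] reduced_root_system_def by blast
  then obtain c :: "'i \<Rightarrow> nat" where
    c: "\<beta> = (\<Sum>l\<in>UNIV. real (c l) *\<^sub>R \<alpha> l) \<or> \<beta> = - (\<Sum>l\<in>UNIV. real (c l) *\<^sub>R \<alpha> l)"
    using sr by (auto simp: simple_roots_def)
  \<comment> \<open>By independence the coefficients of \<open>\<beta>\<close> are \<open>1\<close> at \<open>j\<close> and negative at \<open>i\<close>.\<close>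
  have coord: "f i = - of_int (cartan \<alpha> i j) \<and> f j = 1"
    if f: "\<beta> = (\<Sum>l\<in>UNIV. f l *\<^sub>R \<alpha> l)" for f :: "'i \<Rightarrow> real"
  proof -
    define g where "g l = f l - (if l = j then 1 else 0) + (if l = i then of_int (cartan \<alpha> i j) else 0)" for l
    have "(\<Sum>l\<in>UNIV. g l *\<^sub>R \<alpha> l) = \<beta> - \<alpha> j + of_int (cartan \<alpha> i j) *\<^sub>R \<alpha> i"
      unfolding g_def f
      by (simp add: algebra_simps sum.distrib sum_subtractf if_distrib[of "\<lambda>x. x *\<^sub>R _"] cong: if_cong)
    then have z: "(\<Sum>l\<in>UNIV. g l *\<^sub>R \<alpha> l) = 0"
      by (simp add: \<beta>_def)
    have "(\<Sum>v\<in>range \<alpha>. g (inv_into UNIV \<alpha> v) *\<^sub>R v) = (\<Sum>l\<in>UNIV. g l *\<^sub>R \<alpha> l)"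
      using inj by (subst sum.reindex) (auto simp: inv_f_f)
    then have "(\<Sum>v\<in>range \<alpha>. g (inv_into UNIV \<alpha> v) *\<^sub>R v) = 0" using z by simp
    then have "g (inv_into UNIV \<alpha> v) = 0" if "v \<in> range \<alpha>" for v
      using ind that by (subst (asm) dependent_finite) auto
    then have "g l = 0" for l
      using inj by (metis inv_f_f rangeI)
    from this[of i] this[of j] show ?thesis
      using \<open>i \<noteq> j\<close> by (auto simp: g_def)
  qed
  from c show False
  proof
    assume "\<beta> = (\<Sum>l\<in>UNIV. real (c l) *\<^sub>R \<alpha> l)"
    from coord[OF this] pos show False by linarith
  next
    assume "\<beta> = - (\<Sum>l\<in>UNIV. real (c l) *\<^sub>R \<alpha> l)"
    then have "\<beta> = (\<Sum>l\<in>UNIV. (- real (c l)) *\<^sub>R \<alpha> l)"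
      by (simp add: sum_negf)
    from coord[OF this] show False
      by linarith
  qed
qed

text \<open>Let \<open>\<sigma>\<close> be a short root that is not orthogonal to the root \<open>b\<close>; it exists by irreducibility.  The two
  Cartan integers \<open>n = b \<bullet> \<sigma>\<close> and \<open>m = 2 * (b \<bullet> \<sigma>) / (b \<bullet> b)\<close> satisfy \<open>\<bar>n * m\<bar> \<le> 4\<close> by Cauchy-Schwarz and
  \<open>\<bar>m\<bar> \<le> \<bar>n\<bar>\<close> because \<open>\<sigma>\<close> is short.  This forces \<open>m dvd n\<close>, and the quotient is \<open>(b \<bullet> b) / 2\<close>.\<close>

lemma half_norm_eq:
  assumes R: "simple_root_data R \<alpha>"
  shows "real (half_norm \<alpha> i) = (\<alpha> i \<bullet> \<alpha> i) / 2"
proof -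
  have rr: "reduced_root_system R" and irr: "irreducible_root_system R"
    and norm: "short_roots_normalized R"
    using R by (auto simp: simple_root_data_def)
  have fin: "finite R" and nz: "\<And>\<beta>. \<beta> \<in> R \<Longrightarrow> \<beta> \<noteq> 0"
    and refl: "\<And>\<beta> \<gamma>. \<beta> \<in> R \<Longrightarrow> \<gamma> \<in> R \<Longrightarrow> \<gamma> - (2 * (\<beta> \<bullet> \<gamma>) / (\<beta> \<bullet> \<beta>)) *\<^sub>R \<beta> \<in> R"
    and int: "\<And>\<beta> \<gamma>. \<beta> \<in> R \<Longrightarrow> \<gamma> \<in> R \<Longrightarrow> 2 * (\<beta> \<bullet> \<gamma>) / (\<beta> \<bullet> \<beta>) \<in> \<int>"
    using rr unfolding reduced_root_system_def by blast+
  define short where "short = {\<beta>\<in>R. \<forall>\<gamma>\<in>R. \<beta> \<bullet> \<beta> \<le> \<gamma> \<bullet> \<gamma>}"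
  have short2: "\<sigma> \<bullet> \<sigma> = 2" if "\<sigma> \<in> short" for \<sigma>
    using norm that by (auto simp: short_roots_normalized_def short_def)
  define R1 where "R1 = {\<beta>\<in>R. \<exists>\<sigma>\<in>short. \<beta> \<bullet> \<sigma> \<noteq> 0}"
  define R2 where "R2 = R - R1"
  have "R \<noteq> {}" using irr by (simp add: irreducible_root_system_def)
  then obtain \<sigma>0 where \<sigma>0: "\<sigma>0 \<in> short"
    using arg_min_if_finite(1)[OF fin, of "\<lambda>\<beta>. \<beta> \<bullet> \<beta>"] arg_min_least[OF fin, of _ "\<lambda>\<beta>. \<beta> \<bullet> \<beta>"]
    unfolding short_def by blast
  then have "\<sigma>0 \<in> R1"
    using short2[OF \<sigma>0] by (auto simp: R1_def short_def intro!: bexI[of _ \<sigma>0])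
  \<comment> \<open>A root orthogonal to all short roots is orthogonal to every root \<open>\<beta>\<close> that is not, because
    reflecting a short root in \<open>\<beta>\<close> gives a short root.\<close>
  have "\<beta> \<bullet> \<gamma> = 0" if \<beta>: "\<beta> \<in> R1" and \<gamma>: "\<gamma> \<in> R2" for \<beta> \<gamma>
  proof -
    from \<beta> obtain \<sigma> where s: "\<sigma> \<in> short" "\<beta> \<bullet> \<sigma> \<noteq> 0" and bR: "\<beta> \<in> R" by (auto simp: R1_def)
    define n where "n = 2 * (\<beta> \<bullet> \<sigma>) / (\<beta> \<bullet> \<beta>)"
    define \<sigma>' where "\<sigma>' = \<sigma> - n *\<^sub>R \<beta>"
    have b0: "\<beta> \<bullet> \<beta> \<noteq> 0" using nz[OF bR] by simp
    have "\<sigma>' \<in> R" using refl[OF bR, of \<sigma>] s by (simp add: \<sigma>'_def n_def short_def)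
    moreover have "\<sigma>' \<bullet> \<sigma>' = \<sigma> \<bullet> \<sigma> - 2 * n * (\<beta> \<bullet> \<sigma>) + n * (n * (\<beta> \<bullet> \<beta>))"
      by (simp add: \<sigma>'_def inner_diff_left inner_diff_right inner_commute algebra_simps)
    moreover have "n * (\<beta> \<bullet> \<beta>) = 2 * (\<beta> \<bullet> \<sigma>)" using b0 by (simp add: n_def)
    ultimately have "\<sigma>' \<in> short" using s by (simp add: short_def)
    then have "\<gamma> \<bullet> \<sigma>' = 0" "\<gamma> \<bullet> \<sigma> = 0" using \<gamma> s by (auto simp: R2_def R1_def)
    then have "n * (\<gamma> \<bullet> \<beta>) = 0" by (simp add: \<sigma>'_def inner_diff_right)
    then show ?thesis using s b0 by (auto simp: n_def inner_commute)
  qed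
  moreover have "R1 \<union> R2 = R" by (auto simp: R1_def R2_def)
  ultimately have "R2 = {}"
    using irr \<open>\<sigma>0 \<in> R1\<close> unfolding irreducible_root_system_def by blast
  then have "\<alpha> i \<in> R1" using simple_rootD(1)[OF R] by (auto simp: R2_def)
  then obtain \<sigma> where s: "\<sigma> \<in> short" "\<alpha> i \<bullet> \<sigma> \<noteq> 0" by (auto simp: R1_def)
  define b where "b = \<alpha> i"
  have bR: "b \<in> R" and sR: "\<sigma> \<in> R" and b0: "b \<bullet> b > 0" and b2: "b \<bullet> b \<ge> 2"
    using simple_rootD[OF R, of i] s short2[OF s(1)] by (auto simp: b_def short_def)
  obtain m :: int where m: "2 * (b \<bullet> \<sigma>) / (b \<bullet> b) = of_int m" using int[OF bR sR] by (auto elim: Ints_cases)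
  obtain n :: int where n: "b \<bullet> \<sigma> = of_int n"
    using int[OF sR bR] short2[OF s(1)] by (auto elim: Ints_cases simp: inner_commute)
  have nm: "2 * of_int n = of_int m * (b \<bullet> b)" using m n b0 by (simp add: field_simps)
  have n0: "n \<noteq> 0" using s n by (auto simp: b_def)
  have "(b \<bullet> \<sigma>)\<^sup>2 \<le> (b \<bullet> b) * (\<sigma> \<bullet> \<sigma>)" by (rule Cauchy_Schwarz_ineq)
  then have CS: "(real_of_int n)\<^sup>2 \<le> 2 * (b \<bullet> b)" using short2[OF s(1)] n by simp
  have m0: "m \<noteq> 0" using nm n0 by auto
  have "real_of_int (\<bar>n\<bar> * \<bar>m\<bar>) \<le> 4"
  proof -
    have "(real_of_int n)\<^sup>2 * \<bar>real_of_int m\<bar> \<le> 2 * (b \<bullet> b) * \<bar>real_of_int m\<bar>"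
      using CS by (rule mult_right_mono) simp
    also have "\<dots> = 2 * \<bar>of_int m * (b \<bullet> b)\<bar>" using b0 by (simp add: abs_mult)
    also have "\<dots> = 4 * \<bar>real_of_int n\<bar>" by (simp flip: nm add: abs_mult)
    also have "(real_of_int n)\<^sup>2 = \<bar>real_of_int n\<bar> * \<bar>real_of_int n\<bar>"
      by (simp add: power2_eq_square)
    finally have "\<bar>real_of_int n\<bar> * (\<bar>real_of_int n\<bar> * \<bar>real_of_int m\<bar>) \<le> \<bar>real_of_int n\<bar> * 4"
      by (simp add: power2_eq_square mult_ac)
    then have "\<bar>real_of_int n\<bar> * \<bar>real_of_int m\<bar> \<le> 4"
      by (rule mult_left_le_imp_le) (use n0 in simp)
    then show ?thesis by simp
  qed
  then have "\<bar>n\<bar> * \<bar>m\<bar> \<le> 4" by linarith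
  have "\<bar>real_of_int m\<bar> * 2 \<le> \<bar>real_of_int m\<bar> * (b \<bullet> b)" using b2 by (intro mult_left_mono) auto
  also have "\<dots> = 2 * \<bar>real_of_int n\<bar>" using nm b0 by (metis abs_mult abs_numeral abs_of_pos)
  finally have "\<bar>m\<bar> \<le> \<bar>n\<bar>" by linarith
  have "m dvd n"
  proof (cases "\<bar>m\<bar> = 1")
    case False
    then have "\<bar>m\<bar> \<ge> 2" using m0 by linarith
    have "\<bar>n\<bar> \<le> 2"
    proof (rule ccontr)
      assume "\<not> ?thesis"
      then have "3 * 2 \<le> \<bar>n\<bar> * \<bar>m\<bar>" using \<open>\<bar>m\<bar> \<ge> 2\<close> by (intro mult_mono) auto
      then show False using \<open>\<bar>n\<bar> * \<bar>m\<bar> \<le> 4\<close> by linarith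
    qed
    then have "\<bar>n\<bar> = \<bar>m\<bar>" using \<open>\<bar>m\<bar> \<ge> 2\<close> \<open>\<bar>m\<bar> \<le> \<bar>n\<bar>\<close> by linarith
    then show ?thesis by (metis abs_dvd_iff dvd_refl dvd_abs_iff)
  qed (metis abs_dvd_iff one_dvd)
  then obtain d where "n = m * d" by (auto simp: dvd_def)
  then have "b \<bullet> b / 2 = of_int d" using nm m0 by simp
  then have "\<alpha> i \<bullet> \<alpha> i / 2 = of_int d" by (simp add: b_def)
  moreover have "d \<ge> 0" using b0 \<open>b \<bullet> b / 2 = of_int d\<close> by (metis divide_nonneg_pos less_le of_int_0_le_iff zero_less_numeral)
  ultimately show ?thesis by (simp add: half_norm_def)
qed

lemma cartan_symmetrizable:
  assumes R: "simple_root_data R \<alpha>"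
  shows "int (half_norm \<alpha> i) * cartan \<alpha> i j = int (half_norm \<alpha> j) * cartan \<alpha> j i"
proof -
  have "real_of_int (int (half_norm \<alpha> i) * cartan \<alpha> i j)
      = real_of_int (int (half_norm \<alpha> j) * cartan \<alpha> j i)"
    using simple_rootD(2)[OF R]
    by (simp add: half_norm_eq[OF R] cartan_eq[OF R] inner_commute)
  then show ?thesis by linarith
qed

text \<open>The weak algebra attaches the exponent \<open>a i j\<close> to \<open>E i\<close>, the quantum group attaches it to \<open>K i\<close>.\<close>

lemma qpar_cartan_sym:
  assumes R: "simple_root_data R \<alpha>"
  shows "qpar \<alpha> q i powi cartan \<alpha> i j = qpar \<alpha> q j powi cartan \<alpha> j i"
proof -
  have "qpar \<alpha> q i powi cartan \<alpha> i j = q powi (int (half_norm \<alpha> i) * cartan \<alpha> i j)" for i j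
    unfolding qpar_def by (simp add: power_int_mult)
  then show ?thesis using cartan_symmetrizable[OF R] by metis
qed

section \<open>Gaussian binomial coefficients\<close>

text \<open>The \<open>q\<close>-Pascal recursion needs no division, so it makes sense for an indeterminate and for a
  root of unity alike and commutes with evaluation.\<close>

fun gauss :: "'k::field \<Rightarrow> nat \<Rightarrow> nat \<Rightarrow> 'k" where
  "gauss x m 0 = 1"
| "gauss x 0 (Suc s) = 0"
| "gauss x (Suc m) (Suc s) = x ^ Suc s * gauss x m (Suc s) + inverse x ^ (m - s) * gauss x m s"

lemma gauss_eq_0: "m < s \<Longrightarrow> gauss x m s = 0"
  by (induction x m s rule: gauss.induct) auto

lemma inverse_fls_X: "inverse (fls_X :: 'k::field fls) = fls_X_inv"
  by (metis fls_X_inv_times_conv_shift(1) fls_X_shift_to_one inverse_unique mult.commute)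

lemma qint_nonzero:
  assumes "m > 0"
  shows "qint m \<noteq> (0 :: 'k::field fls)"
proof -
  have "fls_nth (fls_X ^ m - fls_X_inv ^ m :: 'k fls) (int m) \<noteq> 0" if "m > 0" for m
    using that by (simp add: fls_X_power_conv_shift_1 fls_X_inv_power_conv_shift_1)
  from this[OF assms] this[of 1] show ?thesis
    unfolding qint_def by (metis divide_eq_0_iff fls_zero_nth power_one_right zero_less_one)
qed

text \<open>This is the identity behind the \<open>q\<close>-Pascal rule; the rule holds for \<open>q\<close> and for
  \<open>inverse q\<close>, since \<open>qint\<close> does not distinguish the two.\<close>

lemma qint_add:
  assumes a: "a = (fls_X :: 'k::field fls) \<or> a = fls_X_inv" and "s \<le> m"
  shows "qint (Suc m) = a ^ Suc s * qint (m - s) + inverse a ^ (m - s) * qint (Suc s)"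
proof -
  have aux: "(a ^ Suc m - b ^ Suc m) / (a - b) =
      a ^ Suc s * ((a ^ (m - s) - b ^ (m - s)) / (a - b)) + b ^ (m - s) * ((a ^ Suc s - b ^ Suc s) / (a - b))"
    for a b :: "'k fls"
  proof -
    have "a ^ Suc m = a ^ Suc s * a ^ (m - s)" "b ^ Suc m = b ^ (m - s) * b ^ Suc s"
      using \<open>s \<le> m\<close> by (simp_all flip: power_add)
    then have "a ^ Suc m - b ^ Suc m
        = a ^ Suc s * (a ^ (m - s) - b ^ (m - s)) + b ^ (m - s) * (a ^ Suc s - b ^ Suc s)"
      by (simp add: algebra_simps del: power_Suc)
    then show ?thesis by (simp add: add_divide_distrib del: power_Suc)
  qed
  have sym: "qint m = (fls_X_inv ^ m - fls_X ^ m) / (fls_X_inv - fls_X :: 'k fls)" for m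
    unfolding qint_def by (metis minus_diff_eq minus_divide_divide)
  have inv': "inverse (fls_X_inv :: 'k fls) = fls_X" by (metis inverse_fls_X inverse_inverse_eq)
  from a show ?thesis
  proof
    assume "a = fls_X"
    then show ?thesis unfolding qint_def inverse_fls_X[symmetric] using aux by simp
  next
    assume "a = fls_X_inv"
    then show ?thesis unfolding sym inv' using aux[of fls_X_inv fls_X] by (simp add: inv')
  qed
qed

lemma qfact_nonzero: "qfact m \<noteq> (0 :: 'k::field fls)"
  by (auto simp: qfact_def qint_nonzero)

lemma qfact_Suc: "qfact (Suc m) = qint (Suc m) * (qfact m :: 'k::field fls)"
  by (simp add: qfact_def mult.commute)

lemma qbinom_gauss:
  assumes a: "a = (fls_X :: 'k::field fls) \<or> a = fls_X_inv" and "s \<le> m"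
  shows "qbinom m s = gauss a m s"
  using assms
proof (induction a m s rule: gauss.induct)
  case (1 x m)
  then show ?case using qfact_nonzero by (simp add: qbinom_def qfact_def)
next
  case (3 x m s)
  then have sm: "s \<le> m" by simp
  have IH2: "qbinom m s = gauss x m s" using 3 sm by simp
  show ?case
  proof (cases "s = m")
    case True
    have "qbinom (Suc m) (Suc m) = (1 :: 'k fls)" "qbinom m m = (1 :: 'k fls)"
      using qfact_nonzero by (simp_all add: qbinom_def qfact_def[of 0])
    then show ?thesis using IH2 True by (simp add: gauss_eq_0)
  next
    case False
    then have IH1: "qbinom m (Suc s) = gauss x m (Suc s)" using 3 sm by simp
    obtain l where l: "m - s = Suc l" using False sm by (metis Suc_diff_Suc le_neq_implies_less)
    then have l': "m - Suc s = l" by simp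
    note nz = qfact_nonzero[where 'k='k] qint_nonzero[where 'k='k]
    show ?thesis
      unfolding gauss.simps IH1[symmetric] IH2[symmetric] qbinom_def l' diff_Suc_Suc qfact_Suc l
        qint_add[OF "3.prems"(1) sm, unfolded l]
      using nz by (simp add: field_simps del: power_Suc)
  qed
qed simp

lemma laurent_eval_superset:
  assumes "finite S" "{r. fls_nth f r \<noteq> 0} \<subseteq> S"
  shows "laurent_eval f x = (\<Sum>r\<in>S. fls_nth f r * x powi r)"
  unfolding laurent_eval_def using assms by (intro sum.mono_neutral_left) auto

lemma laurent_eval_add:
  assumes "finite {r. fls_nth f r \<noteq> 0}" "finite {r. fls_nth g r \<noteq> 0}"
  shows "finite {r. fls_nth (f + g) r \<noteq> 0}"
    "laurent_eval (f + g) x = laurent_eval f x + laurent_eval g x"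
proof -
  let ?S = "{r. fls_nth f r \<noteq> 0} \<union> {r. fls_nth g r \<noteq> 0}"
  have sub: "{r. fls_nth (f + g) r \<noteq> 0} \<subseteq> ?S" by auto
  then show "finite {r. fls_nth (f + g) r \<noteq> 0}" using assms finite_subset by blast
  show "laurent_eval (f + g) x = laurent_eval f x + laurent_eval g x"
    using assms sub
    by (subst (1 2 3) laurent_eval_superset[of ?S]) (auto simp: sum.distrib algebra_simps)
qed

lemma laurent_eval_shift:
  assumes "x \<noteq> 0"
  shows "finite {r. fls_nth f r \<noteq> 0} \<Longrightarrow> finite {r. fls_nth (fls_shift (- n) f) r \<noteq> 0}"
    "laurent_eval (fls_shift (- n) f) x = x powi n * laurent_eval f x"
proof -
  have eq: "{r. fls_nth (fls_shift (- n) f) r \<noteq> 0} = (\<lambda>r. r + n) ` {r. fls_nth f r \<noteq> 0}"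
    by (auto simp: image_iff) (metis diff_add_cancel)
  then show "finite {r. fls_nth f r \<noteq> 0} \<Longrightarrow> finite {r. fls_nth (fls_shift (- n) f) r \<noteq> 0}" by simp
  show "laurent_eval (fls_shift (- n) f) x = x powi n * laurent_eval f x"
    unfolding laurent_eval_def eq using assms
    by (subst sum.reindex) (auto simp: inj_on_def sum_distrib_left power_int_add mult_ac)
qed

text \<open>Evaluation is additive on Laurent polynomials, and the coefficients in the recursion are powers of
  \<open>X\<close>, multiplication by which is a shift; so the values satisfy the same recursion.\<close>

lemma laurent_eval_gauss:
  assumes x: "x \<noteq> 0" and a: "(a, n) = (fls_X :: 'k::field fls, 1) \<or> (a, n) = (fls_X_inv, -1)"
  shows "finite {r. fls_nth (gauss a m s) r \<noteq> 0} \<and> laurent_eval (gauss a m s) x = gauss (x powi n) m s"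
proof -
  have pow: "a ^ l * f = fls_shift (- (n * int l)) f" "inverse a ^ l * f = fls_shift (- (- n * int l)) f"
    if "(a, n) = (fls_X :: 'k::field fls, 1) \<or> (a, n) = (fls_X_inv, -1)" for a l and f :: "'k fls"
  proof -
    have inv': "inverse (fls_X_inv :: 'k fls) = fls_X" by (metis inverse_fls_X inverse_inverse_eq)
    show "a ^ l * f = fls_shift (- (n * int l)) f" "inverse a ^ l * f = fls_shift (- (- n * int l)) f"
      using that by (auto simp: inverse_fls_X inv' fls_X_power_conv_shift_1 fls_X_inv_power_conv_shift_1 fls_shifted_times_simps)
  qed
  have xp: "x powi (n * int l) = (x powi n) ^ l" "x powi (- n * int l) = inverse (x powi n) ^ l" for l
    by (simp_all add: power_int_mult power_int_minus power_inverse)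
  have one: "{r. fls_nth (1 :: 'k fls) r \<noteq> 0} = {0}" by auto
  show ?thesis
    using a
  proof (induction a m s rule: gauss.induct)
    case (1 a m)
    have "laurent_eval (1 :: 'k fls) x = 1" by (simp add: laurent_eval_def one)
    then show ?case by (simp add: one)
  next
    case (2 a s)
    then show ?case by (simp add: laurent_eval_def)
  next
    case (3 a m s)
    let ?f = "gauss a m (Suc s)" and ?g = "gauss a m s"
    note IH1 = "3.IH"(1)[OF "3.prems"] and IH2 = "3.IH"(2)[OF "3.prems"]
    note fin1 = laurent_eval_shift(1)[OF x, of ?f "n * int (Suc s)"]
    note fin2 = laurent_eval_shift(1)[OF x, of ?g "- n * int (m - s)"]
    have "gauss a (Suc m) (Suc s)
        = fls_shift (- (n * int (Suc s))) ?f + fls_shift (- (- n * int (m - s))) ?g"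
      unfolding gauss.simps pow[OF "3.prems"] ..
    moreover have "gauss (x powi n) (Suc m) (Suc s)
        = x powi (n * int (Suc s)) * gauss (x powi n) m (Suc s)
          + x powi (- n * int (m - s)) * gauss (x powi n) m s"
      unfolding gauss.simps xp ..
    ultimately show ?case
      using laurent_eval_add[of "fls_shift (- (n * int (Suc s))) ?f" "fls_shift (- (- n * int (m - s))) ?g"]
        fin1 fin2 IH1 IH2 laurent_eval_shift(2)[OF x, of "n * int (Suc s)" ?f]
        laurent_eval_shift(2)[OF x, of "- n * int (m - s)" ?g] by (simp only: simp_thms)
  qed
qed

text \<open>The invariance under \<open>x \<mapsto> inverse x\<close> is what makes it possible to apply the factors of the quantum
  Serre operator in increasing or in decreasing order.\<close>

lemma laurent_eval_qbinom:
  fixes x :: "'k::field"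
  assumes "x \<noteq> 0" "s \<le> m"
  shows "laurent_eval (qbinom m s) x = gauss x m s"
    "laurent_eval (qbinom m s) x = gauss (inverse x) m s"
proof -
  show "laurent_eval (qbinom m s) x = gauss x m s"
    using laurent_eval_gauss[OF assms(1), of fls_X 1 m s] qbinom_gauss[OF _ assms(2), of "fls_X :: 'k fls"] by simp
  show "laurent_eval (qbinom m s) x = gauss (inverse x) m s"
    using laurent_eval_gauss[OF assms(1), of fls_X_inv "-1" m s]
      qbinom_gauss[OF _ assms(2), of "fls_X_inv :: 'k fls"]
    by (simp add: power_int_minus)
qed

section \<open>The quantum Serre operator as a product of commutators\<close>

text \<open>The operators \<open>y \<mapsto> x * y - t r * y * x\<close> for \<open>r = 0, 1, \<dots>\<close> applied successively to \<open>y\<close>.\<close>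

primrec qad_free ::
    "(nat \<Rightarrow> 'k::field) \<Rightarrow> ('x fword \<Rightarrow>\<^sub>0 'k) \<Rightarrow> ('x fword \<Rightarrow>\<^sub>0 'k) \<Rightarrow> nat \<Rightarrow> ('x fword \<Rightarrow>\<^sub>0 'k)" where
  "qad_free t x y 0 = y"
| "qad_free t x y (Suc r) = x * qad_free t x y r + pm_scale (- t r) (qad_free t x y r * x)"

lemma poly_mapping_keys_induct [consumes 1, case_names zero single add]:
  fixes f :: "'m \<Rightarrow>\<^sub>0 'k::ab_group_add"
  assumes "Poly_Mapping.keys f \<subseteq> S"
    and "P 0" "\<And>k c. k \<in> S \<Longrightarrow> P (Poly_Mapping.single k c)"
    and "\<And>f g. Poly_Mapping.keys f \<subseteq> S \<Longrightarrow> Poly_Mapping.keys g \<subseteq> S \<Longrightarrow> P f \<Longrightarrow> P g \<Longrightarrow> P (f + g)"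
  shows "P f"
  using assms(1)
proof (induction f rule: update_induct)
  case const
  then show ?case using assms(2) by simp
next
  case (update f a b)
  have eq: "Poly_Mapping.update a b f = f + Poly_Mapping.single a b"
    using update(1) by (intro poly_mapping_eqI) (auto simp: lookup_update lookup_add lookup_single in_keys_iff when_def)
  have "Poly_Mapping.keys f \<subseteq> S" "a \<in> S"
    using update by (auto simp: keys_update split: if_splits)
  then show ?case using assms(3,4) update(3) unfolding eq by (metis keys_single insert_subset empty_subsetI)
qed

lemma poly_mapping_induct [case_names zero single add]:
  fixes f :: "'m \<Rightarrow>\<^sub>0 'k::ab_group_add"
  assumes "P 0" "\<And>k c. P (Poly_Mapping.single k c)" "\<And>f g. P f \<Longrightarrow> P g \<Longrightarrow> P (f + g)"
  shows "P f"
  by (rule poly_mapping_keys_induct[OF subset_UNIV]) (use assms in auto)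

lemma pm_scale_conv_single: "pm_scale c f = Poly_Mapping.single 0 c * (f :: 'm::monoid_add \<Rightarrow>\<^sub>0 'k::field)"
  unfolding pm_scale_def by (rule mult_map_scale_conv_mult)

lemma mult_pm_scale_left [simp]: "pm_scale c f * g = pm_scale c (f * g :: 'm::monoid_add \<Rightarrow>\<^sub>0 'k::field)"
  by (simp add: pm_scale_conv_single mult.assoc)

lemma single_0_commute:
  "Poly_Mapping.single 0 c * f = f * Poly_Mapping.single (0::'m::monoid_add) (c::'k::field)"
proof (induction f rule: poly_mapping_induct)
  case (single k v)
  then show ?case by (simp add: mult_single mult.commute)
qed (simp_all add: distrib_left distrib_right)

lemma mult_pm_scale_right [simp]: "f * pm_scale c g = pm_scale c (f * g :: 'm::monoid_add \<Rightarrow>\<^sub>0 'k::field)"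
  by (metis pm_scale_conv_single single_0_commute mult.assoc)

text \<open>The \<open>q\<close>-binomial theorem for the product of the \<open>L - u * inverse z ^ (2 * r) * R\<close> with \<open>r < m\<close>, where
  \<open>L\<close> and \<open>R\<close> are the commuting operators of left and right multiplication by \<open>x\<close>.\<close>

lemma qad_free_gauss:
  assumes z: "z \<noteq> 0"
  shows "qad_free (\<lambda>r. u * inverse z ^ (2 * r)) x y m
    = (\<Sum>s\<le>m. pm_scale ((- u * z) ^ s * inverse z ^ (m * s) * gauss z m s) (x ^ (m - s) * y * x ^ s))"
proof (induction m)
  case 0
  then show ?case by simp
next
  case (Suc m)
  let ?c = "\<lambda>m s. (- u * z) ^ s * inverse z ^ (m * s) * gauss z m s"
  let ?T = "\<lambda>m s. x ^ (m - s) * y * x ^ s"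
  \<comment> \<open>The \<open>q\<close>-Pascal rule, with the powers of \<open>u\<close> and \<open>z\<close> absorbed into the coefficients.\<close>
  have c: "?c (Suc m) (Suc s) = ?c m (Suc s) - u * inverse z ^ (2 * m) * ?c m s" if "s \<le> m" for s
  proof -
    obtain l where l: "m = s + l" using \<open>s \<le> m\<close> le_Suc_ex by blast
    show ?thesis
      using z unfolding l by (simp add: field_simps power_add power_mult_distrib power2_eq_square mult_2_right)
  qed
  have "x * (\<Sum>s\<le>m. pm_scale (?c m s) (?T m s)) = (\<Sum>s\<le>m. pm_scale (?c m s) (?T (Suc m) s))"
    by (simp add: sum_distrib_left Suc_diff_le mult.assoc)
  also have "\<dots> = (\<Sum>s\<le>Suc m. pm_scale (?c m s) (?T (Suc m) s))"
    by (simp add: gauss_eq_0)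
  also have "\<dots> = pm_scale (?c m 0) (?T (Suc m) 0) + (\<Sum>s\<le>m. pm_scale (?c m (Suc s)) (?T (Suc m) (Suc s)))"
    by (rule sum.atMost_Suc_shift)
  finally have L: "x * (\<Sum>s\<le>m. pm_scale (?c m s) (?T m s)) = \<dots>" .
  have R: "pm_scale (- (u * inverse z ^ (2 * m))) ((\<Sum>s\<le>m. pm_scale (?c m s) (?T m s)) * x)
      = (\<Sum>s\<le>m. pm_scale (- u * inverse z ^ (2 * m) * ?c m s) (?T (Suc m) (Suc s)))"
    by (simp add: sum_distrib_right pm.scale_sum_right mult.assoc power_commutes)
  have "(\<Sum>s\<le>Suc m. pm_scale (?c (Suc m) s) (?T (Suc m) s))
     = pm_scale (?c (Suc m) 0) (?T (Suc m) 0) + (\<Sum>s\<le>m. pm_scale (?c (Suc m) (Suc s)) (?T (Suc m) (Suc s)))"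
    by (rule sum.atMost_Suc_shift)
  also have "(\<Sum>s\<le>m. pm_scale (?c (Suc m) (Suc s)) (?T (Suc m) (Suc s)))
     = (\<Sum>s\<le>m. pm_scale (?c m (Suc s) - u * inverse z ^ (2 * m) * ?c m s) (?T (Suc m) (Suc s)))"
    by (intro sum.cong refl) (simp only: c atMost_iff)
  finally show ?case
    unfolding qad_free.simps Suc.IH L R
    by (simp add: pm.scale_left_diff_distrib sum_subtractf sum_negf add.assoc flip: sum.distrib)
qed

text \<open>The quantum Serre operator is the case \<open>u = z ^ (m - 1)\<close> of the \<open>q\<close>-binomial theorem, with \<open>z = c\<close> or
  \<open>z = inverse c\<close>.\<close>

lemma serre_qad_free:
  assumes c: "c \<noteq> 0"
  shows "serre c m x y = qad_free (\<lambda>r. c powi (int m - 1 - 2 * int r)) x y m"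
    "serre c m x y = qad_free (\<lambda>r. c powi (1 - int m + 2 * int r)) x y m"
proof -
  have *: "serre c m x y = qad_free (\<lambda>r. z powi (int m - 1 - 2 * int r)) x y m"
    if z: "z \<noteq> 0" and g: "\<And>s. s \<le> m \<Longrightarrow> laurent_eval (qbinom m s) c = gauss z m s" for z
  proof -
    have t: "z powi (int m - 1 - 2 * int r) = (z ^ m * inverse z) * inverse z ^ (2 * r)" for r
      using z by (simp add: power_int_diff power_int_mult power_mult power_inverse divide_inverse)
    have "(- (z ^ m * inverse z) * z) ^ s * inverse z ^ (m * s) = (-1) ^ s" for s
    proof -
      have "- (z ^ m * inverse z) * z = (- 1) * z ^ m" using z by simp
      then show ?thesis
        using z by (simp only: power_mult_distrib flip: power_mult) (simp add: power_inverse)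
    qed
    then show ?thesis
      unfolding t qad_free_gauss[OF z] serre_def
      by (intro sum.cong) (auto simp: g)
  qed
  show "serre c m x y = qad_free (\<lambda>r. c powi (int m - 1 - 2 * int r)) x y m"
    using * c laurent_eval_qbinom(1)[OF c] by blast
  have "inverse c powi (int m - 1 - 2 * int r) = c powi (1 - int m + 2 * int r)" for r
    by (simp add: power_int_inverse algebra_simps flip: power_int_minus)
  then show "serre c m x y = qad_free (\<lambda>r. c powi (1 - int m + 2 * int r)) x y m"
    using *[of "inverse c"] c laurent_eval_qbinom(2)[OF c] by simp
qed

section \<open>Algebras, homomorphisms and generators\<close>

lemma scalars_simps [simp]:
  "carrier scalars = UNIV" "x \<otimes>\<^bsub>scalars\<^esub> y = x * y" "\<one>\<^bsub>scalars\<^esub> = 1"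
  "\<zero>\<^bsub>scalars\<^esub> = 0" "x \<oplus>\<^bsub>scalars\<^esub> y = x + y" "x \<odot>\<^bsub>scalars\<^esub> y = x * y"
  by (simp_all add: scalars_def)

lemma cring_scalars: "cring (scalars :: ('k::field, 'k) module)"
proof (rule cringI)
  show "abelian_group (scalars :: ('k, 'k) module)"
    by (rule abelian_groupI) (auto simp: algebra_simps intro: exI[of _ "- _"])
  show "Group.comm_monoid (scalars :: ('k, 'k) module)"
    by (rule comm_monoidI) (auto simp: algebra_simps)
qed (simp add: algebra_simps)

lemma ring_transfer:
  assumes "ring R" "carrier S = carrier R" "mult S = mult R" "\<one>\<^bsub>S\<^esub> = \<one>\<^bsub>R\<^esub>"
    "\<zero>\<^bsub>S\<^esub> = \<zero>\<^bsub>R\<^esub>" "add S = add R"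
  shows "ring S"
proof -
  interpret ring R by fact
  show ?thesis
    by (intro ringI abelian_groupI monoidI)
      (auto simp: assms m_assoc l_distr r_distr a_ac intro: bexI[of _ "\<ominus>\<^bsub>R\<^esub> _"] l_neg)
qed

lemma k_algebraI:
  fixes A (structure)
  assumes "ring A"
    and "\<And>c x. x \<in> carrier A \<Longrightarrow> c \<odot> x \<in> carrier A"
    and "\<And>c d x. x \<in> carrier A \<Longrightarrow> (c + d) \<odot> x = c \<odot> x \<oplus> d \<odot> x"
    and "\<And>c x y. x \<in> carrier A \<Longrightarrow> y \<in> carrier A \<Longrightarrow> c \<odot> (x \<oplus> y) = c \<odot> x \<oplus> c \<odot> y"
    and "\<And>c d x. x \<in> carrier A \<Longrightarrow> (c * d) \<odot> x = c \<odot> (d \<odot> x)"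
    and "\<And>x. x \<in> carrier A \<Longrightarrow> 1 \<odot> x = x"
    and "\<And>c x y. x \<in> carrier A \<Longrightarrow> y \<in> carrier A \<Longrightarrow> (c \<odot> x) \<otimes> y = c \<odot> (x \<otimes> y)"
    and "\<And>c x y. x \<in> carrier A \<Longrightarrow> y \<in> carrier A \<Longrightarrow> x \<otimes> (c \<odot> y) = c \<odot> (x \<otimes> y)"
  shows "k_algebra A"
proof -
  have "Module.module scalars A"
    using assms by (intro moduleI cring_scalars ring.is_abelian_group) auto
  then show ?thesis
    using assms by (auto intro!: k_algebra.intro k_algebra_axioms.intro)
qed

context k_algebra
begin

lemma A_ring: "ring A" ..

lemma sc_closed [simp, intro]: "x \<in> carrier A \<Longrightarrow> c \<odot> x \<in> carrier A"
  by simp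

lemma sc_add: "x \<in> carrier A \<Longrightarrow> (c + d) \<odot> x = c \<odot> x \<oplus> d \<odot> x"
  using smult_l_distr[of c d x] by simp

lemma sc_distr: "x \<in> carrier A \<Longrightarrow> y \<in> carrier A \<Longrightarrow> c \<odot> (x \<oplus> y) = c \<odot> x \<oplus> c \<odot> y"
  using smult_r_distr[of c x y] by simp

lemma sc_sc [simp]: "x \<in> carrier A \<Longrightarrow> c \<odot> (d \<odot> x) = (c * d) \<odot> x"
  using smult_assoc1[of c d x] by simp

lemma sc_one [simp]: "x \<in> carrier A \<Longrightarrow> 1 \<odot> x = x"
  using smult_one[of x] by simp

lemma sc_zero_left [simp]: "x \<in> carrier A \<Longrightarrow> 0 \<odot> x = \<zero>"
  using smult_l_null[of x] by simp

lemma sc_zero_right [simp]: "c \<odot> \<zero> = \<zero>"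
  using smult_r_null[of c] by simp

lemma sc_minus: "x \<in> carrier A \<Longrightarrow> (- c) \<odot> x = \<ominus> (c \<odot> x)"
  using sc_add[of x "- c" c] M.minus_equality[of "(- c) \<odot> x" "c \<odot> x"] by simp

text \<open>Negation is written as multiplication by \<open>- 1\<close>: in contrast to \<open>a_inv\<close>, this does not refer to the
  carrier, so a formula keeps its form when it is read in an ideal component or in the opposite algebra.\<close>

lemma minus_eq_sc: "x \<in> carrier A \<Longrightarrow> \<ominus> x = (- 1) \<odot> x"
  by (simp add: sc_minus)

declare smult_mult_left [simp] smult_mult_right [simp]

lemma sc_cancel [simp]: "x \<in> carrier A \<Longrightarrow> c \<odot> x \<oplus> (- c) \<odot> x = \<zero>"
  by (simp flip: sc_add)

lemma sub_self [simp]: "x \<in> carrier A \<Longrightarrow> x \<oplus> (- 1) \<odot> x = \<zero>"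
  using sc_cancel[of x 1] by simp

lemma sub_of_add_eq: "x \<in> carrier A \<Longrightarrow> d \<in> carrier A \<Longrightarrow> x \<oplus> d = y \<Longrightarrow> y \<oplus> (- 1) \<odot> d = x"
  by (auto simp: M.a_assoc)

lemma add_sub_cancel: "x \<in> carrier A \<Longrightarrow> y \<in> carrier A \<Longrightarrow> (x \<oplus> y) \<oplus> (- 1) \<odot> x = y"
  using sc_cancel[of x 1] by (simp add: M.a_comm[of x y] M.a_assoc)

lemma eq_add_of_sub:
  assumes "x \<in> carrier A" "y \<in> carrier A" "x \<oplus> (- 1) \<odot> y = d"
  shows "x = y \<oplus> d"
  using add_sub_cancel[of y x] assms by (auto simp: M.a_assoc)

lemma sub_self' [simp]: "x \<in> carrier A \<Longrightarrow> (- 1) \<odot> x \<oplus> x = \<zero>"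
  using sub_self[of x] by (simp add: M.a_comm)

lemma eq_iff_sub_zero: "x \<in> carrier A \<Longrightarrow> y \<in> carrier A \<Longrightarrow> x \<oplus> (- 1) \<odot> y = \<zero> \<longleftrightarrow> x = y"
  by (metis M.r_neg M.a_inv_closed M.minus_equality M.minus_minus minus_eq_sc)

end

lemma k_algebra_scalars: "k_algebra (scalars :: ('k::field, 'k) module)"
  by (rule k_algebraI) (auto simp: algebra_simps intro: cring.axioms cring_scalars)

lemma linear_mapsD:
  assumes "h \<in> linear_maps A B"
  shows "x \<in> carrier A \<Longrightarrow> h x \<in> carrier B"
    "x \<in> carrier A \<Longrightarrow> y \<in> carrier A \<Longrightarrow> h (x \<oplus>\<^bsub>A\<^esub> y) = h x \<oplus>\<^bsub>B\<^esub> h y"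
    "x \<in> carrier A \<Longrightarrow> h (c \<odot>\<^bsub>A\<^esub> x) = c \<odot>\<^bsub>B\<^esub> h x"
  using assms by (auto simp: linear_maps_def)

lemma linear_maps_zero:
  assumes "k_algebra A" "k_algebra B" "h \<in> linear_maps A B"
  shows "h \<zero>\<^bsub>A\<^esub> = \<zero>\<^bsub>B\<^esub>"
proof -
  interpret A: k_algebra A by fact
  interpret B: k_algebra B by fact
  have "h (0 \<odot>\<^bsub>A\<^esub> \<zero>\<^bsub>A\<^esub>) = 0 \<odot>\<^bsub>B\<^esub> h \<zero>\<^bsub>A\<^esub>" using linear_mapsD(3)[OF assms(3)] by blast
  then show ?thesis using linear_mapsD(1)[OF assms(3)] by simp
qed

lemma alg_homD:
  assumes "h \<in> alg_hom A B"
  shows "x \<in> carrier A \<Longrightarrow> h x \<in> carrier B"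
    "x \<in> carrier A \<Longrightarrow> y \<in> carrier A \<Longrightarrow> h (x \<oplus>\<^bsub>A\<^esub> y) = h x \<oplus>\<^bsub>B\<^esub> h y"
    "x \<in> carrier A \<Longrightarrow> h (c \<odot>\<^bsub>A\<^esub> x) = c \<odot>\<^bsub>B\<^esub> h x"
    "x \<in> carrier A \<Longrightarrow> y \<in> carrier A \<Longrightarrow> h (x \<otimes>\<^bsub>A\<^esub> y) = h x \<otimes>\<^bsub>B\<^esub> h y"
    "h \<one>\<^bsub>A\<^esub> = \<one>\<^bsub>B\<^esub>" "h \<in> linear_maps A B"
  using assms by (auto simp: linear_maps_def alg_hom_def ring_hom_def)

lemma alg_homI:
  assumes "h \<in> linear_maps A B"
    "\<And>x y. x \<in> carrier A \<Longrightarrow> y \<in> carrier A \<Longrightarrow> h (x \<otimes>\<^bsub>A\<^esub> y) = h x \<otimes>\<^bsub>B\<^esub> h y"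
    "h \<one>\<^bsub>A\<^esub> = \<one>\<^bsub>B\<^esub>"
  shows "h \<in> alg_hom A B"
  using assms by (auto simp: linear_maps_def alg_hom_def ring_hom_def)

lemma linear_mapsI:
  assumes "\<And>x. x \<in> carrier A \<Longrightarrow> h x \<in> carrier B"
    "\<And>x y. x \<in> carrier A \<Longrightarrow> y \<in> carrier A \<Longrightarrow> h (x \<oplus>\<^bsub>A\<^esub> y) = h x \<oplus>\<^bsub>B\<^esub> h y"
    "\<And>c x. x \<in> carrier A \<Longrightarrow> h (c \<odot>\<^bsub>A\<^esub> x) = c \<odot>\<^bsub>B\<^esub> h x"
  shows "h \<in> linear_maps A B"
  using assms by (auto simp: linear_maps_def)

lemma linear_maps_comp:
  assumes "g \<in> linear_maps A B" "h \<in> linear_maps B C"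
  shows "h \<circ> g \<in> linear_maps A C"
  by (rule linear_mapsI) (use linear_mapsD[OF assms(1)] linear_mapsD[OF assms(2)] in auto)

lemma alg_hom_comp:
  assumes "g \<in> alg_hom A B" "h \<in> alg_hom B C"
  shows "h \<circ> g \<in> alg_hom A C"
  by (intro alg_homI linear_maps_comp[of _ _ B] alg_homD(6)[OF assms(1)] alg_homD(6)[OF assms(2)])
    (use alg_homD[OF assms(1)] alg_homD[OF assms(2)] in auto)

lemma alg_hom_id: "id \<in> alg_hom A A"
  by (auto intro!: alg_homI linear_mapsI)

text \<open>The subalgebra generated by \<open>G\<close>, as an inductive set: homomorphisms and Hopf axioms are compared on it by
  rule induction.\<close>

inductive_set alg_gen :: "('k::field, 'a) module \<Rightarrow> 'a set \<Rightarrow> 'a set"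
  for A :: "('k, 'a) module" and G :: "'a set" where
  one: "\<one>\<^bsub>A\<^esub> \<in> alg_gen A G"
| gen: "x \<in> G \<Longrightarrow> x \<in> alg_gen A G"
| add: "x \<in> alg_gen A G \<Longrightarrow> y \<in> alg_gen A G \<Longrightarrow> x \<oplus>\<^bsub>A\<^esub> y \<in> alg_gen A G"
| mult: "x \<in> alg_gen A G \<Longrightarrow> y \<in> alg_gen A G \<Longrightarrow> x \<otimes>\<^bsub>A\<^esub> y \<in> alg_gen A G"
| smult: "x \<in> alg_gen A G \<Longrightarrow> c \<odot>\<^bsub>A\<^esub> x \<in> alg_gen A G"

lemma alg_gen_subset:
  assumes "G \<subseteq> alg_gen A H"
  shows "alg_gen A G \<subseteq> alg_gen A H"
proof
  fix x assume "x \<in> alg_gen A G"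
  then show "x \<in> alg_gen A H" by induction (use assms in \<open>auto intro: alg_gen.intros\<close>)
qed

lemma (in k_algebra) alg_gen_carrier:
  assumes "G \<subseteq> carrier A" "x \<in> alg_gen A G"
  shows "x \<in> carrier A"
  using assms(2) by induction (use assms(1) in auto)

lemma alg_hom_eqI:
  assumes "k_algebra A" "g \<in> alg_hom A B" "h \<in> alg_hom A B" "G \<subseteq> carrier A"
    "\<And>x. x \<in> G \<Longrightarrow> g x = h x" "x \<in> alg_gen A G"
  shows "g x = h x"
  using assms(6)
proof induction
  case one
  then show ?case by (simp add: alg_homD(5)[OF assms(2)] alg_homD(5)[OF assms(3)])
qed (auto simp: alg_homD(2-4)[OF assms(2)] alg_homD(2-4)[OF assms(3)] assms(5)
    k_algebra.alg_gen_carrier[OF assms(1,4)])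

lemma alg_gen_image:
  assumes "k_algebra A" "h \<in> alg_hom A B" "G \<subseteq> carrier A" "x \<in> alg_gen A G"
  shows "h x \<in> alg_gen B (h ` G)"
  using assms(4)
proof induction
  case one
  then show ?case by (simp add: alg_homD(5)[OF assms(2)] alg_gen.one)
qed (auto simp: alg_homD(2-4)[OF assms(2)] k_algebra.alg_gen_carrier[OF assms(1,3)] intro: alg_gen.intros)

text \<open>The target of the antipode, which thereby becomes a homomorphism and is determined by its values on generators.\<close>

definition op_alg :: "('k, 'a) module \<Rightarrow> ('k, 'a) module" where
  "op_alg A = A\<lparr>mult := \<lambda>x y. y \<otimes>\<^bsub>A\<^esub> x\<rparr>"

lemma op_alg_simps [simp]:
  "carrier (op_alg A) = carrier A" "x \<otimes>\<^bsub>op_alg A\<^esub> y = y \<otimes>\<^bsub>A\<^esub> x" "\<one>\<^bsub>op_alg A\<^esub> = \<one>\<^bsub>A\<^esub>"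
  "\<zero>\<^bsub>op_alg A\<^esub> = \<zero>\<^bsub>A\<^esub>" "x \<oplus>\<^bsub>op_alg A\<^esub> y = x \<oplus>\<^bsub>A\<^esub> y" "c \<odot>\<^bsub>op_alg A\<^esub> x = c \<odot>\<^bsub>A\<^esub> x"
  by (simp_all add: op_alg_def)

lemma (in k_algebra) k_algebra_op: "k_algebra (op_alg A)"
proof (rule k_algebraI)
  show "ring (op_alg A)"
    by (intro ringI abelian_groupI monoidI)
      (auto simp: A.m_assoc A.l_distr A.r_distr M.a_ac intro: bexI[of _ "\<ominus> _"] M.l_neg)
qed (auto simp: sc_add sc_distr)

section \<open>Linear extension of a map on a basis\<close>

definition lin_ext :: "('k::field, 'c) module \<Rightarrow> ('m \<Rightarrow> 'c) \<Rightarrow> ('m \<Rightarrow>\<^sub>0 'k) \<Rightarrow> 'c" where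
  "lin_ext C h f = (\<Oplus>\<^bsub>C\<^esub>p\<in>Poly_Mapping.keys f. Poly_Mapping.lookup f p \<odot>\<^bsub>C\<^esub> h p)"

lemma keys_pm_scale: "Poly_Mapping.keys (pm_scale c f) \<subseteq> Poly_Mapping.keys f"
  by (auto simp: in_keys_iff)

context k_algebra
begin

lemma lin_ext_superset:
  assumes "finite S" "Poly_Mapping.keys f \<subseteq> S" "h \<in> S \<rightarrow> carrier A"
  shows "lin_ext A h f = (\<Oplus>p\<in>S. Poly_Mapping.lookup f p \<odot> h p)"
  unfolding lin_ext_def
  using assms by (intro M.add.finprod_mono_neutral_cong_left) (auto simp: in_keys_iff Pi_iff)

lemma lin_ext_closed:
  assumes "h \<in> Poly_Mapping.keys f \<rightarrow> carrier A"
  shows "lin_ext A h f \<in> carrier A"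
  unfolding lin_ext_def using assms by (intro M.finsum_closed) auto

lemma lin_ext_single:
  assumes "h k \<in> carrier A"
  shows "lin_ext A h (Poly_Mapping.single k c) = c \<odot> h k"
  using assms by (subst lin_ext_superset[of "{k}"]) auto

lemma lin_ext_add:
  assumes "h \<in> Poly_Mapping.keys f \<rightarrow> carrier A" "h \<in> Poly_Mapping.keys g \<rightarrow> carrier A"
  shows "lin_ext A h (f + g) = lin_ext A h f \<oplus> lin_ext A h g"
proof -
  let ?S = "Poly_Mapping.keys f \<union> Poly_Mapping.keys g"
  have h: "h \<in> ?S \<rightarrow> carrier A" using assms by auto
  have "Poly_Mapping.keys (f + g) \<subseteq> ?S" by (rule Poly_Mapping.keys_add)
  then have "lin_ext A h (f + g) = (\<Oplus>p\<in>?S. Poly_Mapping.lookup (f + g) p \<odot> h p)"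
    using h by (intro lin_ext_superset) auto
  also have "\<dots> = (\<Oplus>p\<in>?S. Poly_Mapping.lookup f p \<odot> h p \<oplus> Poly_Mapping.lookup g p \<odot> h p)"
    using h by (intro M.finsum_cong') (auto simp: lookup_add sc_add Pi_iff)
  also have "\<dots> = lin_ext A h f \<oplus> lin_ext A h g"
    using h by (subst M.finsum_addf) (auto intro!: arg_cong2[of _ _ _ _ "(\<oplus>)"] lin_ext_superset[symmetric])
  finally show ?thesis .
qed

lemma lin_ext_pm_scale:
  assumes "h \<in> Poly_Mapping.keys f \<rightarrow> carrier A"
  shows "lin_ext A h (pm_scale c f) = c \<odot> lin_ext A h f"
proof -
  have "lin_ext A h (pm_scale c f) = (\<Oplus>p\<in>Poly_Mapping.keys f. Poly_Mapping.lookup (pm_scale c f) p \<odot> h p)"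
    using assms keys_pm_scale by (intro lin_ext_superset) (simp_all add: keys_pm_scale)
  also have "\<dots> = (\<Oplus>p\<in>Poly_Mapping.keys f. c \<odot> (Poly_Mapping.lookup f p \<odot> h p))"
    using assms by (intro M.finsum_cong') (auto simp: Pi_iff)
  also have "\<dots> = c \<odot> lin_ext A h f"
    unfolding lin_ext_def using assms by (intro finsum_smult_ldistr[symmetric]) auto
  finally show ?thesis .
qed

end

section \<open>Quotient algebras\<close>

text \<open>Evaluation at an arbitrary representative, the form in which \<^const>\<open>tensor_lift\<close> is defined.\<close>

definition qlift :: "('a \<Rightarrow> 'b) \<Rightarrow> 'a set \<Rightarrow> 'b" where
  "qlift h X = h (SOME x. x \<in> X)"

locale k_ideal = k_algebra A + I?: ideal I A for A (structure) and I
begin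

lemma sc_ideal: "x \<in> I \<Longrightarrow> c \<odot> x \<in> I"
  using I.I_l_closed[of x "c \<odot> \<one>"] I.Icarr by simp

lemma carrier_quot: "carrier (alg_quot A I) = (+>) I ` carrier A"
  by (auto simp: alg_quot_def ring.defs module.defs FactRing_def A_RCOSETS_def RCOSETS_def a_r_coset_def)

lemma quot_simps:
  "x \<in> carrier A \<Longrightarrow> y \<in> carrier A \<Longrightarrow> (I +> x) \<otimes>\<^bsub>alg_quot A I\<^esub> (I +> y) = I +> (x \<otimes> y)"
  "x \<in> carrier A \<Longrightarrow> y \<in> carrier A \<Longrightarrow> (I +> x) \<oplus>\<^bsub>alg_quot A I\<^esub> (I +> y) = I +> (x \<oplus> y)"
  "\<one>\<^bsub>alg_quot A I\<^esub> = I +> \<one>" "\<zero>\<^bsub>alg_quot A I\<^esub> = I"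
  by (simp_all add: alg_quot_def ring.defs module.defs FactRing_def rcoset_mult_add a_rcos_sum)

lemma quot_smult:
  assumes "x \<in> carrier A"
  shows "c \<odot>\<^bsub>alg_quot A I\<^esub> (I +> x) = I +> (c \<odot> x)"
proof -
  have coset: "I +> (c \<odot> y) = I +> (c \<odot> x)" if y: "y \<in> I +> x" for y
  proof -
    obtain h where h: "h \<in> I" "y = h \<oplus> x" using y by (auto simp: a_r_coset_def')
    then have "c \<odot> y = c \<odot> h \<oplus> c \<odot> x" using assms I.Icarr by (simp add: sc_distr)
    then have "c \<odot> y \<in> I +> (c \<odot> x)" using sc_ideal[OF h(1)] by (auto simp: a_r_coset_def')
    then show ?thesis using assms by (metis a_repr_independence sc_closed I.a_subgroup)
  qed
  have "c \<odot>\<^bsub>alg_quot A I\<^esub> (I +> x) = (\<Union>y\<in>I +> x. I +> (c \<odot> y))"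
    by (simp add: alg_quot_def ring.defs module.defs)
  also have "\<dots> = I +> (c \<odot> x)"
    using I.a_rcos_self[OF assms] by (intro SUP_eq_const coset) auto
  finally show ?thesis .
qed

lemma k_algebra_quot: "k_algebra (alg_quot A I)"
proof (rule k_algebraI)
  have "ring (A Quot I)" by (rule quotient_is_ring)
  then show "ring (alg_quot A I)"
    by (rule ring_transfer) (simp_all add: alg_quot_def ring.defs module.defs)
qed (auto simp: carrier_quot quot_simps quot_smult sc_add sc_distr)

lemma quot_hom: "(+>) I \<in> alg_hom A (alg_quot A I)"
  by (intro alg_homI linear_mapsI) (simp_all only: carrier_quot quot_simps quot_smult imageI)

lemma quot_eqI:
  assumes "x \<in> carrier A" "y \<in> carrier A" "x \<oplus> (- 1) \<odot> y \<in> I"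
  shows "I +> x = I +> y"
proof -
  have "x = (x \<oplus> (- 1) \<odot> y) \<oplus> y"
    using assms by (simp add: M.a_assoc flip: minus_eq_sc) (simp add: M.l_neg)
  then have "x \<in> I +> y" using assms(3) unfolding a_r_coset_def' by blast
  then show ?thesis using assms(2) by (metis a_repr_independence I.a_subgroup)
qed

lemma qlift_eq:
  assumes "k_algebra B" "h \<in> linear_maps A B" "\<And>x. x \<in> I \<Longrightarrow> h x = \<zero>\<^bsub>B\<^esub>" "x \<in> carrier A"
  shows "qlift h (I +> x) = h x"
proof -
  interpret B: k_algebra B by fact
  have "(SOME y. y \<in> I +> x) \<in> I +> x"
    using I.a_rcos_self[OF assms(4)] by (rule someI)
  then obtain n where n: "n \<in> I" "(SOME y. y \<in> I +> x) = n \<oplus> x"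
    unfolding a_r_coset_def' by blast
  have "h (n \<oplus> x) = h n \<oplus>\<^bsub>B\<^esub> h x"
    using linear_mapsD(2)[OF assms(2) I.Icarr[OF n(1)] assms(4)] .
  also have "\<dots> = h x"
    unfolding assms(3)[OF n(1)] by (rule B.l_zero) (rule linear_mapsD(1)[OF assms(2,4)])
  finally show ?thesis
    unfolding qlift_def n(2) .
qed

lemma qlift_linear:
  assumes "k_algebra B" "h \<in> linear_maps A B" "\<And>x. x \<in> I \<Longrightarrow> h x = \<zero>\<^bsub>B\<^esub>"
  shows "qlift h \<in> linear_maps (alg_quot A I) B"
  by (rule linear_mapsI; (simp_all only: carrier_quot)?;
      (elim imageE, hypsubst,
       simp only: quot_simps quot_smult qlift_eq[OF assms] linear_mapsD[OF assms(2)] sc_closed M.a_closed))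

lemma qlift_hom:
  assumes "k_algebra B" "h \<in> alg_hom A B" "\<And>x. x \<in> I \<Longrightarrow> h x = \<zero>\<^bsub>B\<^esub>"
  shows "qlift h \<in> alg_hom (alg_quot A I) B"
proof (rule alg_homI)
  note eq = qlift_eq[OF assms(1) alg_homD(6)[OF assms(2)] assms(3)]
  show "qlift h \<in> linear_maps (alg_quot A I) B"
    by (rule qlift_linear[OF assms(1) alg_homD(6)[OF assms(2)] assms(3)])
  show "qlift h \<one>\<^bsub>alg_quot A I\<^esub> = \<one>\<^bsub>B\<^esub>"
    by (simp only: quot_simps eq A.one_closed alg_homD(5)[OF assms(2)])
  fix x y assume "x \<in> carrier (alg_quot A I)" "y \<in> carrier (alg_quot A I)"
  then show "qlift h (x \<otimes>\<^bsub>alg_quot A I\<^esub> y) = qlift h x \<otimes>\<^bsub>B\<^esub> qlift h y"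
    unfolding carrier_quot
    by (elim imageE) (simp only: quot_simps eq A.m_closed alg_homD(4)[OF assms(2)])
qed

end

text \<open>Closure under negation comes from the scalar \<open>- 1\<close>.\<close>

lemma (in k_algebra) k_idealI:
  assumes "I \<subseteq> carrier A" "\<zero> \<in> I" "\<And>x y. x \<in> I \<Longrightarrow> y \<in> I \<Longrightarrow> x \<oplus> y \<in> I"
    and smult: "\<And>c x. x \<in> I \<Longrightarrow> c \<odot> x \<in> I"
    and "\<And>x y. x \<in> I \<Longrightarrow> y \<in> carrier A \<Longrightarrow> y \<otimes> x \<in> I"
    and "\<And>x y. x \<in> I \<Longrightarrow> y \<in> carrier A \<Longrightarrow> x \<otimes> y \<in> I"
  shows "k_ideal A I"
proof (intro k_ideal.intro k_algebra_axioms idealI A_ring)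
  show "subgroup I (add_monoid A)"
  proof (rule subgroup.intro)
    fix x assume x: "x \<in> I"
    then have "inv\<^bsub>add_monoid A\<^esub> x = (- 1) \<odot> x"
      using minus_eq_sc[of x] assms(1) by (auto simp: a_inv_def)
    then show "inv\<^bsub>add_monoid A\<^esub> x \<in> I" using smult[OF x] by simp
  qed (use assms in auto)
qed (use assms in auto)

section \<open>Presented algebras\<close>

lemma free_algebra_simps [simp]:
  "carrier free_algebra = UNIV" "x \<otimes>\<^bsub>free_algebra\<^esub> y = x * y" "\<one>\<^bsub>free_algebra\<^esub> = 1"
  "\<zero>\<^bsub>free_algebra\<^esub> = 0" "x \<oplus>\<^bsub>free_algebra\<^esub> y = x + y" "c \<odot>\<^bsub>free_algebra\<^esub> x = pm_scale c x"
  by (simp_all add: free_algebra_def)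

lemma k_algebra_free: "k_algebra free_algebra"
proof (rule k_algebraI)
  show "ring free_algebra"
    by (intro ringI abelian_groupI monoidI)
      (auto simp: mult.assoc distrib_left distrib_right add.assoc add.commute intro: exI[of _ "- _"])
qed (auto simp: pm.scale_left_distrib pm.scale_right_distrib)

definition eval_word :: "('k, 'b) module \<Rightarrow> ('x \<Rightarrow> 'b) \<Rightarrow> 'x fword \<Rightarrow> 'b" where
  "eval_word B g w = foldr (\<lambda>x y. g x \<otimes>\<^bsub>B\<^esub> y) (letters w) \<one>\<^bsub>B\<^esub>"

definition ev :: "('k::field, 'b) module \<Rightarrow> ('x \<Rightarrow> 'b) \<Rightarrow> ('x fword \<Rightarrow>\<^sub>0 'k) \<Rightarrow> 'b" where
  "ev B g = lin_ext B (eval_word B g)"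

context
  fixes B :: "('k::field, 'b) module" (structure) and g :: "'x \<Rightarrow> 'b"
  assumes B: "k_algebra B" and g: "\<And>x. g x \<in> carrier B"
begin

interpretation k_algebra B by (rule B)

lemma eval_word_closed: "eval_word B g w \<in> carrier B"
proof -
  have "foldr (\<lambda>x y. g x \<otimes> y) xs \<one> \<in> carrier B" for xs by (induction xs) (auto simp: g)
  then show ?thesis by (simp add: eval_word_def)
qed

lemma eval_word_add: "eval_word B g (v + w) = eval_word B g v \<otimes> eval_word B g w"
proof -
  have c: "foldr (\<lambda>x y. g x \<otimes> y) xs \<one> \<in> carrier B" for xs by (induction xs) (auto simp: g)
  have "foldr (\<lambda>x y. g x \<otimes> y) (xs @ ys) \<one> = foldr (\<lambda>x y. g x \<otimes> y) xs \<one> \<otimes> foldr (\<lambda>x y. g x \<otimes> y) ys \<one>" for xs ys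
    using c g by (induction xs) (simp_all add: A.m_assoc del: foldr_append)
  then show ?thesis by (simp add: eval_word_def plus_fword_def)
qed

lemma ev_hom: "ev B g \<in> alg_hom free_algebra B"
proof -
  have lin: "ev B g \<in> linear_maps free_algebra B"
    unfolding ev_def using eval_word_closed
    by (intro linear_mapsI) (auto simp: lin_ext_add lin_ext_pm_scale lin_ext_closed)
  note D = linear_mapsD[OF lin, simplified] and Z = linear_maps_zero[OF k_algebra_free B lin, simplified]
  have ev_single: "ev B g (Poly_Mapping.single w c) = c \<odot> eval_word B g w" for w c
    unfolding ev_def using eval_word_closed by (simp add: lin_ext_single)
  have one: "ev B g 1 = \<one>"
    using ev_single[of 0 1] by (simp add: eval_word_def) (simp add: zero_fword_def)
  have "ev B g (f * h) = ev B g f \<otimes> ev B g h" for f h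
  proof (induction f rule: poly_mapping_induct)
    case (single v c)
    show ?case
    proof (induction h rule: poly_mapping_induct)
      case (single w d)
      then show ?case
        using eval_word_closed by (simp add: mult_single ev_single eval_word_add mult.commute)
    qed (use D in \<open>simp_all add: Z distrib_left A.r_distr\<close>)
  qed (use D in \<open>simp_all add: Z distrib_right A.l_distr\<close>)
  then show ?thesis using lin one by (intro alg_homI) auto
qed

lemma ev_simps:
  "ev B g (p * r) = ev B g p \<otimes> ev B g r" "ev B g (p + r) = ev B g p \<oplus> ev B g r"
  "ev B g (pm_scale c p) = c \<odot> ev B g p" "ev B g 1 = \<one>" "ev B g (letter x) = g x"
  "ev B g (p - r) = ev B g p \<oplus> (- 1) \<odot> ev B g r" "ev B g p \<in> carrier B"
proof -
  note D = alg_homD[OF ev_hom, simplified]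
  show "ev B g (p * r) = ev B g p \<otimes> ev B g r" "ev B g (p + r) = ev B g p \<oplus> ev B g r"
    "ev B g (pm_scale c p) = c \<odot> ev B g p" "ev B g 1 = \<one>" "ev B g p \<in> carrier B"
    using D by auto
  show "ev B g (letter x) = g x"
    unfolding ev_def letter_def using eval_word_closed g
    by (simp add: lin_ext_single eval_word_def)
  have "p - r = p + pm_scale (- 1) r" by (simp add: pm.scale_minus_left)
  then show "ev B g (p - r) = ev B g p \<oplus> (- 1) \<odot> ev B g r"
    using D by (simp only:)
qed

end

lemma ev_diff_zero_iff:
  assumes "k_algebra B" "\<And>x. g x \<in> carrier B"
  shows "ev B g (p - r) = \<zero>\<^bsub>B\<^esub> \<longleftrightarrow> ev B g p = ev B g r"
  using k_algebra.eq_iff_sub_zero[OF assms(1)] by (simp add: ev_simps[OF assms])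

lemma letters_generate: "p \<in> alg_gen free_algebra (range letter)"
proof (induction p rule: poly_mapping_induct)
  case zero
  have "pm_scale 0 1 \<in> alg_gen free_algebra (range (letter :: 'a \<Rightarrow> 'a fword \<Rightarrow>\<^sub>0 'b))"
    using alg_gen.smult[OF alg_gen.one, of free_algebra 0] by simp
  then show ?case by simp
next
  case (single w c)
  have "Poly_Mapping.single (FWord xs) 1 \<in> alg_gen free_algebra (range (letter :: 'a \<Rightarrow> 'a fword \<Rightarrow>\<^sub>0 'b))" for xs
  proof (induction xs)
    case Nil
    then show ?case
      using alg_gen.one[of free_algebra] by (simp flip: zero_fword_def)
  next
    case (Cons x xs)
    have "Poly_Mapping.single (FWord (x # xs)) 1 = letter x * Poly_Mapping.single (FWord xs) (1::'b)"
      by (simp add: letter_def mult_single plus_fword_def)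
    then show ?case
      using alg_gen.mult[OF alg_gen.gen Cons, of "letter x"] by simp
  qed
  from alg_gen.smult[OF this[of "letters w"], of c] show ?case
    by (simp add: pm_scale_def)
next
  case (add f g)
  then show ?case using alg_gen.add[of f free_algebra _ g] by simp
qed

lemma presented_ideal: "k_ideal free_algebra (Idl\<^bsub>free_algebra\<^esub> P)"
  by (intro k_ideal.intro k_algebra_free ring.genideal_ideal) (simp_all add: k_algebra.A_ring[OF k_algebra_free])

lemma k_algebra_presented: "k_algebra (presented_algebra P)"
  unfolding presented_algebra_def by (rule k_ideal.k_algebra_quot[OF presented_ideal])

lemma presented_proj: "(+>\<^bsub>free_algebra\<^esub>) (Idl\<^bsub>free_algebra\<^esub> P) \<in> alg_hom free_algebra (presented_algebra P)"
  unfolding presented_algebra_def by (rule k_ideal.quot_hom[OF presented_ideal])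

lemma presented_gen_closed: "presented_gen P x \<in> carrier (presented_algebra P)"
  using alg_homD(1)[OF presented_proj] by (simp add: presented_gen_def)

lemma presented_generated: "carrier (presented_algebra P) = alg_gen (presented_algebra P) (range (presented_gen P))"
proof
  show "carrier (presented_algebra P) \<subseteq> alg_gen (presented_algebra P) (range (presented_gen P))"
  proof
    fix X assume "X \<in> carrier (presented_algebra P)"
    then obtain p where "X = Idl\<^bsub>free_algebra\<^esub> P +>\<^bsub>free_algebra\<^esub> p"
      unfolding presented_algebra_def k_ideal.carrier_quot[OF presented_ideal] by auto
    moreover have "(+>\<^bsub>free_algebra\<^esub>) (Idl\<^bsub>free_algebra\<^esub> P) ` range letter = range (presented_gen P)"
      unfolding presented_gen_def by (simp only: image_image)
    ultimately show "X \<in> alg_gen (presented_algebra P) (range (presented_gen P))"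
      using alg_gen_image[OF k_algebra_free presented_proj _ letters_generate, of P p] by simp
  qed
  show "alg_gen (presented_algebra P) (range (presented_gen P)) \<subseteq> carrier (presented_algebra P)"
  proof
    have gens: "range (presented_gen P) \<subseteq> carrier (presented_algebra P)"
      using presented_gen_closed by (rule image_subsetI)
    fix X assume "X \<in> alg_gen (presented_algebra P) (range (presented_gen P))"
    then show "X \<in> carrier (presented_algebra P)"
      by (rule k_algebra.alg_gen_carrier[OF k_algebra_presented gens])
  qed
qed

lemma ev_presented_gen: "ev (presented_algebra P) (presented_gen P) p = Idl\<^bsub>free_algebra\<^esub> P +>\<^bsub>free_algebra\<^esub> p"
  by (rule alg_hom_eqI[OF k_algebra_free ev_hom[OF k_algebra_presented presented_gen_closed] presented_proj
        _ _ letters_generate])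
    (auto simp: ev_simps[OF k_algebra_presented presented_gen_closed], simp_all add: presented_gen_def)

lemma presented_relation:
  assumes "p \<in> P"
  shows "ev (presented_algebra P) (presented_gen P) p = \<zero>\<^bsub>presented_algebra P\<^esub>"
proof -
  interpret k_ideal free_algebra "Idl\<^bsub>free_algebra\<^esub> P" by (rule presented_ideal)
  have "P \<subseteq> Idl\<^bsub>free_algebra\<^esub> P" by (rule A.genideal_self) simp
  then have "p \<in> Idl\<^bsub>free_algebra\<^esub> P" using assms by blast
  then have "Idl\<^bsub>free_algebra\<^esub> P +>\<^bsub>free_algebra\<^esub> p = Idl\<^bsub>free_algebra\<^esub> P" by (rule I.a_rcos_const)
  also have "\<dots> = \<zero>\<^bsub>presented_algebra P\<^esub>"
    by (simp only: presented_algebra_def quot_simps)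
  finally show ?thesis unfolding ev_presented_gen .
qed

lemma presented_eq:
  assumes "p - r \<in> P"
  shows "ev (presented_algebra P) (presented_gen P) p = ev (presented_algebra P) (presented_gen P) r"
  using presented_relation[OF assms]
  unfolding ev_diff_zero_iff[OF k_algebra_presented presented_gen_closed] .

text \<open>The kernel of evaluation is an ideal, so it contains the ideal generated by the relations.\<close>

lemma presented_universal:
  assumes B: "k_algebra B" and g: "\<And>x. g x \<in> carrier B"
    and rel: "\<And>p. p \<in> P \<Longrightarrow> ev B g p = \<zero>\<^bsub>B\<^esub>"
  shows "\<exists>h\<in>alg_hom (presented_algebra P) B. \<forall>x. h (presented_gen P x) = g x"
proof -
  interpret k_ideal free_algebra "Idl\<^bsub>free_algebra\<^esub> P" by (rule presented_ideal)
  interpret B: k_algebra B by fact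
  note ev = ev_simps[OF B g]
  have ev0: "ev B g 0 = \<zero>\<^bsub>B\<^esub>"
    using linear_maps_zero[OF k_algebra_free B alg_homD(6)[OF ev_hom[OF B g]]] by simp
  have "k_ideal free_algebra {p. ev B g p = \<zero>\<^bsub>B\<^esub>}"
    by (rule k_idealI) (simp_all add: ev ev0 del: pm.scale_minus_left)
  then have "ideal {p. ev B g p = \<zero>\<^bsub>B\<^esub>} free_algebra" by (rule k_ideal.axioms)
  then have "Idl\<^bsub>free_algebra\<^esub> P \<subseteq> {p. ev B g p = \<zero>\<^bsub>B\<^esub>}"
    using rel by (intro A.genideal_minimal) auto
  then have z: "\<And>p. p \<in> Idl\<^bsub>free_algebra\<^esub> P \<Longrightarrow> ev B g p = \<zero>\<^bsub>B\<^esub>" by auto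
  have "qlift (ev B g) \<in> alg_hom (presented_algebra P) B"
    unfolding presented_algebra_def by (rule qlift_hom[OF B ev_hom[OF B g] z])
  moreover have "qlift (ev B g) (presented_gen P x) = g x" for x
    unfolding presented_gen_def
    using qlift_eq[OF B alg_homD(6)[OF ev_hom[OF B g]] z, of "letter x"]
    by (simp only: ev free_algebra_simps UNIV_I)
  ultimately show ?thesis by blast
qed

section \<open>Tensor products of algebras\<close>

lemma pair_algebra_simps [simp]:
  "carrier (pair_algebra A B) = {f. Poly_Mapping.keys f \<subseteq> carrier A \<times> carrier B}"
  "\<one>\<^bsub>pair_algebra A B\<^esub> = Poly_Mapping.single (\<one>\<^bsub>A\<^esub>, \<one>\<^bsub>B\<^esub>) 1"
  "\<zero>\<^bsub>pair_algebra A B\<^esub> = 0" "f \<oplus>\<^bsub>pair_algebra A B\<^esub> g = f + g"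
  "c \<odot>\<^bsub>pair_algebra A B\<^esub> f = pm_scale c f"
  by (simp_all add: pair_algebra_def)

lemma pair_mult:
  "f \<otimes>\<^bsub>pair_algebra A B\<^esub> g = (\<Sum>p\<in>Poly_Mapping.keys f. \<Sum>r\<in>Poly_Mapping.keys g.
     Poly_Mapping.single (fst p \<otimes>\<^bsub>A\<^esub> fst r, snd p \<otimes>\<^bsub>B\<^esub> snd r)
       (Poly_Mapping.lookup f p * Poly_Mapping.lookup g r))"
  by (simp add: pair_algebra_def case_prod_unfold)

text \<open>The multiplication of \<^const>\<open>pair_algebra\<close> is a sum over supports.  Once it is known to be additive in
  both arguments, all its properties reduce to the product of two pairs.\<close>

lemma pair_mult_add_left:
  "(f + f') \<otimes>\<^bsub>pair_algebra A B\<^esub> g = f \<otimes>\<^bsub>pair_algebra A B\<^esub> g + f' \<otimes>\<^bsub>pair_algebra A B\<^esub> g"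
  unfolding pair_mult
  by (rule setsum_keys_plus_distrib) (simp_all add: distrib_right Poly_Mapping.single_add sum.distrib)

lemma pair_mult_add_right:
  "f \<otimes>\<^bsub>pair_algebra A B\<^esub> (g + g') = f \<otimes>\<^bsub>pair_algebra A B\<^esub> g + f \<otimes>\<^bsub>pair_algebra A B\<^esub> g'"
  unfolding pair_mult sum.distrib[symmetric]
  by (intro sum.cong refl setsum_keys_plus_distrib)
    (simp_all add: distrib_left Poly_Mapping.single_add)

lemma pair_mult_zero [simp]:
  "0 \<otimes>\<^bsub>pair_algebra A B\<^esub> g = 0" "f \<otimes>\<^bsub>pair_algebra A B\<^esub> 0 = 0"
  by (simp_all add: pair_mult)

lemma pair_mult_single:
  "Poly_Mapping.single (a, b) c \<otimes>\<^bsub>pair_algebra A B\<^esub> Poly_Mapping.single (a', b') c'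
     = Poly_Mapping.single (a \<otimes>\<^bsub>A\<^esub> a', b \<otimes>\<^bsub>B\<^esub> b') (c * c')"
  by (cases "c = 0"; cases "c' = 0") (simp_all add: pair_mult)

lemma pm_scale_single [simp]: "pm_scale c (Poly_Mapping.single k d) = Poly_Mapping.single k (c * d)"
  by (intro poly_mapping_eqI) (simp add: lookup_single when_def)

lemma pair_mult_scale:
  "pm_scale c f \<otimes>\<^bsub>pair_algebra A B\<^esub> g = pm_scale c (f \<otimes>\<^bsub>pair_algebra A B\<^esub> g)"
  "f \<otimes>\<^bsub>pair_algebra A B\<^esub> pm_scale c g = pm_scale c (f \<otimes>\<^bsub>pair_algebra A B\<^esub> g)"
proof -
  have 1: "pm_scale c f \<otimes>\<^bsub>pair_algebra A B\<^esub> g = pm_scale c (f \<otimes>\<^bsub>pair_algebra A B\<^esub> g)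
    \<and> g \<otimes>\<^bsub>pair_algebra A B\<^esub> pm_scale c f = pm_scale c (g \<otimes>\<^bsub>pair_algebra A B\<^esub> f)" for f g
  proof (induction f rule: poly_mapping_induct)
    case (single k d)
    then show ?case
    proof (induction g rule: poly_mapping_induct)
      case (single l e)
      then show ?case by (cases k; cases l) (simp add: pair_mult_single mult_ac)
    qed (simp_all add: pair_mult_add_left pair_mult_add_right pm.scale_right_distrib)
  qed (simp_all add: pair_mult_add_left pair_mult_add_right pm.scale_right_distrib)
  show "pm_scale c f \<otimes>\<^bsub>pair_algebra A B\<^esub> g = pm_scale c (f \<otimes>\<^bsub>pair_algebra A B\<^esub> g)"
    "f \<otimes>\<^bsub>pair_algebra A B\<^esub> pm_scale c g = pm_scale c (f \<otimes>\<^bsub>pair_algebra A B\<^esub> g)"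
    using 1 by blast+
qed

lemma keys_add_subset:
  "Poly_Mapping.keys f \<subseteq> S \<Longrightarrow> Poly_Mapping.keys g \<subseteq> S \<Longrightarrow> Poly_Mapping.keys (f + g) \<subseteq> S"
  using Poly_Mapping.keys_add[of f g] by auto

lemma keys_single_subset: "k \<in> S \<Longrightarrow> Poly_Mapping.keys (Poly_Mapping.single k c) \<subseteq> S"
  by simp

locale two_algebras = A: k_algebra A + B: k_algebra B
  for A :: "('k::field, 'a) module" and B :: "('k, 'b) module"
begin

abbreviation P where "P \<equiv> pair_algebra A B"
abbreviation S where "S \<equiv> carrier A \<times> carrier B"

lemma pair_mult_closed:
  assumes "Poly_Mapping.keys f \<subseteq> S" "Poly_Mapping.keys g \<subseteq> S"
  shows "Poly_Mapping.keys (f \<otimes>\<^bsub>P\<^esub> g) \<subseteq> S"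
  using assms(1)
proof (induction f rule: poly_mapping_keys_induct)
  case (single k c)
  note k = single
  from assms(2) show ?case
  proof (induction g rule: poly_mapping_keys_induct)
    case (single l d)
    then show ?case using k
      by (cases k; cases l) (auto simp: pair_mult_single split: if_splits)
  next
    case (add f g)
    then show ?case unfolding pair_mult_add_right by (intro keys_add_subset)
  qed simp
next
  case (add f g)
  then show ?case unfolding pair_mult_add_left by (intro keys_add_subset)
qed simp

lemma pair_mult_assoc:
  assumes "Poly_Mapping.keys f \<subseteq> S" "Poly_Mapping.keys g \<subseteq> S" "Poly_Mapping.keys h \<subseteq> S"
  shows "(f \<otimes>\<^bsub>P\<^esub> g) \<otimes>\<^bsub>P\<^esub> h = f \<otimes>\<^bsub>P\<^esub> (g \<otimes>\<^bsub>P\<^esub> h)"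
  using assms(1)
proof (induction f rule: poly_mapping_keys_induct)
  case (single k c)
  note k = single
  from assms(2) show ?case
  proof (induction g rule: poly_mapping_keys_induct)
    case (single l d)
    note l = single
    from assms(3) show ?case
    proof (induction h rule: poly_mapping_keys_induct)
      case (single m e)
      then show ?case using k l
        by (cases k; cases l; cases m) (simp add: pair_mult_single A.A.m_assoc B.A.m_assoc mult.assoc)
    qed (simp_all add: pair_mult_add_right)
  qed (simp_all add: pair_mult_add_left pair_mult_add_right)
qed (simp_all add: pair_mult_add_left)

lemma pair_mult_one:
  assumes "Poly_Mapping.keys f \<subseteq> S"
  shows "\<one>\<^bsub>P\<^esub> \<otimes>\<^bsub>P\<^esub> f = f" "f \<otimes>\<^bsub>P\<^esub> \<one>\<^bsub>P\<^esub> = f"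
proof -
  have "\<one>\<^bsub>P\<^esub> \<otimes>\<^bsub>P\<^esub> f = f \<and> f \<otimes>\<^bsub>P\<^esub> \<one>\<^bsub>P\<^esub> = f"
    using assms
  proof (induction f rule: poly_mapping_keys_induct)
    case (single k c)
    then show ?case by (cases k) (simp add: pair_mult_single)
  qed (simp_all add: pair_mult_add_left pair_mult_add_right)
  then show "\<one>\<^bsub>P\<^esub> \<otimes>\<^bsub>P\<^esub> f = f" "f \<otimes>\<^bsub>P\<^esub> \<one>\<^bsub>P\<^esub> = f" by auto
qed

lemma k_algebra_pair: "k_algebra P"
proof (rule k_algebraI)
  have "\<exists>g\<in>carrier P. g \<oplus>\<^bsub>P\<^esub> f = \<zero>\<^bsub>P\<^esub>" if "f \<in> carrier P" for f
    using that by (intro bexI[of _ "- f"]) (auto simp: in_keys_iff subset_iff)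
  then have ag: "abelian_group P"
    by (intro abelian_groupI) (simp_all add: keys_add_subset add_ac)
  have mon: "Group.monoid P"
    by (intro monoidI)
      (use pair_mult_closed pair_mult_assoc pair_mult_one in \<open>simp_all add: keys_single_subset\<close>)
  show "ring P"
    by (intro ringI ag mon) (simp_all add: pair_mult_add_left pair_mult_add_right)
qed (auto simp: pair_mult_scale pm.scale_left_distrib pm.scale_right_distrib in_keys_iff subset_iff)

abbreviation N where "N \<equiv> pm.span (bilinear_rels A B)"

lemma rels_carrier: "r \<in> bilinear_rels A B \<Longrightarrow> Poly_Mapping.keys r \<subseteq> S"
proof -
  have diff: "Poly_Mapping.keys (f - g) \<subseteq> S"
    if "Poly_Mapping.keys f \<subseteq> S" "Poly_Mapping.keys g \<subseteq> S" for f g :: "'a \<times> 'b \<Rightarrow>\<^sub>0 'k"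
  proof
    fix p assume "p \<in> Poly_Mapping.keys (f - g)"
    then have "p \<in> Poly_Mapping.keys f \<or> p \<in> Poly_Mapping.keys g" by (auto simp: in_keys_iff lookup_minus)
    then show "p \<in> S" using that by blast
  qed
  show "r \<in> bilinear_rels A B \<Longrightarrow> Poly_Mapping.keys r \<subseteq> S"
    by (induction rule: bilinear_rels.induct;
        intro diff keys_add_subset keys_single_subset SigmaI; simp)
qed

text \<open>Multiplying a bilinearity relation by a pair gives a bilinearity relation of the same kind; hence the span
  of these relations is an ideal.\<close>

lemma rels_mult_single:
  assumes "r \<in> bilinear_rels A B" "a0 \<in> carrier A" "b0 \<in> carrier B"
  shows "Poly_Mapping.single (a0, b0) 1 \<otimes>\<^bsub>P\<^esub> r \<in> bilinear_rels A B"
    "r \<otimes>\<^bsub>P\<^esub> Poly_Mapping.single (a0, b0) 1 \<in> bilinear_rels A B"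
proof -
  have diff: "f \<otimes>\<^bsub>P\<^esub> (g - h) = f \<otimes>\<^bsub>P\<^esub> g - f \<otimes>\<^bsub>P\<^esub> h" "(g - h) \<otimes>\<^bsub>P\<^esub> f = g \<otimes>\<^bsub>P\<^esub> f - h \<otimes>\<^bsub>P\<^esub> f" for f g h
    using pair_mult_add_right[of A B f "g - h" h] pair_mult_add_left[of A B "g - h" h f]
    by (simp_all add: algebra_simps)
  note simps = diff pair_mult_add_left pair_mult_add_right pair_mult_single
    A.A.r_distr A.A.l_distr B.A.r_distr B.A.l_distr
  show "Poly_Mapping.single (a0, b0) 1 \<otimes>\<^bsub>P\<^esub> r \<in> bilinear_rels A B"
    using assms by (induction rule: bilinear_rels.induct) (simp_all add: simps bilinear_rels.intros)
  show "r \<otimes>\<^bsub>P\<^esub> Poly_Mapping.single (a0, b0) 1 \<in> bilinear_rels A B"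
    using assms by (induction rule: bilinear_rels.induct) (simp_all add: simps bilinear_rels.intros)
qed

lemma k_ideal_N: "k_ideal P N"
proof -
  interpret P: k_algebra P by (rule k_algebra_pair)
  have mult: "f \<otimes>\<^bsub>P\<^esub> n \<in> N \<and> n \<otimes>\<^bsub>P\<^esub> f \<in> N" if "n \<in> N" "Poly_Mapping.keys f \<subseteq> S" for n f
    using that(1)
  proof (induction rule: pm.span_induct_alt)
    case base
    then show ?case by (simp add: pm.span_zero)
  next
    case (step c r n)
    have "f \<otimes>\<^bsub>P\<^esub> r \<in> N \<and> r \<otimes>\<^bsub>P\<^esub> f \<in> N"
      using that(2)
    proof (induction f rule: poly_mapping_keys_induct)
      case (single k d)
      obtain a b where k: "k = (a, b)" "a \<in> carrier A" "b \<in> carrier B" using single by auto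
      have "Poly_Mapping.single k d = pm_scale d (Poly_Mapping.single (a, b) 1)" by (simp add: k)
      then show ?case
        using rels_mult_single[OF step(1) k(2,3)]
        by (simp only: pair_mult_scale) (blast intro: pm.span_scale pm.span_base)
    qed (auto simp: pair_mult_add_left pair_mult_add_right pm.span_zero intro: pm.span_add)
    then show ?case using step
      by (simp add: pair_mult_add_left pair_mult_add_right pair_mult_scale pm.span_add pm.span_scale)
  qed
  have "N \<subseteq> carrier P"
  proof
    fix n assume "n \<in> N"
    then show "n \<in> carrier P"
    proof (induction rule: pm.span_induct_alt)
      case (step c r n)
      have "Poly_Mapping.keys (pm_scale c r) \<subseteq> S"
        using keys_pm_scale rels_carrier[OF step(1)] by (rule order_trans)
      then show ?case using step by (simp add: keys_add_subset)
    qed simp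
  qed
  then show ?thesis
    using mult by (intro P.k_idealI) (auto intro: pm.span_add pm.span_scale pm.span_zero)
qed

sublocale N: k_ideal P N by (rule k_ideal_N)

lemma k_algebra_tensor: "k_algebra (tensor A B)"
  unfolding tensor_def by (rule N.k_algebra_quot)

sublocale T: k_algebra "tensor A B" by (rule k_algebra_tensor)

lemma single_carrier: "a \<in> carrier A \<Longrightarrow> b \<in> carrier B \<Longrightarrow> Poly_Mapping.single (a, b) c \<in> carrier P"
  by (simp add: keys_single_subset del: keys_single)

lemma tens_closed [simp]: "a \<in> carrier A \<Longrightarrow> b \<in> carrier B \<Longrightarrow> tens A B a b \<in> carrier (tensor A B)"
  unfolding tens_def tensor_def N.carrier_quot using single_carrier by blast

lemma tens_mult [simp]:
  assumes "a \<in> carrier A" "b \<in> carrier B" "a' \<in> carrier A" "b' \<in> carrier B"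
  shows "tens A B a b \<otimes>\<^bsub>tensor A B\<^esub> tens A B a' b' = tens A B (a \<otimes>\<^bsub>A\<^esub> a') (b \<otimes>\<^bsub>B\<^esub> b')"
  unfolding tens_def tensor_def using assms single_carrier
  by (simp only: N.quot_simps pair_mult_single mult_1_left)

lemma tens_one: "\<one>\<^bsub>tensor A B\<^esub> = tens A B \<one>\<^bsub>A\<^esub> \<one>\<^bsub>B\<^esub>"
  by (simp only: tens_def tensor_def N.quot_simps pair_algebra_simps)

lemma coset_eqI:
  assumes "f - g \<in> bilinear_rels A B" "f \<in> carrier P" "g \<in> carrier P"
  shows "N +>\<^bsub>P\<^esub> f = N +>\<^bsub>P\<^esub> g"
  using assms by (intro N.quot_eqI) (auto intro: pm.span_base)

lemma tens_add_left:
  assumes "a \<in> carrier A" "a' \<in> carrier A" "b \<in> carrier B"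
  shows "tens A B (a \<oplus>\<^bsub>A\<^esub> a') b = tens A B a b \<oplus>\<^bsub>tensor A B\<^esub> tens A B a' b"
  unfolding tens_def tensor_def N.quot_simps(2)[OF single_carrier[OF assms(1,3)] single_carrier[OF assms(2,3)]]
  using assms bilinear_rels.intros(1)[OF assms]
  by (intro coset_eqI N.M.a_closed single_carrier) (auto simp: single_carrier simp del: keys_single)

lemma tens_add_right:
  assumes "a \<in> carrier A" "b \<in> carrier B" "b' \<in> carrier B"
  shows "tens A B a (b \<oplus>\<^bsub>B\<^esub> b') = tens A B a b \<oplus>\<^bsub>tensor A B\<^esub> tens A B a b'"
  unfolding tens_def tensor_def N.quot_simps(2)[OF single_carrier[OF assms(1,2)] single_carrier[OF assms(1,3)]]
  using assms bilinear_rels.intros(2)[OF assms]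
  by (intro coset_eqI N.M.a_closed single_carrier) (auto simp: single_carrier simp del: keys_single)

lemma smult_tens:
  assumes "a \<in> carrier A" "b \<in> carrier B"
  shows "c \<odot>\<^bsub>tensor A B\<^esub> tens A B a b = N +>\<^bsub>P\<^esub> Poly_Mapping.single (a, b) c"
  unfolding tens_def tensor_def N.quot_smult[OF single_carrier[OF assms]] by simp

lemma tens_smult_left [simp]:
  assumes "a \<in> carrier A" "b \<in> carrier B"
  shows "tens A B (c \<odot>\<^bsub>A\<^esub> a) b = c \<odot>\<^bsub>tensor A B\<^esub> tens A B a b"
  unfolding smult_tens[OF assms] unfolding tens_def
  using assms bilinear_rels.intros(3)[OF assms] by (intro coset_eqI single_carrier) auto

lemma tens_smult_right [simp]:
  assumes "a \<in> carrier A" "b \<in> carrier B"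
  shows "tens A B a (c \<odot>\<^bsub>B\<^esub> b) = c \<odot>\<^bsub>tensor A B\<^esub> tens A B a b"
  unfolding smult_tens[OF assms] unfolding tens_def
  using assms bilinear_rels.intros(4)[OF assms] by (intro coset_eqI single_carrier) auto

lemma tens_zero [simp]:
  "b \<in> carrier B \<Longrightarrow> tens A B \<zero>\<^bsub>A\<^esub> b = \<zero>\<^bsub>tensor A B\<^esub>"
  "a \<in> carrier A \<Longrightarrow> tens A B a \<zero>\<^bsub>B\<^esub> = \<zero>\<^bsub>tensor A B\<^esub>"
proof -
  show "tens A B \<zero>\<^bsub>A\<^esub> b = \<zero>\<^bsub>tensor A B\<^esub>" if "b \<in> carrier B"
    using tens_smult_left[of "\<zero>\<^bsub>A\<^esub>" b 0] that by simp
  show "tens A B a \<zero>\<^bsub>B\<^esub> = \<zero>\<^bsub>tensor A B\<^esub>" if "a \<in> carrier A"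
    using tens_smult_right[of a "\<zero>\<^bsub>B\<^esub>" 0] that by simp
qed

text \<open>Neither zero nor scalar multiples need a case of their own, as \<open>c (a \<otimes> b) = (c a) \<otimes> b\<close>.\<close>

lemma tensor_induct [consumes 1, case_names tens add]:
  assumes "X \<in> carrier (tensor A B)"
    and tens: "\<And>a b. a \<in> carrier A \<Longrightarrow> b \<in> carrier B \<Longrightarrow> Q (tens A B a b)"
    and add: "\<And>X Y. X \<in> carrier (tensor A B) \<Longrightarrow> Y \<in> carrier (tensor A B) \<Longrightarrow> Q X \<Longrightarrow> Q Y
      \<Longrightarrow> Q (X \<oplus>\<^bsub>tensor A B\<^esub> Y)"
  shows "Q X"
proof -
  have carr: "N +>\<^bsub>P\<^esub> f \<in> carrier (tensor A B)" if "Poly_Mapping.keys f \<subseteq> S" for f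
    unfolding tensor_def N.carrier_quot using that by auto
  obtain f where f: "Poly_Mapping.keys f \<subseteq> S" and X: "X = N +>\<^bsub>P\<^esub> f"
    using assms(1) unfolding tensor_def N.carrier_quot by auto
  show ?thesis
    unfolding X using f
  proof (induction f rule: poly_mapping_keys_induct)
    case zero
    have "N +>\<^bsub>P\<^esub> 0 = \<zero>\<^bsub>tensor A B\<^esub>"
      unfolding tensor_def N.quot_simps(4) by (rule N.I.a_rcos_const) (rule pm.span_zero)
    then show ?case using tens[of "\<zero>\<^bsub>A\<^esub>" "\<zero>\<^bsub>B\<^esub>"] by simp
  next
    case (single k c)
    then obtain a b where k: "k = (a, b)" "a \<in> carrier A" "b \<in> carrier B" by auto
    have "N +>\<^bsub>P\<^esub> Poly_Mapping.single k c = tens A B (c \<odot>\<^bsub>A\<^esub> a) b"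
      unfolding k(1) using k(2,3) by (simp add: smult_tens)
    then show ?case using tens[of "c \<odot>\<^bsub>A\<^esub> a" b] k(2,3) by (simp del: tens_smult_left)
  next
    case (add f g)
    have "N +>\<^bsub>P\<^esub> (f + g) = (N +>\<^bsub>P\<^esub> f) \<oplus>\<^bsub>tensor A B\<^esub> (N +>\<^bsub>P\<^esub> g)"
      unfolding tensor_def using add by (subst N.quot_simps(2)) auto
    then show ?case using assms(3)[OF carr carr] add by simp
  qed
qed

definition bilin :: "('k, 'c) module \<Rightarrow> ('a \<Rightarrow> 'b \<Rightarrow> 'c) \<Rightarrow> bool" where
  "bilin C h \<longleftrightarrow> (\<forall>b\<in>carrier B. (\<lambda>a. h a b) \<in> linear_maps A C) \<and> (\<forall>a\<in>carrier A. h a \<in> linear_maps B C)"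

text \<open>The induced linear map on the free vector space annihilates the bilinearity relations, so its value does not
  depend on the chosen representative.\<close>

lemma tensor_lift:
  fixes C :: "('k, 'c) module"
  assumes C: "k_algebra C" and h: "bilin C h"
  shows "tensor_lift C h \<in> linear_maps (tensor A B) C"
    "a \<in> carrier A \<Longrightarrow> b \<in> carrier B \<Longrightarrow> tensor_lift C h (tens A B a b) = h a b"
proof -
  interpret C: k_algebra C by fact
  have hL: "(\<lambda>a. h a b) \<in> linear_maps A C" if "b \<in> carrier B" for b using h that by (auto simp: bilin_def)
  have hR: "h a \<in> linear_maps B C" if "a \<in> carrier A" for a using h that by (auto simp: bilin_def)
  define H where "H p = h (fst p) (snd p)" for p
  have Hc: "H p \<in> carrier C" if "p \<in> S" for p
    using that linear_mapsD(1)[OF hR] by (auto simp: H_def)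
  then have HP: "H \<in> Poly_Mapping.keys f \<rightarrow> carrier C" if "Poly_Mapping.keys f \<subseteq> S" for f :: "'a \<times> 'b \<Rightarrow>\<^sub>0 'k"
    using that by auto
  have lin: "lin_ext C H \<in> linear_maps P C"
    by (intro linear_mapsI) (simp_all add: C.lin_ext_closed C.lin_ext_add C.lin_ext_pm_scale HP)
  note L = linear_mapsD[OF lin]
  have s: "lin_ext C H (Poly_Mapping.single (a, b) c) = c \<odot>\<^bsub>C\<^esub> h a b"
    if "a \<in> carrier A" "b \<in> carrier B" for a b c
    using Hc[of "(a, b)"] that by (subst C.lin_ext_single) (auto simp: H_def)
  have hc: "h a b \<in> carrier C" if "a \<in> carrier A" "b \<in> carrier B" for a b
    using linear_mapsD(1)[OF hR] that .
  have sub: "lin_ext C H (f - g) = lin_ext C H f \<oplus>\<^bsub>C\<^esub> (- 1) \<odot>\<^bsub>C\<^esub> lin_ext C H g"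
    if "f \<in> carrier P" "g \<in> carrier P" for f g
  proof -
    have "f - g = f \<oplus>\<^bsub>P\<^esub> (- 1) \<odot>\<^bsub>P\<^esub> g" by simp
    then show ?thesis using that L(2,3) N.sc_closed by metis
  qed
  have subz: "lin_ext C H (f - g) = \<zero>\<^bsub>C\<^esub>"
    if "f \<in> carrier P" "g \<in> carrier P" "lin_ext C H f = lin_ext C H g" for f g
    unfolding sub[OF that(1,2)] that(3) using L(1)[OF that(2)] by (simp add: C.eq_iff_sub_zero)
  have add: "lin_ext C H (f + g) = lin_ext C H f \<oplus>\<^bsub>C\<^esub> lin_ext C H g" "f + g \<in> carrier P"
    if "f \<in> carrier P" "g \<in> carrier P" for f g
    using L(2)[OF that] N.M.a_closed[OF that] by simp_all
  have rel: "lin_ext C H r = \<zero>\<^bsub>C\<^esub>" if "r \<in> bilinear_rels A B" for r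
    using that
    by (cases rule: bilinear_rels.cases; hypsubst; intro subz add(2) single_carrier)
      (simp_all add: add(1) single_carrier s hc linear_mapsD(2,3)[OF hL] linear_mapsD(2,3)[OF hR]
        del: pair_algebra_simps)
  have "lin_ext C H n = \<zero>\<^bsub>C\<^esub> \<and> n \<in> carrier P" if "n \<in> N" for n
    using that
  proof (induction rule: pm.span_induct_alt)
    case base
    then show ?case using linear_maps_zero[OF k_algebra_pair C lin] by simp
  next
    case (step c r n)
    have r: "r \<in> carrier P" using rels_carrier[OF step(1)] by simp
    show ?case
      using add[OF N.sc_closed[OF r, of c], of n] L(3)[OF r, of c] rel[OF step(1)] step(2) by simp
  qed
  then have z: "\<And>n. n \<in> N \<Longrightarrow> lin_ext C H n = \<zero>\<^bsub>C\<^esub>" by blast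
  have eq: "tensor_lift C h = qlift (lin_ext C H)"
    unfolding tensor_lift_def qlift_def lin_ext_def H_def Let_def ..
  show "tensor_lift C h \<in> linear_maps (tensor A B) C"
    unfolding eq tensor_def by (rule N.qlift_linear[OF C lin z])
  assume ab: "a \<in> carrier A" "b \<in> carrier B"
  then have "tensor_lift C h (tens A B a b) = lin_ext C H (Poly_Mapping.single (a, b) 1)"
    unfolding eq tens_def by (intro N.qlift_eq[OF C lin z] single_carrier)
  then show "tensor_lift C h (tens A B a b) = h a b" using s[OF ab] hc[OF ab] by simp
qed

text \<open>Both sides of the product rule are bilinear, so pure tensors suffice.\<close>

lemma tensor_homI:
  assumes "k_algebra C" and L: "L \<in> linear_maps (tensor A B) C"
    and one: "L (tens A B \<one>\<^bsub>A\<^esub> \<one>\<^bsub>B\<^esub>) = \<one>\<^bsub>C\<^esub>"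
    and mult: "\<And>a b a' b'. a \<in> carrier A \<Longrightarrow> b \<in> carrier B \<Longrightarrow> a' \<in> carrier A \<Longrightarrow> b' \<in> carrier B \<Longrightarrow>
      L (tens A B (a \<otimes>\<^bsub>A\<^esub> a') (b \<otimes>\<^bsub>B\<^esub> b')) = L (tens A B a b) \<otimes>\<^bsub>C\<^esub> L (tens A B a' b')"
  shows "L \<in> alg_hom (tensor A B) C"
proof (rule alg_homI[OF L])
  interpret C: k_algebra C by fact
  note D = linear_mapsD[OF L]
  show "L (X \<otimes>\<^bsub>tensor A B\<^esub> Y) = L X \<otimes>\<^bsub>C\<^esub> L Y"
    if X: "X \<in> carrier (tensor A B)" and Y: "Y \<in> carrier (tensor A B)" for X Y
    using X
  proof (induction rule: tensor_induct)
    case (tens a b)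
    note ab = this
    from Y show ?case
    proof (induction rule: tensor_induct)
      case (tens a' b')
      then show ?case using ab by (simp add: mult)
    next
      case (add X Y)
      then show ?case using ab by (simp add: D T.A.r_distr C.A.r_distr)
    qed
  next
    case (add X Z)
    then show ?case using Y by (simp add: D T.A.l_distr C.A.l_distr)
  qed
  show "L \<one>\<^bsub>tensor A B\<^esub> = \<one>\<^bsub>C\<^esub>" using one by (simp add: tens_one)
qed

end

lemma tensor_map:
  assumes A: "k_algebra A" and B: "k_algebra B" and C: "k_algebra C" and D: "k_algebra D"
    and g: "g \<in> linear_maps A C" and h: "h \<in> linear_maps B D"
  shows "tensor_map C D g h \<in> linear_maps (tensor A B) (tensor C D)"
    "a \<in> carrier A \<Longrightarrow> b \<in> carrier B \<Longrightarrow> tensor_map C D g h (tens A B a b) = tens C D (g a) (h b)"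
proof -
  interpret AB: two_algebras A B using A B by (rule two_algebras.intro)
  interpret CD: two_algebras C D using C D by (rule two_algebras.intro)
  have b: "AB.bilin (tensor C D) (\<lambda>a b. tens C D (g a) (h b))"
    unfolding AB.bilin_def
    by (auto intro!: linear_mapsI simp: linear_mapsD[OF g] linear_mapsD[OF h] CD.tens_add_left CD.tens_add_right)
  show "tensor_map C D g h \<in> linear_maps (tensor A B) (tensor C D)"
    "a \<in> carrier A \<Longrightarrow> b \<in> carrier B \<Longrightarrow> tensor_map C D g h (tens A B a b) = tens C D (g a) (h b)"
    unfolding tensor_map_def by (rule AB.tensor_lift[OF CD.k_algebra_tensor b])+
qed

lemma tensor_map_hom:
  assumes A: "k_algebra A" and B: "k_algebra B" and C: "k_algebra C" and D: "k_algebra D"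
    and g: "g \<in> alg_hom A C" and h: "h \<in> alg_hom B D"
  shows "tensor_map C D g h \<in> alg_hom (tensor A B) (tensor C D)"
proof -
  interpret AB: two_algebras A B using A B by (rule two_algebras.intro)
  interpret CD: two_algebras C D using C D by (rule two_algebras.intro)
  note m = tensor_map[OF A B C D alg_homD(6)[OF g] alg_homD(6)[OF h]]
  show ?thesis
    by (rule AB.tensor_homI[OF CD.k_algebra_tensor m(1)])
      (simp_all add: m(2) alg_homD[OF g] alg_homD[OF h] CD.tens_one)
qed

text \<open>The map is a lift of a lift.  The inner one is bilinear in \<open>t\<close> and \<open>c\<close> and multiplicative, by
  induction over \<open>t\<close>.\<close>

lemma tensor_assoc:
  assumes A: "k_algebra A" and B: "k_algebra B" and C: "k_algebra C"
  shows "tensor_assoc A B C \<in> alg_hom (tensor (tensor A B) C) (tensor A (tensor B C))"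
    "a \<in> carrier A \<Longrightarrow> b \<in> carrier B \<Longrightarrow> c \<in> carrier C \<Longrightarrow>
      tensor_assoc A B C (tens (tensor A B) C (tens A B a b) c) = tens A (tensor B C) a (tens B C b c)"
proof -
  interpret AB: two_algebras A B using A B by (rule two_algebras.intro)
  interpret BC: two_algebras B C using B C by (rule two_algebras.intro)
  interpret ABC: two_algebras A "tensor B C" using A BC.k_algebra_tensor by (rule two_algebras.intro)
  interpret ABC': two_algebras "tensor A B" C using AB.k_algebra_tensor C by (rule two_algebras.intro)
  let ?T = "tensor A (tensor B C)"
  let ?in = "\<lambda>c. tensor_lift ?T (\<lambda>a b. tens A (tensor B C) a (tens B C b c))"
  have b1: "AB.bilin ?T (\<lambda>a b. tens A (tensor B C) a (tens B C b c))" if "c \<in> carrier C" for c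
    unfolding AB.bilin_def using that
    by (auto intro!: linear_mapsI simp: ABC.tens_add_left ABC.tens_add_right BC.tens_add_left)
  note in1 = AB.tensor_lift[OF ABC.k_algebra_tensor b1]
  have addc: "?in (c \<oplus>\<^bsub>C\<^esub> d) t = ?in c t \<oplus>\<^bsub>?T\<^esub> ?in d t"
    if "t \<in> carrier (tensor A B)" "c \<in> carrier C" "d \<in> carrier C" for t c d
    using that(1)
  proof (induction rule: AB.tensor_induct)
    case (add X Y)
    then show ?case using that(2,3) linear_mapsD[OF in1(1)]
      by (simp add: ABC.T.M.a_ac)
  qed (use that in \<open>simp add: in1(2) BC.tens_add_right ABC.tens_add_right\<close>)
  have smultc: "?in (k \<odot>\<^bsub>C\<^esub> c) t = k \<odot>\<^bsub>?T\<^esub> ?in c t"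
    if "t \<in> carrier (tensor A B)" "c \<in> carrier C" for t c k
    using that(1)
  proof (induction rule: AB.tensor_induct)
    case (add X Y)
    then show ?case using that(2) linear_mapsD[OF in1(1)] by (simp add: ABC.T.sc_distr)
  qed (use that in \<open>simp add: in1(2)\<close>)
  have b2: "ABC'.bilin ?T (\<lambda>t c. ?in c t)"
    unfolding ABC'.bilin_def
    by (auto intro!: linear_mapsI simp: addc smultc linear_mapsD[OF in1(1)])
  note out = ABC'.tensor_lift[OF ABC.k_algebra_tensor b2]
  have val: "tensor_assoc A B C (tens (tensor A B) C t c) = ?in c t"
    if "t \<in> carrier (tensor A B)" "c \<in> carrier C" for t c
    unfolding tensor_assoc_def by (rule out(2)[OF that])
  have lin: "tensor_assoc A B C \<in> linear_maps (tensor (tensor A B) C) ?T"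
    unfolding tensor_assoc_def by (rule out(1))
  show "tensor_assoc A B C (tens (tensor A B) C (tens A B a b) c) = tens A (tensor B C) a (tens B C b c)"
    if "a \<in> carrier A" "b \<in> carrier B" "c \<in> carrier C" for a b c
    using that by (simp add: val in1(2))
  have inmult: "?in (c \<otimes>\<^bsub>C\<^esub> d) (t \<otimes>\<^bsub>tensor A B\<^esub> u) = ?in c t \<otimes>\<^bsub>?T\<^esub> ?in d u"
    if t: "t \<in> carrier (tensor A B)" and u: "u \<in> carrier (tensor A B)" and cd: "c \<in> carrier C" "d \<in> carrier C"
    for t u c d
    using t
  proof (induction rule: AB.tensor_induct)
    case (tens a b)
    note ab = this
    from u show ?case
    proof (induction rule: AB.tensor_induct)
      case (tens a' b')
      then show ?case using ab cd by (simp add: in1(2))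
    next
      case (add X Y)
      then show ?case using ab cd linear_mapsD[OF in1(1)]
        by (simp add: AB.T.A.r_distr ABC.T.A.r_distr)
    qed
  next
    case (add X Z)
    then show ?case using u cd linear_mapsD[OF in1(1)]
      by (simp add: AB.T.A.l_distr ABC.T.A.l_distr)
  qed
  show "tensor_assoc A B C \<in> alg_hom (tensor (tensor A B) C) ?T"
    by (rule ABC'.tensor_homI[OF ABC.k_algebra_tensor lin])
      (simp_all add: val inmult in1(2) AB.tens_one BC.tens_one ABC.tens_one)
qed

section \<open>Hopf algebras from generators\<close>

text \<open>Each generator is grouplike or skew primitive.  In a quantum group all generators are of one of these
  two kinds, and the axioms hold for such elements by a direct computation.\<close>

locale hopf_on_generators = k_algebra A
  for A :: "('k::field, 'a) module" (structure) +
  fixes G :: "'a set" and \<Delta> :: "'a \<Rightarrow> ('a \<times> 'a \<Rightarrow>\<^sub>0 'k) set" and \<epsilon> :: "'a \<Rightarrow> 'k" and S :: "'a \<Rightarrow> 'a"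
  assumes G: "G \<subseteq> carrier A" "carrier A = alg_gen A G"
    and Delta: "\<Delta> \<in> alg_hom A (tensor A A)" and eps: "\<epsilon> \<in> alg_hom A scalars"
    and S: "S \<in> alg_hom A (op_alg A)"
    and gens: "\<And>x. x \<in> G \<Longrightarrow>
      (\<Delta> x = tens A A x x \<and> \<epsilon> x = 1 \<and> S x \<otimes> x = \<one> \<and> x \<otimes> S x = \<one>) \<or>
      (\<exists>g\<in>carrier A. \<exists>h\<in>carrier A. \<Delta> g = tens A A g g \<and> \<Delta> h = tens A A h h \<and> \<epsilon> g = 1 \<and> \<epsilon> h = 1 \<and>
        \<Delta> x = tens A A g x \<oplus>\<^bsub>tensor A A\<^esub> tens A A x h \<and> \<epsilon> x = 0 \<and>
        S g \<otimes> x \<oplus> S x \<otimes> h = \<zero> \<and> g \<otimes> S x \<oplus> x \<otimes> S h = \<zero>)"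
begin

sublocale AA: two_algebras A A by (intro two_algebras.intro k_algebra_axioms)

lemma AAA: "two_algebras (tensor A A) A" "two_algebras A (tensor A A)"
  by (intro two_algebras.intro k_algebra_axioms AA.k_algebra_tensor)+

lemma S_simps:
  "x \<in> carrier A \<Longrightarrow> S x \<in> carrier A"
  "x \<in> carrier A \<Longrightarrow> y \<in> carrier A \<Longrightarrow> S (x \<oplus> y) = S x \<oplus> S y"
  "x \<in> carrier A \<Longrightarrow> S (c \<odot> x) = c \<odot> S x"
  "x \<in> carrier A \<Longrightarrow> y \<in> carrier A \<Longrightarrow> S (x \<otimes> y) = S y \<otimes> S x"
  "S \<one> = \<one>"
  using alg_homD[OF S] by auto

lemma eps_simps:
  "x \<in> carrier A \<Longrightarrow> y \<in> carrier A \<Longrightarrow> \<epsilon> (x \<oplus> y) = \<epsilon> x + \<epsilon> y"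
  "x \<in> carrier A \<Longrightarrow> \<epsilon> (c \<odot> x) = c * \<epsilon> x"
  "x \<in> carrier A \<Longrightarrow> y \<in> carrier A \<Longrightarrow> \<epsilon> (x \<otimes> y) = \<epsilon> x * \<epsilon> y"
  "\<epsilon> \<one> = 1"
  using alg_homD[OF eps] by auto

lemmas Delta_simps = alg_homD[OF Delta]

abbreviation "Tl \<equiv> tensor_map (tensor A A) A \<Delta> id"
abbreviation "Tr \<equiv> tensor_map A (tensor A A) id \<Delta>"

lemma Tl: "Tl \<in> alg_hom (tensor A A) (tensor (tensor A A) A)"
    "a \<in> carrier A \<Longrightarrow> b \<in> carrier A \<Longrightarrow> Tl (tens A A a b) = tens (tensor A A) A (\<Delta> a) b"
  using tensor_map_hom[OF k_algebra_axioms k_algebra_axioms AA.k_algebra_tensor k_algebra_axioms Delta alg_hom_id]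
    tensor_map(2)[OF k_algebra_axioms k_algebra_axioms AA.k_algebra_tensor k_algebra_axioms
      alg_homD(6)[OF Delta] alg_homD(6)[OF alg_hom_id]]
  by simp_all

lemma Tr: "Tr \<in> alg_hom (tensor A A) (tensor A (tensor A A))"
    "a \<in> carrier A \<Longrightarrow> b \<in> carrier A \<Longrightarrow> Tr (tens A A a b) = tens A (tensor A A) a (\<Delta> b)"
  using tensor_map_hom[OF k_algebra_axioms k_algebra_axioms k_algebra_axioms AA.k_algebra_tensor alg_hom_id Delta]
    tensor_map(2)[OF k_algebra_axioms k_algebra_axioms k_algebra_axioms AA.k_algebra_tensor
      alg_homD(6)[OF alg_hom_id] alg_homD(6)[OF Delta]]
  by simp_all

text \<open>Both sides are homomorphisms in \<open>x\<close>.\<close>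

lemma coassoc:
  assumes "x \<in> carrier A"
  shows "tensor_assoc A A A (Tl (\<Delta> x)) = Tr (\<Delta> x)"
proof -
  interpret L: two_algebras "tensor A A" A by (rule AAA)
  interpret R: two_algebras A "tensor A A" by (rule AAA)
  note as = tensor_assoc[OF k_algebra_axioms k_algebra_axioms k_algebra_axioms]
  note D = alg_homD[OF as(1)] alg_homD[OF Tl(1)] alg_homD[OF Tr(1)] alg_homD[OF Delta] as(2)
  have "(tensor_assoc A A A \<circ> (Tl \<circ> \<Delta>)) x = (Tr \<circ> \<Delta>) x"
  proof (rule alg_hom_eqI[OF k_algebra_axioms _ _ G(1)])
    show "tensor_assoc A A A \<circ> (Tl \<circ> \<Delta>) \<in> alg_hom A (tensor A (tensor A A))"
      by (rule alg_hom_comp[OF alg_hom_comp[OF Delta Tl(1)] as(1)])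
    show "Tr \<circ> \<Delta> \<in> alg_hom A (tensor A (tensor A A))"
      by (rule alg_hom_comp[OF Delta Tr(1)])
    show "x \<in> alg_gen A G" using assms G by simp
    fix x assume xG: "x \<in> G"
    then have x: "x \<in> carrier A" using G by auto
    from gens[OF xG] show "(tensor_assoc A A A \<circ> (Tl \<circ> \<Delta>)) x = (Tr \<circ> \<Delta>) x"
    proof (elim disjE bexE conjE)
      assume "\<Delta> x = tens A A x x"
      then show ?thesis using x by (simp add: Tl Tr D)
    next
      fix g h assume gh: "g \<in> carrier A" "h \<in> carrier A" "\<Delta> g = tens A A g g" "\<Delta> h = tens A A h h"
        "\<Delta> x = tens A A g x \<oplus>\<^bsub>tensor A A\<^esub> tens A A x h"
      then have "tensor_assoc A A A (Tl (\<Delta> x)) = tens A (tensor A A) g (tens A A g x)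
         \<oplus>\<^bsub>tensor A (tensor A A)\<^esub> (tens A (tensor A A) g (tens A A x h)
         \<oplus>\<^bsub>tensor A (tensor A A)\<^esub> tens A (tensor A A) x (tens A A h h))"
        using x by (simp add: D Tl(2) L.tens_add_left)
      moreover have "Tr (\<Delta> x) = tens A (tensor A A) g (tens A A g x)
         \<oplus>\<^bsub>tensor A (tensor A A)\<^esub> (tens A (tensor A A) g (tens A A x h)
         \<oplus>\<^bsub>tensor A (tensor A A)\<^esub> tens A (tensor A A) x (tens A A h h))"
        using x gh by (simp add: D Tr(2) R.tens_add_right R.T.M.a_assoc)
      ultimately show ?thesis by simp
    qed
  qed
  then show ?thesis by simp
qed

text \<open>The maps \<open>a \<otimes> b \<mapsto> \<epsilon>(a) b\<close> and \<open>a \<otimes> b \<mapsto> \<epsilon>(b) a\<close> are homomorphisms because \<open>\<epsilon>\<close> takes values in the field.\<close>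

lemma counits:
  assumes "x \<in> carrier A"
  shows "tensor_lift A (\<lambda>a b. \<epsilon> a \<odot> b) (\<Delta> x) = x" (is "?L (\<Delta> x) = x")
    and "tensor_lift A (\<lambda>a b. \<epsilon> b \<odot> a) (\<Delta> x) = x" (is "?R (\<Delta> x) = x")
proof -
  have bL: "AA.bilin A (\<lambda>a b. \<epsilon> a \<odot> b)" and bR: "AA.bilin A (\<lambda>a b. \<epsilon> b \<odot> a)"
    unfolding AA.bilin_def
    by (auto intro!: linear_mapsI simp: eps_simps sc_add sc_distr mult.commute)
  note L = AA.tensor_lift[OF k_algebra_axioms bL] and R = AA.tensor_lift[OF k_algebra_axioms bR]
  have homs: "?L \<in> alg_hom (tensor A A) A" "?R \<in> alg_hom (tensor A A) A"
    by (rule AA.tensor_homI[OF k_algebra_axioms L(1)], simp_all add: L(2) eps_simps mult.commute)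
      (rule AA.tensor_homI[OF k_algebra_axioms R(1)], simp_all add: R(2) eps_simps mult.commute)
  have gen: "?L (\<Delta> x) = x \<and> ?R (\<Delta> x) = x" if xG: "x \<in> G" for x
  proof -
    have x: "x \<in> carrier A" using G xG by auto
    from gens[OF xG] show ?thesis
    proof (elim disjE bexE conjE)
      assume "\<Delta> x = tens A A x x" "\<epsilon> x = 1"
      then show ?thesis using x by (simp add: L(2) R(2))
    next
      fix g h assume gh: "g \<in> carrier A" "h \<in> carrier A" "\<epsilon> g = 1" "\<epsilon> h = 1" "\<epsilon> x = 0"
        "\<Delta> x = tens A A g x \<oplus>\<^bsub>tensor A A\<^esub> tens A A x h"
      then show ?thesis using x
        by (simp add: alg_homD[OF homs(1)] alg_homD[OF homs(2)] L(2) R(2))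
    qed
  qed
  have eq: "(H \<circ> \<Delta>) x = id x"
    if "H \<in> alg_hom (tensor A A) A" "\<And>x. x \<in> G \<Longrightarrow> H (\<Delta> x) = x" for H
    by (rule alg_hom_eqI[OF k_algebra_axioms alg_hom_comp[OF Delta that(1)] alg_hom_id G(1)])
      (use that assms G in auto)
  show "?L (\<Delta> x) = x" using eq[OF homs(1)] gen by simp
  show "?R (\<Delta> x) = x" using eq[OF homs(2)] gen by simp
qed

text \<open>The maps \<open>a \<otimes> b \<mapsto> S(a) b\<close> and \<open>a \<otimes> b \<mapsto> a S(b)\<close> are not multiplicative, but each satisfies a
  one-sided product rule, which suffices to pass from generators to products.\<close>

lemma antipodes:
  assumes "x \<in> carrier A"
  shows "tensor_lift A (\<lambda>a b. S a \<otimes> b) (\<Delta> x) = \<epsilon> x \<odot> \<one> \<and>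
    tensor_lift A (\<lambda>a b. a \<otimes> S b) (\<Delta> x) = \<epsilon> x \<odot> \<one>" (is "?L (\<Delta> x) = _ \<and> ?R (\<Delta> x) = _")
proof -
  have bL: "AA.bilin A (\<lambda>a b. S a \<otimes> b)" and bR: "AA.bilin A (\<lambda>a b. a \<otimes> S b)"
    unfolding AA.bilin_def
    by (auto intro!: linear_mapsI simp: S_simps A.l_distr A.r_distr)
  note L = AA.tensor_lift[OF k_algebra_axioms bL] and R = AA.tensor_lift[OF k_algebra_axioms bR]
  note LD = linear_mapsD[OF L(1)] and RD = linear_mapsD[OF R(1)]
  have L1: "?L (X \<otimes>\<^bsub>tensor A A\<^esub> tens A A c d) = S c \<otimes> (?L X \<otimes> d)"
    if "X \<in> carrier (tensor A A)" "c \<in> carrier A" "d \<in> carrier A" for X c d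
    using that(1)
  proof (induction rule: AA.tensor_induct)
    case (tens a b)
    then show ?case using that(2,3) by (simp add: L(2) S_simps A.m_assoc)
  next
    case (add X Y)
    then show ?case using that(2,3)
      by (simp add: LD S_simps AA.T.A.l_distr A.l_distr A.r_distr)
  qed
  have R1: "?R (tens A A a b \<otimes>\<^bsub>tensor A A\<^esub> Y) = a \<otimes> (?R Y \<otimes> S b)"
    if "Y \<in> carrier (tensor A A)" "a \<in> carrier A" "b \<in> carrier A" for Y a b
    using that(1)
  proof (induction rule: AA.tensor_induct)
    case (tens c d)
    then show ?case using that(2,3) by (simp add: R(2) S_simps A.m_assoc)
  next
    case (add X Y)
    then show ?case using that(2,3)
      by (simp add: RD S_simps AA.T.A.r_distr A.l_distr A.r_distr)
  qed
  have L2: "?L (X \<otimes>\<^bsub>tensor A A\<^esub> Y) = l \<odot> ?L Y"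
    if "X \<in> carrier (tensor A A)" "Y \<in> carrier (tensor A A)" "?L X = l \<odot> \<one>" for X Y l
    using that(2)
  proof (induction rule: AA.tensor_induct)
    case (tens c d)
    then show ?case using that(1,3) by (simp add: L1 L(2) S_simps)
  next
    case (add Y Z)
    then show ?case using that(1) by (simp add: LD AA.T.A.r_distr sc_distr)
  qed
  have R2: "?R (X \<otimes>\<^bsub>tensor A A\<^esub> Y) = l \<odot> ?R X"
    if "X \<in> carrier (tensor A A)" "Y \<in> carrier (tensor A A)" "?R Y = l \<odot> \<one>" for X Y l
    using that(1)
  proof (induction rule: AA.tensor_induct)
    case (tens c d)
    then show ?case using that(2,3) by (simp add: R1 R(2) S_simps)
  next
    case (add Y Z)
    then show ?case using that(2) by (simp add: RD AA.T.A.l_distr sc_distr)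
  qed
  from assms have "x \<in> alg_gen A G" using G by simp
  then show ?thesis
  proof induction
    case one
    then show ?case by (simp add: Delta_simps(5) AA.tens_one L(2) R(2) S_simps eps_simps)
  next
    case (gen x)
    then have x: "x \<in> carrier A" using G by auto
    from gens[OF gen] show ?case
    proof (elim disjE bexE conjE)
      assume "\<Delta> x = tens A A x x" "\<epsilon> x = 1" "S x \<otimes> x = \<one>" "x \<otimes> S x = \<one>"
      then show ?thesis using x by (simp add: L(2) R(2))
    next
      fix g h assume gh: "g \<in> carrier A" "h \<in> carrier A" "\<epsilon> x = 0"
        "\<Delta> x = tens A A g x \<oplus>\<^bsub>tensor A A\<^esub> tens A A x h"
        "S g \<otimes> x \<oplus> S x \<otimes> h = \<zero>" "g \<otimes> S x \<oplus> x \<otimes> S h = \<zero>"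
      then show ?thesis using x by (simp add: LD RD L(2) R(2))
    qed
  next
    case (add x y)
    then have "x \<in> carrier A" "y \<in> carrier A" using G(2) by auto
    then show ?case using add.IH by (simp add: Delta_simps LD RD eps_simps sc_add)
  next
    case (mult x y)
    then have "x \<in> carrier A" "y \<in> carrier A" using G(2) by auto
    then show ?case using mult.IH by (simp add: Delta_simps L2 R2 eps_simps mult.commute)
  next
    case (smult x c)
    then have "x \<in> carrier A" using G(2) by auto
    then show ?case using smult.IH by (simp add: Delta_simps LD RD eps_simps)
  qed
qed

lemma hopf: "hopf_algebra A \<Delta> \<epsilon> S"
  using coassoc counits antipodes Delta eps alg_homD[OF S]
  by (intro hopf_algebra.intro hopf_algebra_axioms.intro k_algebra_axioms) (auto intro!: linear_mapsI)

end

section \<open>Iterated twisted commutators\<close>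

text \<open>The record version of \<^const>\<open>qad_free\<close>; using iterated commutators instead of the Serre sum avoids finite
  sums in algebras given by records.\<close>

primrec qad :: "('k::field, 'a) module \<Rightarrow> (nat \<Rightarrow> 'k) \<Rightarrow> 'a \<Rightarrow> 'a \<Rightarrow> nat \<Rightarrow> 'a" where
  "qad B t x y 0 = y"
| "qad B t x y (Suc r) = x \<otimes>\<^bsub>B\<^esub> qad B t x y r \<oplus>\<^bsub>B\<^esub> (- t r) \<odot>\<^bsub>B\<^esub> (qad B t x y r \<otimes>\<^bsub>B\<^esub> x)"

lemma ev_qad_free:
  assumes "k_algebra B" "\<And>x. g x \<in> carrier B"
  shows "ev B g (qad_free t p r m) = qad B t (ev B g p) (ev B g r) m"
  by (induction m) (simp_all add: ev_simps[OF assms] del: pm.scale_minus_left)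

context k_algebra
begin

lemma qad_closed [simp]: "x \<in> carrier A \<Longrightarrow> y \<in> carrier A \<Longrightarrow> qad A t x y r \<in> carrier A"
  by (induction r) auto

text \<open>Evaluation of the two factorizations of the Serre operator in the free algebra on two letters.\<close>

lemma qad_order:
  assumes "x \<in> carrier A" "y \<in> carrier A" "c \<noteq> 0"
  shows "qad A (\<lambda>r. c powi (int m - 1 - 2 * int r)) x y m = qad A (\<lambda>r. c powi (1 - int m + 2 * int r)) x y m"
proof -
  define g where "g b = (if b then x else y)" for b
  have g: "g b \<in> carrier A" for b using assms by (simp add: g_def)
  have "qad A t x y m = ev A g (qad_free t (letter True) (letter False) m)" for t
    using g by (simp add: ev_qad_free ev_simps k_algebra_axioms g_def)
  then show ?thesis
    using serre_qad_free[OF assms(3), of m "letter True" "letter False"] by metis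
qed

lemma qad_add:
  assumes "x \<in> carrier A" "y \<in> carrier A" "z \<in> carrier A"
  shows "qad A t x (y \<oplus> z) r = qad A t x y r \<oplus> qad A t x z r"
proof (induction r)
  case (Suc r)
  have *: "(p \<oplus> u) \<oplus> (v \<oplus> w) = (p \<oplus> v) \<oplus> (u \<oplus> w)"
    if "p \<in> carrier A" "u \<in> carrier A" "v \<in> carrier A" "w \<in> carrier A" for p u v w
    using that by (simp add: M.a_ac)
  show ?case unfolding qad.simps Suc
    using assms by (simp add: A.l_distr A.r_distr sc_distr *)
qed simp

text \<open>Moving \<open>b\<close> past the \<open>r\<close>-th iterated commutator of \<open>y\<close> with \<open>a\<close> costs one factor \<open>u\<close> for \<open>y\<close> and \<open>r\<close>
  factors \<open>p\<close> for the copies of \<open>a\<close>.  This is exactly the next twist, so the commutator with \<open>b\<close> vanishes.\<close>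

lemma qad_absorb:
  assumes c: "a \<in> carrier A" "b \<in> carrier A" "y \<in> carrier A"
    and ba: "b \<otimes> a = p \<odot> (a \<otimes> b)" and bY: "b \<otimes> y = u \<odot> (y \<otimes> b)"
    and t: "\<And>r. t r = u * p ^ r"
  shows "qad A t (a \<oplus> b) y r = qad A t a y r"
proof -
  have tS: "t (Suc r) = p * t r" for r by (simp add: t mult_ac)
  have comm: "b \<otimes> qad A t a y r = t r \<odot> (qad A t a y r \<otimes> b)" for r
  proof (induction r)
    case 0
    then show ?case using bY by (simp add: t)
  next
    case (Suc r)
    let ?y = "qad A t a y r"
    have y: "?y \<in> carrier A" using c by simp
    have "b \<otimes> (a \<otimes> ?y) = (b \<otimes> a) \<otimes> ?y" using c y by (simp add: A.m_assoc)
    also have "\<dots> = p \<odot> (a \<otimes> (b \<otimes> ?y))" using c y by (simp add: ba A.m_assoc)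
    also have "\<dots> = t (Suc r) \<odot> (a \<otimes> ?y \<otimes> b)" using c y by (simp add: Suc A.m_assoc tS mult_ac)
    finally have 1: "b \<otimes> (a \<otimes> ?y) = \<dots>" .
    have "b \<otimes> (?y \<otimes> a) = (b \<otimes> ?y) \<otimes> a" using c y by (simp add: A.m_assoc)
    also have "\<dots> = t r \<odot> (?y \<otimes> (b \<otimes> a))" using c y by (simp add: Suc A.m_assoc)
    also have "\<dots> = t (Suc r) \<odot> (?y \<otimes> a \<otimes> b)" using c y by (simp add: ba A.m_assoc tS mult_ac)
    finally have 2: "b \<otimes> (?y \<otimes> a) = \<dots>" .
    show ?case using c y by (simp add: A.r_distr A.l_distr sc_distr 1 2 mult_ac)
  qed
  show ?thesis
  proof (induction r)
    case (Suc r)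
    let ?y = "qad A t a y r"
    have y: "?y \<in> carrier A" using c by simp
    have "(a \<oplus> b) \<otimes> ?y \<oplus> (- t r) \<odot> (?y \<otimes> (a \<oplus> b))
      = (a \<otimes> ?y \<oplus> (- t r) \<odot> (?y \<otimes> a)) \<oplus> (t r \<odot> (?y \<otimes> b) \<oplus> (- t r) \<odot> (?y \<otimes> b))"
      using c y by (simp add: A.r_distr A.l_distr sc_distr comm M.a_ac)
    also have "t r \<odot> (?y \<otimes> b) \<oplus> (- t r) \<odot> (?y \<otimes> b) = \<zero>"
      using c y by (simp flip: sc_add)
    finally show ?case using c y by (simp add: Suc)
  qed simp
qed

text \<open>In the opposite algebra, \<open>y * x - t * x * y = - t * (x * y - inverse t * y * x)\<close>.\<close>

lemma qad_op:
  assumes c: "x \<in> carrier A" "y \<in> carrier A" and t: "\<And>r. t r \<noteq> 0"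
  shows "\<exists>s. qad (op_alg A) t x y r = s \<odot> qad A (\<lambda>r. inverse (t r)) x y r"
proof (induction r)
  case 0
  then show ?case using c by (intro exI[of _ 1]) simp
next
  case (Suc r)
  then obtain s where s: "qad (op_alg A) t x y r = s \<odot> qad A (\<lambda>r. inverse (t r)) x y r" by blast
  show ?case
    using c t[of r]
    by (intro exI[of _ "- t r * s"]) (simp add: s sc_distr M.a_comm mult_ac)
qed

text \<open>The iterated commutator of \<open>x * g\<close> and \<open>y * h\<close> is, up to a scalar, that of \<open>x\<close> and \<open>y\<close> times
  \<open>G = g ^ r * h\<close>.  The point is that moving \<open>g\<close> past the iterated commutator and moving \<open>G\<close> past \<open>x\<close> produce
  the same scalar \<open>l ^ r * m\<close>, so that both terms of the next commutator are rescaled alike.\<close>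

lemma qad_twist:
  assumes c: "x \<in> carrier A" "y \<in> carrier A" "g \<in> carrier A" "h \<in> carrier A"
    and gh: "g \<otimes> h = h \<otimes> g" and gx: "g \<otimes> x = l \<odot> (x \<otimes> g)"
    and gy: "g \<otimes> y = m \<odot> (y \<otimes> g)" and hx: "h \<otimes> x = m \<odot> (x \<otimes> h)"
  shows "\<exists>s G. G \<in> carrier A \<and> g \<otimes> G = G \<otimes> g \<and> G \<otimes> x = (l ^ r * m) \<odot> (x \<otimes> G) \<and>
    g \<otimes> qad A t x y r = (l ^ r * m) \<odot> (qad A t x y r \<otimes> g) \<and>
    qad A t (k \<odot> (x \<otimes> g)) (n \<odot> (y \<otimes> h)) r = s \<odot> (qad A t x y r \<otimes> G)"
proof (induction r)
  case 0
  then show ?case using c gh gy hx by (intro exI[of _ n] exI[of _ h]) simp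
next
  case (Suc r)
  then obtain s G where G: "G \<in> carrier A" and gG: "g \<otimes> G = G \<otimes> g"
    and Gx: "G \<otimes> x = (l ^ r * m) \<odot> (x \<otimes> G)"
    and gq: "g \<otimes> qad A t x y r = (l ^ r * m) \<odot> (qad A t x y r \<otimes> g)"
    and q: "qad A t (k \<odot> (x \<otimes> g)) (n \<odot> (y \<otimes> h)) r = s \<odot> (qad A t x y r \<otimes> G)" by blast
  let ?y = "qad A t x y r" and ?f = "l ^ r * m"
  have y: "?y \<in> carrier A" using c by simp
  have gxz: "g \<otimes> (x \<otimes> z) = l \<odot> (x \<otimes> (g \<otimes> z))" if "z \<in> carrier A" for z
    using c that by (simp add: gx flip: A.m_assoc)
  have gyz: "g \<otimes> (?y \<otimes> z) = ?f \<odot> (?y \<otimes> (g \<otimes> z))" if "z \<in> carrier A" for z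
    using c y that by (simp add: gq flip: A.m_assoc)
  have Gxz: "G \<otimes> (x \<otimes> z) = ?f \<odot> (x \<otimes> (G \<otimes> z))" if "z \<in> carrier A" for z
    using c G that by (simp add: Gx flip: A.m_assoc)
  have "g \<otimes> G \<otimes> x = (l ^ Suc r * m) \<odot> (x \<otimes> (g \<otimes> G))"
    using c G by (simp add: A.m_assoc Gx gxz mult_ac)
  moreover have "g \<otimes> qad A t x y (Suc r) = (l ^ Suc r * m) \<odot> (qad A t x y (Suc r) \<otimes> g)"
    using c y by (simp add: A.r_distr A.l_distr A.m_assoc sc_distr gxz gyz gq gx mult_ac)
  moreover have "qad A t (k \<odot> (x \<otimes> g)) (n \<odot> (y \<otimes> h)) (Suc r)
      = (k * s * ?f) \<odot> (qad A t x y (Suc r) \<otimes> (g \<otimes> G))"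
    unfolding qad.simps q
    using c y G by (simp add: A.l_distr A.m_assoc sc_distr gyz Gxz gG mult_ac)
  moreover have "g \<otimes> (g \<otimes> G) = g \<otimes> G \<otimes> g"
    using A.m_assoc[of g G g] c G by (simp only: gG)
  ultimately show ?case using c G by (intro exI[of _ "k * s * ?f"] exI[of _ "g \<otimes> G"]) simp
qed

end

lemma alg_hom_qad:
  assumes "k_algebra A" "h \<in> alg_hom A B" "x \<in> carrier A" "y \<in> carrier A"
  shows "h (qad A t x y r) = qad B t (h x) (h y) r"
proof -
  interpret k_algebra A by fact
  show ?thesis
    by (induction r) (simp_all add: assms alg_homD(2-4)[OF assms(2)])
qed

section \<open>Solutions of the defining relations of the quantum group\<close>

text \<open>What the computations in the algebras use of the root data and of the condition on \<open>q\<close>.\<close>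

locale q_datum =
  fixes \<alpha> :: "'i::finite \<Rightarrow> 'v::euclidean_space" and q :: "'k::field"
  assumes q0: "qpar \<alpha> q i \<noteq> 0"
    and qpar_sym: "qpar \<alpha> q i powi cartan \<alpha> i j = qpar \<alpha> q j powi cartan \<alpha> j i"
    and diag: "cartan \<alpha> i i = 2"
    and nonpos: "i \<noteq> j \<Longrightarrow> cartan \<alpha> i j \<le> 0"
begin

definition qc where "qc i j = qpar \<alpha> q i powi cartan \<alpha> i j"
definition lam where "lam i j = (if i = j then 1 / (qpar \<alpha> q i - inverse (qpar \<alpha> q i)) else 0)"
definition sdeg where "sdeg i j = nat (1 - cartan \<alpha> i j)"

text \<open>The twists \<open>q i ^ (a i j + 2 * r)\<close> of the Serre operator of degree \<open>m = 1 - a i j\<close>, in increasing order.\<close>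

definition tw where "tw i j r = qc i j * (qc i i) ^ r"

lemma qc_nz [simp]: "qc i j \<noteq> 0" by (simp add: qc_def q0)
lemma qc_sym: "qc i j = qc j i" unfolding qc_def by (rule qpar_sym)

lemma tw_powi:
  assumes "i \<noteq> j"
  shows "tw i j r = qpar \<alpha> q i powi (1 - int (sdeg i j) + 2 * int r)"
    "inverse (tw i j r) = qpar \<alpha> q i powi (int (sdeg i j) - 1 - 2 * int r)"
proof -
  have 1: "tw i j r = qpar \<alpha> q i powi (cartan \<alpha> i j + 2 * int r)"
    using q0 by (simp add: tw_def qc_def diag power_int_add power_int_mult)
  have 2: "int (sdeg i j) = 1 - cartan \<alpha> i j" using nonpos[OF assms] by (simp add: sdeg_def)
  show "tw i j r = qpar \<alpha> q i powi (1 - int (sdeg i j) + 2 * int r)" unfolding 1 2 by simp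
  show "inverse (tw i j r) = qpar \<alpha> q i powi (int (sdeg i j) - 1 - 2 * int r)"
    unfolding 1 2 by (simp add: power_int_minus[symmetric] algebra_simps)
qed

lemma qad_tw_inverse:
  assumes "k_algebra B" "i \<noteq> j" "x \<in> carrier B" "y \<in> carrier B"
  shows "qad B (\<lambda>r. inverse (tw i j r)) x y (sdeg i j) = qad B (tw i j) x y (sdeg i j)"
proof -
  have "tw i j = (\<lambda>r. qpar \<alpha> q i powi (1 - int (sdeg i j) + 2 * int r))"
    using tw_powi(1)[OF assms(2)] by blast
  then show ?thesis
    using k_algebra.qad_order[OF assms(1,3,4) q0[of i], of "sdeg i j"] tw_powi(2)[OF assms(2)] by simp
qed

lemma serre_qad:
  assumes "i \<noteq> j"
  shows "serre (qpar \<alpha> q i) (nat (1 - cartan \<alpha> i j)) x y = qad_free (tw i j) x y (sdeg i j)"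
proof -
  have "tw i j = (\<lambda>r. qpar \<alpha> q i powi (1 - int (sdeg i j) + 2 * int r))"
    using tw_powi(1)[OF assms] by blast
  then show ?thesis using serre_qad_free(2)[OF q0[of i], of "sdeg i j" x y] by (simp add: sdeg_def)
qed

end

text \<open>Negation appears as multiplication by \<open>- 1\<close> and the Serre relations appear as vanishing iterated
  commutators, so that the relations in an ideal component can be read off from the surrounding algebra.\<close>

locale uq_tuple = q_datum \<alpha> q + k_algebra B
  for \<alpha> :: "'i::finite \<Rightarrow> 'v::euclidean_space" and q :: "'k::field" and B :: "('k, 'b) module" (structure) +
  fixes E F K K' :: "'i \<Rightarrow> 'b"
  assumes closed [simp]: "E i \<in> carrier B" "F i \<in> carrier B" "K i \<in> carrier B" "K' i \<in> carrier B"
    and KK: "K i \<otimes> K j = K j \<otimes> K i"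
    and KK' [simp]: "K i \<otimes> K' i = \<one>" and K'K [simp]: "K' i \<otimes> K i = \<one>"
    and KEK': "K i \<otimes> E j \<otimes> K' i = qc i j \<odot> E j"
    and KFK': "K i \<otimes> F j \<otimes> K' i = inverse (qc i j) \<odot> F j"
    and EF: "E i \<otimes> F j = F j \<otimes> E i \<oplus> lam i j \<odot> (K i \<oplus> (- 1) \<odot> K' i)"
    and serreE: "i \<noteq> j \<Longrightarrow> qad B (tw i j) (E i) (E j) (sdeg i j) = \<zero>"
    and serreF: "i \<noteq> j \<Longrightarrow> qad B (tw i j) (F i) (F j) (sdeg i j) = \<zero>"
begin

lemma cancel [simp]:
  "x \<in> carrier B \<Longrightarrow> K i \<otimes> (K' i \<otimes> x) = x" "x \<in> carrier B \<Longrightarrow> K' i \<otimes> (K i \<otimes> x) = x"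
  by (simp_all flip: A.m_assoc)

lemma move:
  assumes "x \<in> carrier B" "K i \<otimes> x \<otimes> K' i = c \<odot> x" "c \<noteq> 0"
  shows "K i \<otimes> x = c \<odot> (x \<otimes> K i)" "K' i \<otimes> x = inverse c \<odot> (x \<otimes> K' i)"
proof -
  have "K i \<otimes> x \<otimes> K' i \<otimes> K i = c \<odot> (x \<otimes> K i)" using assms by simp
  then show 1: "K i \<otimes> x = c \<odot> (x \<otimes> K i)" using assms(1) by (simp add: A.m_assoc)
  have "K' i \<otimes> (K i \<otimes> x \<otimes> K' i) = x \<otimes> K' i" using assms(1) by (simp add: A.m_assoc)
  then have "c \<odot> (K' i \<otimes> x) = x \<otimes> K' i" using assms by simp
  then have "inverse c \<odot> (c \<odot> (K' i \<otimes> x)) = inverse c \<odot> (x \<otimes> K' i)" by simp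
  then show "K' i \<otimes> x = inverse c \<odot> (x \<otimes> K' i)" using assms(1,3) by simp
qed

lemmas KE = move[OF closed(1) KEK' qc_nz]
lemmas KF = move[OF closed(2) KFK' nonzero_imp_inverse_nonzero[OF qc_nz], simplified inverse_inverse_eq]

lemma KK'_comm: "K' i \<otimes> K j = K j \<otimes> K' i" "K' i \<otimes> K' j = K' j \<otimes> K' i"
proof -
  show *: "K' i \<otimes> K j = K j \<otimes> K' i" for i j
  proof -
    have "K i \<otimes> K j \<otimes> K' i = 1 \<odot> K j" by (subst KK) (simp add: A.m_assoc)
    then show ?thesis using move(2)[of "K j" i 1] by simp
  qed
  show "K' i \<otimes> K' j = K' j \<otimes> K' i"
  proof -
    have "K i \<otimes> K' j \<otimes> K' i = 1 \<odot> K' j" by (subst *[symmetric]) (simp add: A.m_assoc)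
    then show ?thesis using move(2)[of "K' j" i 1] by simp
  qed
qed

lemma universal:
  "\<exists>h\<in>alg_hom (Uq \<alpha> q) B.
    (\<forall>i. h (presented_gen (Uq_rels \<alpha> q) (Ue i)) = E i \<and> h (presented_gen (Uq_rels \<alpha> q) (Uf i)) = F i \<and>
      h (presented_gen (Uq_rels \<alpha> q) (Uk i)) = K i \<and> h (presented_gen (Uq_rels \<alpha> q) (Ukinv i)) = K' i)"
proof -
  define g where "g = case_ugen E F K K'"
  have g: "g x \<in> carrier B" for x by (cases x) (auto simp: g_def)
  have gs: "g (Ue i) = E i" "g (Uf i) = F i" "g (Uk i) = K i" "g (Ukinv i) = K' i" for i
    by (simp_all add: g_def)
  note ev = ev_simps[OF k_algebra_axioms g] and evq = ev_qad_free[OF k_algebra_axioms g]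
    and dz = ev_diff_zero_iff[OF k_algebra_axioms g]
  have rel: "ev B g p = \<zero>" if "p \<in> Uq_rels \<alpha> q" for p
    using that
  proof (cases rule: Uq_rels.cases)
    case (4 i j)
    then show ?thesis using KEK'[of i j] by (simp add: dz ev gs qc_def)
  next
    case (5 i j)
    then show ?thesis using KFK'[of i j] by (simp add: dz ev gs qc_def power_int_minus)
  next
    case (6 i j)
    have "ev B g (letter (Ue i) * letter (Uf j) - letter (Uf j) * letter (Ue i)) = lam i j \<odot> (K i \<oplus> (- 1) \<odot> K' i)"
      by (simp only: ev gs EF[of i j]) (simp add: add_sub_cancel)
    moreover have "ev B g (pm_scale (lam i j) (letter (Uk i) - letter (Ukinv i))) = lam i j \<odot> (K i \<oplus> (- 1) \<odot> K' i)"
      by (simp only: ev gs)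
    ultimately show ?thesis unfolding 6 lam_def[symmetric] by (simp only: dz)
  next
    case (7 i j)
    then show ?thesis using serreE[of i j] by (simp add: serre_qad evq ev gs)
  next
    case (8 i j)
    then show ?thesis using serreF[of i j] by (simp add: serre_qad evq ev gs)
  qed (use KK in \<open>simp_all add: dz ev gs\<close>)
  obtain h where h: "h \<in> alg_hom (Uq \<alpha> q) B" "\<And>x. h (presented_gen (Uq_rels \<alpha> q) x) = g x"
    using presented_universal[OF k_algebra_axioms g rel] by blast
  then show ?thesis by (intro bexI[of _ h]) (simp_all only: h gs simp_thms)
qed

end

lemma (in q_datum) uq_tuple_Uq:
  "uq_tuple \<alpha> q (Uq \<alpha> q) (\<lambda>i. presented_gen (Uq_rels \<alpha> q) (Ue i)) (\<lambda>i. presented_gen (Uq_rels \<alpha> q) (Uf i))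
     (\<lambda>i. presented_gen (Uq_rels \<alpha> q) (Uk i)) (\<lambda>i. presented_gen (Uq_rels \<alpha> q) (Ukinv i))"
proof -
  interpret U: k_algebra "Uq \<alpha> q" by (rule k_algebra_presented)
  let ?P = "Uq_rels \<alpha> q" and ?U = "Uq \<alpha> q"
  let ?g = "presented_gen ?P"
  note g = presented_gen_closed[of ?P]
  note ev = ev_simps[OF U.k_algebra_axioms g] and evq = ev_qad_free[OF U.k_algebra_axioms g]
    and dz = ev_diff_zero_iff[OF U.k_algebra_axioms g]
  have eq: "ev ?U ?g p = ev ?U ?g r" if "p - r \<in> ?P" for p r
    using presented_relation[OF that] unfolding dz .
  show ?thesis
  proof unfold_locales
    show "?g (Uk i) \<otimes>\<^bsub>?U\<^esub> ?g (Uk j) = ?g (Uk j) \<otimes>\<^bsub>?U\<^esub> ?g (Uk i)" for i j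
      using eq[OF Uq_rels.intros(1)[of i j]] by (simp add: ev)
    show "?g (Uk i) \<otimes>\<^bsub>?U\<^esub> ?g (Ukinv i) = \<one>\<^bsub>?U\<^esub>" for i
      using eq[OF Uq_rels.intros(2)[of i]] by (simp add: ev)
    show "?g (Ukinv i) \<otimes>\<^bsub>?U\<^esub> ?g (Uk i) = \<one>\<^bsub>?U\<^esub>" for i
      using eq[OF Uq_rels.intros(3)[of i]] by (simp add: ev)
    show "?g (Uk i) \<otimes>\<^bsub>?U\<^esub> ?g (Ue j) \<otimes>\<^bsub>?U\<^esub> ?g (Ukinv i) = qc i j \<odot>\<^bsub>?U\<^esub> ?g (Ue j)" for i j
      using eq[OF Uq_rels.intros(4)[of i j]] by (simp add: ev qc_def)
    show "?g (Uk i) \<otimes>\<^bsub>?U\<^esub> ?g (Uf j) \<otimes>\<^bsub>?U\<^esub> ?g (Ukinv i) = inverse (qc i j) \<odot>\<^bsub>?U\<^esub> ?g (Uf j)" for i j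
      using eq[OF Uq_rels.intros(5)[of i j]] by (simp add: ev qc_def power_int_minus)
    show "?g (Ue i) \<otimes>\<^bsub>?U\<^esub> ?g (Uf j) = ?g (Uf j) \<otimes>\<^bsub>?U\<^esub> ?g (Ue i) \<oplus>\<^bsub>?U\<^esub>
        lam i j \<odot>\<^bsub>?U\<^esub> (?g (Uk i) \<oplus>\<^bsub>?U\<^esub> (- 1) \<odot>\<^bsub>?U\<^esub> ?g (Ukinv i))" for i j
    proof -
      have "?g (Ue i) \<otimes>\<^bsub>?U\<^esub> ?g (Uf j) \<oplus>\<^bsub>?U\<^esub> (- 1) \<odot>\<^bsub>?U\<^esub> (?g (Uf j) \<otimes>\<^bsub>?U\<^esub> ?g (Ue i))
         = lam i j \<odot>\<^bsub>?U\<^esub> (?g (Uk i) \<oplus>\<^bsub>?U\<^esub> (- 1) \<odot>\<^bsub>?U\<^esub> ?g (Ukinv i))"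
        using eq[OF Uq_rels.intros(6)[of i j]] unfolding ev lam_def .
      then show ?thesis
        by (intro U.eq_add_of_sub U.A.m_closed g)
    qed
    show "qad ?U (tw i j) (?g (Ue i)) (?g (Ue j)) (sdeg i j) = \<zero>\<^bsub>?U\<^esub>" if "i \<noteq> j" for i j
      using presented_relation[OF Uq_rels.intros(7)[OF that, where \<alpha> = \<alpha> and q = q]]
      unfolding serre_qad[OF that] evq ev .
    show "qad ?U (tw i j) (?g (Uf i)) (?g (Uf j)) (sdeg i j) = \<zero>\<^bsub>?U\<^esub>" if "i \<noteq> j" for i j
      using presented_relation[OF Uq_rels.intros(8)[OF that, where \<alpha> = \<alpha> and q = q]]
      unfolding serre_qad[OF that] evq ev .
  qed (simp_all add: g)
qed

text \<open>The family that defines the counit.\<close>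

lemma (in q_datum) uq_tuple_scalars: "uq_tuple \<alpha> q scalars (\<lambda>_. 0) (\<lambda>_. 0) (\<lambda>_. 1) (\<lambda>_. 1)"
proof -
  interpret S: k_algebra "scalars :: ('k, 'k) module" by (rule k_algebra_scalars)
  have "qad scalars t 0 0 r = (0 :: 'k)" for t r by (induction r) simp_all
  then show ?thesis by unfold_locales simp_all
qed

context uq_tuple
begin

text \<open>The family that defines the antipode.  For the Serre relations, \<open>E i * K' i\<close> is a multiple of
  \<open>K' i * E i\<close>, that is, of the product of \<open>E i\<close> and \<open>K' i\<close> in the opposite algebra, to which \<open>qad_twist\<close> applies;
  \<open>K i * F i\<close> already is the product of \<open>F i\<close> and \<open>K i\<close> there.\<close>

lemma uq_tuple_op:
  "uq_tuple \<alpha> q (op_alg B) (\<lambda>i. (- 1) \<odot> (E i \<otimes> K' i)) (\<lambda>i. (- 1) \<odot> (K i \<otimes> F i)) K' K"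
proof -
  interpret O: k_algebra "op_alg B" by (rule k_algebra_op)
  have serre_op: "qad (op_alg B) (tw i j) (k \<odot>\<^bsub>op_alg B\<^esub> (x i \<otimes>\<^bsub>op_alg B\<^esub> g i)) (n \<odot>\<^bsub>op_alg B\<^esub> (x j \<otimes>\<^bsub>op_alg B\<^esub> g j)) (sdeg i j) = \<zero>"
    if "i \<noteq> j" and x: "\<And>i. x i \<in> carrier B" and g: "\<And>i. g i \<in> carrier B" and gg: "\<And>i j. g i \<otimes> g j = g j \<otimes> g i"
      and xg: "\<And>i j. x j \<otimes> g i = qc i j \<odot> (g i \<otimes> x j)"
      and ser: "qad B (tw i j) (x i) (x j) (sdeg i j) = \<zero>"
    for x g :: "'i \<Rightarrow> 'b" and i j k n
  proof -
    have nz: "tw i j r \<noteq> 0" for r by (simp add: tw_def)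
    obtain s where "qad (op_alg B) (tw i j) (x i) (x j) (sdeg i j)
        = s \<odot> qad B (\<lambda>r. inverse (tw i j r)) (x i) (x j) (sdeg i j)"
      using qad_op[OF x x, of "tw i j"] nz by blast
    also have "\<dots> = \<zero>"
      unfolding qad_tw_inverse[OF k_algebra_axioms that(1) x x] ser by simp
    finally have z: "qad (op_alg B) (tw i j) (x i) (x j) (sdeg i j) = \<zero>" .
    show ?thesis
      using O.qad_twist[of "x i" "x j" "g i" "g j" "qc i i" "qc i j" "sdeg i j" "tw i j" k n] x g xg gg z qc_sym[of j i]
      by auto
  qed
  show ?thesis
  proof unfold_locales
    fix i j
    show "K' i \<otimes>\<^bsub>op_alg B\<^esub> ((- 1) \<odot> (E j \<otimes> K' j)) \<otimes>\<^bsub>op_alg B\<^esub> K i = qc i j \<odot>\<^bsub>op_alg B\<^esub> ((- 1) \<odot> (E j \<otimes> K' j))"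
    proof -
      have "K i \<otimes> (E j \<otimes> K' j \<otimes> K' i) = (K i \<otimes> E j \<otimes> K' i) \<otimes> K' j"
        by (simp add: A.m_assoc KK'_comm(2)[of i j])
      then show ?thesis by (simp add: KEK')
    qed
    show "K' i \<otimes>\<^bsub>op_alg B\<^esub> ((- 1) \<odot> (K j \<otimes> F j)) \<otimes>\<^bsub>op_alg B\<^esub> K i = inverse (qc i j) \<odot>\<^bsub>op_alg B\<^esub> ((- 1) \<odot> (K j \<otimes> F j))"
    proof -
      have "K i \<otimes> (K j \<otimes> F j \<otimes> K' i) = K j \<otimes> (K i \<otimes> F j \<otimes> K' i)"
        using KK[of i j] by (simp flip: A.m_assoc)
      then show ?thesis by (simp add: KFK')
    qed
    show "((- 1) \<odot> (E i \<otimes> K' i)) \<otimes>\<^bsub>op_alg B\<^esub> ((- 1) \<odot> (K j \<otimes> F j)) =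
      ((- 1) \<odot> (K j \<otimes> F j)) \<otimes>\<^bsub>op_alg B\<^esub> ((- 1) \<odot> (E i \<otimes> K' i)) \<oplus>\<^bsub>op_alg B\<^esub>
      lam i j \<odot>\<^bsub>op_alg B\<^esub> (K' i \<oplus>\<^bsub>op_alg B\<^esub> (- 1) \<odot>\<^bsub>op_alg B\<^esub> K i)"
    proof -
      let ?D = "lam i j \<odot> (K i \<oplus> (- 1) \<odot> K' i)"
      have "E i \<otimes> (K' i \<otimes> (K j \<otimes> F j)) = K j \<otimes> (E i \<otimes> F j) \<otimes> K' i"
      proof -
        have "K j \<otimes> (E i \<otimes> F j) \<otimes> K' i = (K j \<otimes> E i) \<otimes> (F j \<otimes> K' i)" by (simp add: A.m_assoc)
        also have "K j \<otimes> E i = qc i j \<odot> (E i \<otimes> K j)" using KE(1) qc_sym by metis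
        also have "F j \<otimes> K' i = inverse (qc i j) \<odot> (K' i \<otimes> F j)" using KF(2)[of i j] by simp
        finally show ?thesis by (simp add: A.m_assoc)  (simp add: KK'_comm flip: A.m_assoc)
      qed
      also have "\<dots> = K j \<otimes> (F j \<otimes> E i) \<otimes> K' i \<oplus> K j \<otimes> ?D \<otimes> K' i"
        by (simp add: EF A.l_distr A.r_distr)
      also have "K j \<otimes> ?D \<otimes> K' i = lam i j \<odot> (K i \<oplus> (- 1) \<odot> K' i)"
        by (cases "i = j") (simp_all add: lam_def A.l_distr A.r_distr sc_distr A.m_assoc)
      finally have "K j \<otimes> (F j \<otimes> E i) \<otimes> K' i \<oplus> ?D = E i \<otimes> (K' i \<otimes> (K j \<otimes> F j))" by simp
      then have "K j \<otimes> (F j \<otimes> (E i \<otimes> K' i)) = E i \<otimes> (K' i \<otimes> (K j \<otimes> F j)) \<oplus> (- 1) \<odot> ?D"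
        using sub_of_add_eq[of "K j \<otimes> (F j \<otimes> E i) \<otimes> K' i" ?D] by (simp only: A.m_assoc A.m_closed closed sc_closed M.a_closed)
      then show ?thesis by (simp add: A.m_assoc sc_distr M.a_comm)
    qed
    assume ij: "i \<noteq> j"
    have E: "(- 1) \<odot> (E i \<otimes> K' i) = (- qc i i) \<odot> (K' i \<otimes> E i)" for i
      using KE(2)[of i i] by simp
    show "qad (op_alg B) (tw i j) ((- 1) \<odot> (E i \<otimes> K' i)) ((- 1) \<odot> (E j \<otimes> K' j)) (sdeg i j) = \<zero>\<^bsub>op_alg B\<^esub>"
      using serre_op[of i j E K' "- qc i i" "- qc j j"] ij serreE KK'_comm(2) KE(2) unfolding E by simp
    show "qad (op_alg B) (tw i j) ((- 1) \<odot> (K i \<otimes> F i)) ((- 1) \<odot> (K j \<otimes> F j)) (sdeg i j) = \<zero>\<^bsub>op_alg B\<^esub>"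
      using serre_op[of i j F K "- 1" "- 1"] ij serreF KK KF(1) by simp
  qed (simp_all add: KK'_comm)
qed

end

section \<open>The Hopf algebra structure\<close>

context two_algebras
begin

text \<open>As \<open>g\<close> and \<open>h\<close> commute, the second tensor factors multiply to \<open>G = h * g ^ r\<close> in every term.\<close>

lemma qad_tens:
  assumes "x \<in> carrier A" "y \<in> carrier A" "g \<in> carrier B" "h \<in> carrier B" "g \<otimes>\<^bsub>B\<^esub> h = h \<otimes>\<^bsub>B\<^esub> g"
  shows "\<exists>G\<in>carrier B. g \<otimes>\<^bsub>B\<^esub> G = G \<otimes>\<^bsub>B\<^esub> g \<and>
    qad (tensor A B) t (tens A B x g) (tens A B y h) r = tens A B (qad A t x y r) G"
proof (induction r)
  case 0
  then show ?case using assms by auto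
next
  case (Suc r)
  then obtain G where G: "G \<in> carrier B" "g \<otimes>\<^bsub>B\<^esub> G = G \<otimes>\<^bsub>B\<^esub> g"
    "qad (tensor A B) t (tens A B x g) (tens A B y h) r = tens A B (qad A t x y r) G" by blast
  have "g \<otimes>\<^bsub>B\<^esub> (G \<otimes>\<^bsub>B\<^esub> g) = (G \<otimes>\<^bsub>B\<^esub> g) \<otimes>\<^bsub>B\<^esub> g"
    using assms(3) G(1) G(2)[symmetric] by (simp add: B.A.m_assoc)
  then show ?case using assms G
    by (intro bexI[of _ "G \<otimes>\<^bsub>B\<^esub> g"]) (simp_all add: tens_add_left)
qed

lemma qad_tens':
  assumes "x \<in> carrier B" "y \<in> carrier B" "g \<in> carrier A" "h \<in> carrier A" "g \<otimes>\<^bsub>A\<^esub> h = h \<otimes>\<^bsub>A\<^esub> g"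
  shows "\<exists>G\<in>carrier A. g \<otimes>\<^bsub>A\<^esub> G = G \<otimes>\<^bsub>A\<^esub> g \<and>
    qad (tensor A B) t (tens A B g x) (tens A B h y) r = tens A B G (qad B t x y r)"
proof (induction r)
  case 0
  then show ?case using assms by auto
next
  case (Suc r)
  then obtain G where G: "G \<in> carrier A" "g \<otimes>\<^bsub>A\<^esub> G = G \<otimes>\<^bsub>A\<^esub> g"
    "qad (tensor A B) t (tens A B g x) (tens A B h y) r = tens A B G (qad B t x y r)" by blast
  have "g \<otimes>\<^bsub>A\<^esub> (G \<otimes>\<^bsub>A\<^esub> g) = (G \<otimes>\<^bsub>A\<^esub> g) \<otimes>\<^bsub>A\<^esub> g"
    using assms(3) G(1) G(2)[symmetric] by (simp add: A.A.m_assoc)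
  then show ?case using assms G
    by (intro bexI[of _ "G \<otimes>\<^bsub>A\<^esub> g"]) (simp_all add: tens_add_right)
qed

end

text \<open>The Serre relation for a sum: the two orderings of the factors dispose of \<open>b\<close> against \<open>y\<close> and
  of \<open>a\<close> against \<open>z\<close>, respectively.\<close>

lemma (in q_datum) qad_sum_zero:
  assumes T: "k_algebra T" and "i \<noteq> j"
    and c: "a \<in> carrier T" "b \<in> carrier T" "y \<in> carrier T" "z \<in> carrier T"
    and ba: "b \<otimes>\<^bsub>T\<^esub> a = qc i i \<odot>\<^bsub>T\<^esub> (a \<otimes>\<^bsub>T\<^esub> b)" and bY: "b \<otimes>\<^bsub>T\<^esub> y = qc i j \<odot>\<^bsub>T\<^esub> (y \<otimes>\<^bsub>T\<^esub> b)"
    and za: "z \<otimes>\<^bsub>T\<^esub> a = qc i j \<odot>\<^bsub>T\<^esub> (a \<otimes>\<^bsub>T\<^esub> z)"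
    and ay: "qad T (tw i j) a y (sdeg i j) = \<zero>\<^bsub>T\<^esub>" and bz: "qad T (tw i j) b z (sdeg i j) = \<zero>\<^bsub>T\<^esub>"
  shows "qad T (tw i j) (a \<oplus>\<^bsub>T\<^esub> b) (y \<oplus>\<^bsub>T\<^esub> z) (sdeg i j) = \<zero>\<^bsub>T\<^esub>"
proof -
  interpret T: k_algebra T by fact
  let ?m = "sdeg i j" and ?c = "a \<oplus>\<^bsub>T\<^esub> b"
  have "qad T (tw i j) ?c y ?m = \<zero>\<^bsub>T\<^esub>"
    using T.qad_absorb[OF c(1-3) ba bY, of "tw i j"] ay by (simp add: tw_def)
  moreover have "qad T (tw i j) ?c z ?m = \<zero>\<^bsub>T\<^esub>"
  proof -
    have ab: "a \<otimes>\<^bsub>T\<^esub> b = inverse (qc i i) \<odot>\<^bsub>T\<^esub> (b \<otimes>\<^bsub>T\<^esub> a)" using c by (simp add: ba)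
    have az: "a \<otimes>\<^bsub>T\<^esub> z = inverse (qc i j) \<odot>\<^bsub>T\<^esub> (z \<otimes>\<^bsub>T\<^esub> a)" using c by (simp add: za)
    note inv = qad_tw_inverse[OF T \<open>i \<noteq> j\<close>]
    have "qad T (tw i j) ?c z ?m = qad T (\<lambda>r. inverse (tw i j r)) (b \<oplus>\<^bsub>T\<^esub> a) z ?m"
      using c by (simp add: inv T.M.a_comm)
    also have "\<dots> = qad T (\<lambda>r. inverse (tw i j r)) b z ?m"
      by (rule T.qad_absorb[OF c(2,1,4) ab az]) (simp add: tw_def power_inverse)
    also have "\<dots> = \<zero>\<^bsub>T\<^esub>" using c bz by (simp add: inv)
    finally show ?thesis .
  qed
  ultimately show ?thesis using c by (simp add: T.qad_add)
qed

context uq_tuple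
begin

sublocale BB: two_algebras B B by (intro two_algebras.intro k_algebra_axioms)

abbreviation t where "t \<equiv> tens B B"
abbreviation T where "T \<equiv> tensor B B"

lemma KKK': "K i \<otimes> (K j \<otimes> K' i) = K j" "K i \<otimes> (K' j \<otimes> K' i) = K' j"
proof -
  have "K j \<otimes> K' i = K' i \<otimes> K j" "K' j \<otimes> K' i = K' i \<otimes> K' j" using KK'_comm by metis+
  then show "K i \<otimes> (K j \<otimes> K' i) = K j" "K i \<otimes> (K' j \<otimes> K' i) = K' j" by simp_all
qed

text \<open>The family that defines the comultiplication.  In \<open>[\<Delta>(E i), \<Delta>(F j)]\<close> the mixed terms cancel, since moving
  \<open>K' j\<close> past \<open>E i\<close> and \<open>K i\<close> past \<open>F j\<close> gives inverse factors.\<close>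

lemma uq_tuple_tensor:
  "uq_tuple \<alpha> q T (\<lambda>i. t \<one> (E i) \<oplus>\<^bsub>T\<^esub> t (E i) (K i)) (\<lambda>i. t (F i) \<one> \<oplus>\<^bsub>T\<^esub> t (K' i) (F i))
     (\<lambda>i. t (K i) (K i)) (\<lambda>i. t (K' i) (K' i))"
proof -
  note dist = BB.T.A.l_distr BB.T.A.r_distr BB.T.sc_distr
  show ?thesis
  proof unfold_locales
    fix i j
    have KEK: "K i \<otimes> (E j \<otimes> K' i) = qc i j \<odot> E j" using KEK' by (simp add: A.m_assoc)
    show "t (K i) (K i) \<otimes>\<^bsub>T\<^esub> (t \<one> (E j) \<oplus>\<^bsub>T\<^esub> t (E j) (K j)) \<otimes>\<^bsub>T\<^esub> t (K' i) (K' i)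
      = qc i j \<odot>\<^bsub>T\<^esub> (t \<one> (E j) \<oplus>\<^bsub>T\<^esub> t (E j) (K j))"
      by (simp add: dist A.m_assoc KEK KKK')
    have KFK: "K i \<otimes> (F j \<otimes> K' i) = inverse (qc i j) \<odot> F j" using KFK' by (simp add: A.m_assoc)
    show "t (K i) (K i) \<otimes>\<^bsub>T\<^esub> (t (F j) \<one> \<oplus>\<^bsub>T\<^esub> t (K' j) (F j)) \<otimes>\<^bsub>T\<^esub> t (K' i) (K' i)
      = inverse (qc i j) \<odot>\<^bsub>T\<^esub> (t (F j) \<one> \<oplus>\<^bsub>T\<^esub> t (K' j) (F j))"
      by (simp add: dist A.m_assoc KFK KKK')
    let ?D = "K i \<oplus> (- 1) \<odot> K' i"
    have cross: "t (K' j \<otimes> E i) (F j \<otimes> K i) = t (E i \<otimes> K' j) (K i \<otimes> F j)"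
      by (simp add: KE KF qc_sym[of j i])
    have D: "lam i j \<odot>\<^bsub>T\<^esub> (t (K' j) ?D \<oplus>\<^bsub>T\<^esub> t ?D (K i))
        = lam i j \<odot>\<^bsub>T\<^esub> (t (K i) (K i) \<oplus>\<^bsub>T\<^esub> (- 1) \<odot>\<^bsub>T\<^esub> t (K' i) (K' i))"
    proof (cases "i = j")
      case True
      have *: "(p \<oplus>\<^bsub>T\<^esub> u) \<oplus>\<^bsub>T\<^esub> (v \<oplus>\<^bsub>T\<^esub> (- 1) \<odot>\<^bsub>T\<^esub> p) = v \<oplus>\<^bsub>T\<^esub> u"
        if "p \<in> carrier T" "u \<in> carrier T" "v \<in> carrier T" for p u v
      proof -
        have "(p \<oplus>\<^bsub>T\<^esub> u) \<oplus>\<^bsub>T\<^esub> (v \<oplus>\<^bsub>T\<^esub> (- 1) \<odot>\<^bsub>T\<^esub> p) = (p \<oplus>\<^bsub>T\<^esub> (v \<oplus>\<^bsub>T\<^esub> u)) \<oplus>\<^bsub>T\<^esub> (- 1) \<odot>\<^bsub>T\<^esub> p"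
          using that by (simp add: BB.T.M.a_ac)
        then show ?thesis using that by (simp add: BB.T.add_sub_cancel)
      qed
      show ?thesis using True by (simp add: BB.tens_add_left BB.tens_add_right *)
    qed (simp add: lam_def)
    show "(t \<one> (E i) \<oplus>\<^bsub>T\<^esub> t (E i) (K i)) \<otimes>\<^bsub>T\<^esub> (t (F j) \<one> \<oplus>\<^bsub>T\<^esub> t (K' j) (F j)) =
      (t (F j) \<one> \<oplus>\<^bsub>T\<^esub> t (K' j) (F j)) \<otimes>\<^bsub>T\<^esub> (t \<one> (E i) \<oplus>\<^bsub>T\<^esub> t (E i) (K i)) \<oplus>\<^bsub>T\<^esub>
      lam i j \<odot>\<^bsub>T\<^esub> (t (K i) (K i) \<oplus>\<^bsub>T\<^esub> (- 1) \<odot>\<^bsub>T\<^esub> t (K' i) (K' i))"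
      unfolding D[symmetric]
      by (simp add: dist cross EF BB.tens_add_left[of _ "lam i j \<odot> ?D"] BB.tens_add_right[of _ _ "lam i j \<odot> ?D"]
          BB.T.M.a_ac)
    assume ij: "i \<noteq> j"
    show "qad T (tw i j) (t \<one> (E i) \<oplus>\<^bsub>T\<^esub> t (E i) (K i)) (t \<one> (E j) \<oplus>\<^bsub>T\<^esub> t (E j) (K j)) (sdeg i j) = \<zero>\<^bsub>T\<^esub>"
      by (rule qad_sum_zero[OF BB.k_algebra_tensor ij])
        (use BB.qad_tens'[of "E i" "E j" \<one> \<one> "tw i j" "sdeg i j"] BB.qad_tens[of "E i" "E j" "K i" "K j" "tw i j" "sdeg i j"]
          KK[of i j] in \<open>auto simp: KE serreE[OF ij] qc_sym[of j i]\<close>)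
    show "qad T (tw i j) (t (F i) \<one> \<oplus>\<^bsub>T\<^esub> t (K' i) (F i)) (t (F j) \<one> \<oplus>\<^bsub>T\<^esub> t (K' j) (F j)) (sdeg i j) = \<zero>\<^bsub>T\<^esub>"
      by (rule qad_sum_zero[OF BB.k_algebra_tensor ij])
        (use BB.qad_tens[of "F i" "F j" \<one> \<one> "tw i j" "sdeg i j"] BB.qad_tens'[of "F i" "F j" "K' i" "K' j" "tw i j" "sdeg i j"]
          KK'_comm(2)[of i j] in \<open>auto simp: KF serreF[OF ij] qc_sym[of j i]\<close>)
  qed (simp_all add: KK BB.tens_one)
qed

text \<open>The common form of the two structures of the statement, supplemented by the fact that the antipode
  reverses products, from which the comparison of antipodes is derived.\<close>

definition hopf_on :: "('b \<Rightarrow> ('b \<times> 'b \<Rightarrow>\<^sub>0 'k) set) \<Rightarrow> ('b \<Rightarrow> 'k) \<Rightarrow> ('b \<Rightarrow> 'b) \<Rightarrow> bool" where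
  "hopf_on \<Delta> \<epsilon> S \<longleftrightarrow> hopf_algebra B \<Delta> \<epsilon> S \<and> S \<in> alg_hom B (op_alg B) \<and>
    (\<forall>i. \<Delta> (E i) = t \<one> (E i) \<oplus>\<^bsub>T\<^esub> t (E i) (K i) \<and> \<Delta> (F i) = t (F i) \<one> \<oplus>\<^bsub>T\<^esub> t (K' i) (F i) \<and>
      \<Delta> (K i) = t (K i) (K i) \<and> \<Delta> (K' i) = t (K' i) (K' i) \<and>
      \<epsilon> (E i) = 0 \<and> \<epsilon> (F i) = 0 \<and> \<epsilon> (K i) = 1 \<and> \<epsilon> (K' i) = 1 \<and>
      S (E i) = (- 1) \<odot> (E i \<otimes> K' i) \<and> S (F i) = (- 1) \<odot> (K i \<otimes> F i) \<and> S (K i) = K' i \<and> S (K' i) = K i)"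

definition gens :: "'b set" where
  "gens = range E \<union> range F \<union> range K \<union> range K'"

lemma gens_carrier: "gens \<subseteq> carrier B"
  by (auto simp: gens_def)

text \<open>The structure maps are homomorphisms out of \<open>U\<close>; they are carried over to \<open>B\<close> by \<open>\<phi>\<close>.\<close>

lemma hopf_exists:
  assumes \<phi>: "\<phi> \<in> alg_hom B (Uq \<alpha> q)"
    and \<phi>_gen: "\<And>i. \<phi> (E i) = presented_gen (Uq_rels \<alpha> q) (Ue i)" "\<And>i. \<phi> (F i) = presented_gen (Uq_rels \<alpha> q) (Uf i)"
      "\<And>i. \<phi> (K i) = presented_gen (Uq_rels \<alpha> q) (Uk i)" "\<And>i. \<phi> (K' i) = presented_gen (Uq_rels \<alpha> q) (Ukinv i)"
    and gen: "carrier B = alg_gen B gens"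
  shows "\<exists>\<Delta> \<epsilon> S. hopf_on \<Delta> \<epsilon> S"
proof -
  obtain D where D: "D \<in> alg_hom (Uq \<alpha> q) T"
    "\<And>i. D (\<phi> (E i)) = t \<one> (E i) \<oplus>\<^bsub>T\<^esub> t (E i) (K i)" "\<And>i. D (\<phi> (F i)) = t (F i) \<one> \<oplus>\<^bsub>T\<^esub> t (K' i) (F i)"
    "\<And>i. D (\<phi> (K i)) = t (K i) (K i)" "\<And>i. D (\<phi> (K' i)) = t (K' i) (K' i)"
    using uq_tuple.universal[OF uq_tuple_tensor] unfolding \<phi>_gen by blast
  obtain e where e: "e \<in> alg_hom (Uq \<alpha> q) scalars"
    "\<And>i. e (\<phi> (E i)) = 0" "\<And>i. e (\<phi> (F i)) = 0" "\<And>i. e (\<phi> (K i)) = 1" "\<And>i. e (\<phi> (K' i)) = 1"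
    using uq_tuple.universal[OF uq_tuple_scalars] unfolding \<phi>_gen by blast
  obtain s where s: "s \<in> alg_hom (Uq \<alpha> q) (op_alg B)"
    "\<And>i. s (\<phi> (E i)) = (- 1) \<odot> (E i \<otimes> K' i)" "\<And>i. s (\<phi> (F i)) = (- 1) \<odot> (K i \<otimes> F i)"
    "\<And>i. s (\<phi> (K i)) = K' i" "\<And>i. s (\<phi> (K' i)) = K i"
    using uq_tuple.universal[OF uq_tuple_op] unfolding \<phi>_gen by blast
  note homs = alg_hom_comp[OF \<phi> D(1)] alg_hom_comp[OF \<phi> e(1)] alg_hom_comp[OF \<phi> s(1)]
  have one: "D (\<phi> \<one>) = t \<one> \<one>" "e (\<phi> \<one>) = 1" "s (\<phi> \<one>) = \<one>"
    using homs[THEN alg_homD(5)] by (simp_all add: BB.tens_one)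
  interpret hopf_on_generators B gens "D \<circ> \<phi>" "e \<circ> \<phi>" "s \<circ> \<phi>"
  proof (intro hopf_on_generators.intro hopf_on_generators_axioms.intro k_algebra_axioms gens_carrier gen homs)
    fix x assume "x \<in> gens"
    then consider i where "x = E i" | i where "x = F i" | i where "x = K i" | i where "x = K' i"
      by (auto simp: gens_def)
    then show "((D \<circ> \<phi>) x = t x x \<and> (e \<circ> \<phi>) x = 1 \<and> (s \<circ> \<phi>) x \<otimes> x = \<one> \<and> x \<otimes> (s \<circ> \<phi>) x = \<one>) \<or>
      (\<exists>g\<in>carrier B. \<exists>h\<in>carrier B. (D \<circ> \<phi>) g = t g g \<and> (D \<circ> \<phi>) h = t h h \<and> (e \<circ> \<phi>) g = 1 \<and> (e \<circ> \<phi>) h = 1 \<and>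
        (D \<circ> \<phi>) x = t g x \<oplus>\<^bsub>T\<^esub> t x h \<and> (e \<circ> \<phi>) x = 0 \<and>
        (s \<circ> \<phi>) g \<otimes> x \<oplus> (s \<circ> \<phi>) x \<otimes> h = \<zero> \<and> g \<otimes> (s \<circ> \<phi>) x \<oplus> x \<otimes> (s \<circ> \<phi>) h = \<zero>)"
    proof cases
      case (1 i)
      \<comment> \<open>\<open>E i\<close> is skew primitive with respect to \<open>1\<close> and \<open>K i\<close>.\<close>
      show ?thesis unfolding 1
        by (intro disjI2, rule bexI[of _ \<one>], rule bexI[of _ "K i"])
          (simp_all add: D(2-5) e(2-5) s(2-5) one A.m_assoc)
    next
      case (2 i)
      \<comment> \<open>\<open>F i\<close> is skew primitive with respect to \<open>K' i\<close> and \<open>1\<close>.\<close>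
      show ?thesis unfolding 2
        by (intro disjI2, rule bexI[of _ "K' i"], rule bexI[of _ \<one>])
          (simp_all add: D(2-5) e(2-5) s(2-5) one BB.T.M.a_comm)
    qed (simp_all add: D e s)
  qed
  show ?thesis
    using hopf homs D e s unfolding hopf_on_def
    by (intro exI[of _ "D \<circ> \<phi>"] exI[of _ "e \<circ> \<phi>"] exI[of _ "s \<circ> \<phi>"]) simp
qed

text \<open>Both sides of each compatibility condition are homomorphisms that agree on generators.\<close>

lemma hopf_iso_of_alg_iso:
  assumes C: "uq_tuple \<alpha> q C E2 F2 K2 K2'"
    and h: "hopf_on \<Delta> \<epsilon> S" and h2: "uq_tuple.hopf_on C E2 F2 K2 K2' \<Delta>' \<epsilon>' S'"
    and \<phi>: "\<phi> \<in> alg_iso B C"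
    and \<phi>_gen: "\<And>i. \<phi> (E i) = E2 i" "\<And>i. \<phi> (F i) = F2 i" "\<And>i. \<phi> (K i) = K2 i" "\<And>i. \<phi> (K' i) = K2' i"
    and gen: "carrier B = alg_gen B gens"
  shows "\<phi> \<in> hopf_iso B \<Delta> \<epsilon> S C \<Delta>' \<epsilon>' S'"
proof -
  interpret C: uq_tuple \<alpha> q C E2 F2 K2 K2' by fact
  interpret H: hopf_algebra B \<Delta> \<epsilon> S using h by (simp add: hopf_on_def)
  interpret H2: hopf_algebra C \<Delta>' \<epsilon>' S' using h2 by (simp add: C.hopf_on_def)
  have ph: "\<phi> \<in> alg_hom B C" using \<phi> by (simp add: alg_iso_def)
  note v = h[unfolded hopf_on_def, THEN conjunct2, THEN conjunct2, rule_format]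
    and v2 = h2[unfolded C.hopf_on_def, THEN conjunct2, THEN conjunct2, rule_format]
  note S_op = h[unfolded hopf_on_def, THEN conjunct2, THEN conjunct1]
    and S2_op = h2[unfolded C.hopf_on_def, THEN conjunct2, THEN conjunct1]
  note tm = tensor_map_hom[OF k_algebra_axioms k_algebra_axioms C.k_algebra_axioms C.k_algebra_axioms ph ph]
    and tmv = tensor_map(2)[OF k_algebra_axioms k_algebra_axioms C.k_algebra_axioms C.k_algebra_axioms
        alg_homD(6)[OF ph] alg_homD(6)[OF ph]]
  have op: "\<phi> \<in> alg_hom (op_alg B) (op_alg C)"
    using alg_homD[OF ph] by (intro alg_homI linear_mapsI) simp_all
  have eq: "f x = g x"
    if "f \<in> alg_hom B X" "g \<in> alg_hom B X" "\<And>i. f (E i) = g (E i)" "\<And>i. f (F i) = g (F i)"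
      "\<And>i. f (K i) = g (K i)" "\<And>i. f (K' i) = g (K' i)" "x \<in> carrier B"
    for f g x and X :: "('k, 'd) module"
    by (rule alg_hom_eqI[OF k_algebra_axioms that(1,2) gens_carrier]) (use that gen in \<open>auto simp: gens_def\<close>)
  have 1: "(\<Delta>' \<circ> \<phi>) x = (tensor_map C C \<phi> \<phi> \<circ> \<Delta>) x" if "x \<in> carrier B" for x
    by (rule eq[OF alg_hom_comp[OF ph H2.comult_hom] alg_hom_comp[OF H.comult_hom tm] _ _ _ _ that])
      (simp_all add: v v2 \<phi>_gen alg_homD(2)[OF tm] tmv alg_homD(5)[OF ph])
  have 3: "(S' \<circ> \<phi>) x = (\<phi> \<circ> S) x" if "x \<in> carrier B" for x
    by (rule eq[OF alg_hom_comp[OF ph S2_op] alg_hom_comp[OF S_op op] _ _ _ _ that])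
      (simp_all add: v v2 \<phi>_gen alg_homD(3,4)[OF ph])
  have 2: "(\<epsilon>' \<circ> \<phi>) x = \<epsilon> x" if "x \<in> carrier B" for x
    by (rule alg_hom_eqI[OF k_algebra_axioms alg_hom_comp[OF ph H2.counit_hom] H.counit_hom gens_carrier])
      (use that gen in \<open>auto simp: gens_def v v2 \<phi>_gen\<close>)
  show ?thesis
    using \<phi> 1 2 3 by (simp add: hopf_iso_def)
qed

end

section \<open>Central idempotents\<close>

lemma idem_component_simps [simp]:
  "x \<otimes>\<^bsub>idem_component A e\<^esub> y = x \<otimes>\<^bsub>A\<^esub> y" "\<one>\<^bsub>idem_component A e\<^esub> = e" "\<zero>\<^bsub>idem_component A e\<^esub> = \<zero>\<^bsub>A\<^esub>"
  "x \<oplus>\<^bsub>idem_component A e\<^esub> y = x \<oplus>\<^bsub>A\<^esub> y" "c \<odot>\<^bsub>idem_component A e\<^esub> x = c \<odot>\<^bsub>A\<^esub> x"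
  by (simp_all add: idem_component_def)

lemma alg_prod_simps [simp]:
  "carrier (alg_prod A B) = carrier A \<times> carrier B"
  "p \<otimes>\<^bsub>alg_prod A B\<^esub> r = (fst p \<otimes>\<^bsub>A\<^esub> fst r, snd p \<otimes>\<^bsub>B\<^esub> snd r)"
  "\<one>\<^bsub>alg_prod A B\<^esub> = (\<one>\<^bsub>A\<^esub>, \<one>\<^bsub>B\<^esub>)"
  "p \<oplus>\<^bsub>alg_prod A B\<^esub> r = (fst p \<oplus>\<^bsub>A\<^esub> fst r, snd p \<oplus>\<^bsub>B\<^esub> snd r)"
  "c \<odot>\<^bsub>alg_prod A B\<^esub> p = (c \<odot>\<^bsub>A\<^esub> fst p, c \<odot>\<^bsub>B\<^esub> snd p)"
  by (simp_all add: alg_prod_def RDirProd_def DirProd_def ring.defs module.defs monoid.defs case_prod_unfold)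

locale central_idempotent = k_algebra A
  for A :: "('k::field, 'a) module" (structure) +
  fixes e :: 'a
  assumes e_closed [simp]: "e \<in> carrier A" and idem [simp]: "e \<otimes> e = e"
    and central: "x \<in> carrier A \<Longrightarrow> e \<otimes> x = x \<otimes> e"
begin

lemma idem_assoc [simp]: "x \<in> carrier A \<Longrightarrow> x \<otimes> e \<otimes> e = x \<otimes> e"
  by (simp add: A.m_assoc)

lemma carrier_idem: "x \<in> carrier (idem_component A e) \<longleftrightarrow> x \<in> carrier A \<and> x \<otimes> e = x"
  by (auto simp: idem_component_def) (metis)

lemma ideal_idem: "ideal (carrier (idem_component A e)) A"
proof -
  have "k_ideal A (carrier (idem_component A e))"
  proof (rule k_idealI)
    fix x y assume "x \<in> carrier (idem_component A e)" "y \<in> carrier A"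
    then have x: "x \<in> carrier A" "x \<otimes> e = x" and y: "y \<in> carrier A" by (simp_all add: carrier_idem)
    have "x \<otimes> y \<otimes> e = x \<otimes> e \<otimes> y" using x(1) y by (simp add: A.m_assoc central)
    then show "y \<otimes> x \<in> carrier (idem_component A e)" "x \<otimes> y \<in> carrier (idem_component A e)"
      unfolding carrier_idem using x y by (simp_all add: A.m_assoc)
  qed (auto simp: carrier_idem A.l_distr)
  then show ?thesis by (rule k_ideal.axioms)
qed

lemma k_algebra_idem: "k_algebra (idem_component A e)"
proof (rule k_algebraI)
  show "ring (idem_component A e)"
  proof (intro ringI abelian_groupI monoidI)
    fix x assume "x \<in> carrier (idem_component A e)"
    then show "\<exists>y\<in>carrier (idem_component A e). y \<oplus>\<^bsub>idem_component A e\<^esub> x = \<zero>\<^bsub>idem_component A e\<^esub>"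
      by (intro bexI[of _ "(- 1) \<odot> x"]) (auto simp: carrier_idem)
  qed (auto simp: carrier_idem A.l_distr A.r_distr A.m_assoc M.a_ac central)
qed (auto simp: carrier_idem sc_add sc_distr)

lemma proj_hom: "(\<lambda>x. x \<otimes> e) \<in> alg_hom A (idem_component A e)"
proof (intro alg_homI linear_mapsI)
  fix x y assume xy: "x \<in> carrier A" "y \<in> carrier A"
  have "x \<otimes> e \<otimes> (y \<otimes> e) = x \<otimes> (e \<otimes> y) \<otimes> e" using xy by (simp add: A.m_assoc)
  then show "x \<otimes> y \<otimes> e = (x \<otimes> e) \<otimes>\<^bsub>idem_component A e\<^esub> (y \<otimes> e)"
    using xy by (simp add: central A.m_assoc)
qed (auto simp: carrier_idem A.l_distr)

lemma restrict_hom: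
  assumes "h \<in> alg_hom A B" "h e = \<one>\<^bsub>B\<^esub>"
  shows "h \<in> alg_hom (idem_component A e) B"
  using alg_homD[OF assms(1)] assms(2) by (intro alg_homI linear_mapsI) (auto simp: carrier_idem)

lemma complement: "central_idempotent A (\<one> \<ominus> e)"
proof unfold_locales
  show "\<one> \<ominus> e \<in> carrier A" by simp
  have *: "\<one> \<ominus> e = \<one> \<oplus> (- 1) \<odot> e" by (simp add: a_minus_def minus_eq_sc)
  show "(\<one> \<ominus> e) \<otimes> (\<one> \<ominus> e) = \<one> \<ominus> e"
    unfolding * by (simp add: A.l_distr A.r_distr M.a_assoc sc_distr)
  show "(\<one> \<ominus> e) \<otimes> x = x \<otimes> (\<one> \<ominus> e)" if "x \<in> carrier A" for x
    unfolding * using that by (simp add: A.l_distr A.r_distr central)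
qed

text \<open>The Peirce decomposition for a central idempotent.\<close>

lemma direct_sum: "alg_direct_sum A (idem_component A e) (idem_component A (\<one> \<ominus> e))"
proof -
  let ?f = "\<one> \<ominus> e"
  interpret f: central_idempotent A ?f by (rule complement)
  have f: "?f = \<one> \<oplus> (- 1) \<odot> e" by (simp add: a_minus_def minus_eq_sc)
  have ef: "e \<otimes> ?f = \<zero>" "?f \<otimes> e = \<zero>" by (simp_all add: f A.l_distr A.r_distr)
  have sum1: "e \<oplus> ?f = \<one>"
    using add_sub_cancel[of e \<one>] by (simp add: f M.a_assoc)
  have orth: "x \<otimes> y = \<zero>" "y \<otimes> x = \<zero>"
    if "x \<in> carrier A" "x \<otimes> e = x" "y \<in> carrier A" "y \<otimes> ?f = y" for x y
  proof -
    have "x \<otimes> y = x \<otimes> (e \<otimes> ?f) \<otimes> y" "y \<otimes> x = y \<otimes> (?f \<otimes> e) \<otimes> x"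
      using that central f.central f.e_closed by (metis A.m_assoc A.m_closed e_closed)+
    then show "x \<otimes> y = \<zero>" "y \<otimes> x = \<zero>" using that by (simp_all add: ef)
  qed
  let ?P = "alg_prod (idem_component A e) (idem_component A ?f)" and ?s = "\<lambda>p. fst p \<oplus> snd p"
  have s: "(\<lambda>(x, y). x \<oplus> y) = ?s" by auto
  have P: "p \<in> carrier ?P \<longleftrightarrow> fst p \<in> carrier A \<and> fst p \<otimes> e = fst p \<and> snd p \<in> carrier A \<and> snd p \<otimes> ?f = snd p" for p
    by (simp only: alg_prod_simps mem_Times_iff carrier_idem f.carrier_idem conj_assoc)
  have hom: "?s \<in> alg_hom ?P A"
  proof (intro alg_homI linear_mapsI)
    fix p r assume "p \<in> carrier ?P" "r \<in> carrier ?P"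
    then have p: "fst p \<in> carrier A" "fst p \<otimes> e = fst p" "snd p \<in> carrier A" "snd p \<otimes> ?f = snd p"
      and r: "fst r \<in> carrier A" "fst r \<otimes> e = fst r" "snd r \<in> carrier A" "snd r \<otimes> ?f = snd r"
      unfolding P by blast+
    show "?s (p \<oplus>\<^bsub>?P\<^esub> r) = ?s p \<oplus> ?s r"
      using p(1,3) r(1,3) by (simp add: M.a_ac)
    show "?s (p \<otimes>\<^bsub>?P\<^esub> r) = ?s p \<otimes> ?s r"
      using p(1,3) r(1,3) orth(1)[OF p(1,2) r(3,4)] orth(2)[OF r(1,2) p(3,4)]
      by (simp add: A.l_distr A.r_distr)
  next
    fix c p assume "p \<in> carrier ?P"
    then have p: "fst p \<in> carrier A" "snd p \<in> carrier A" unfolding P by blast+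
    show "?s p \<in> carrier A" using p by simp
    show "?s (c \<odot>\<^bsub>?P\<^esub> p) = c \<odot> ?s p" using p by (simp add: sc_distr)
  qed (simp add: sum1)
  have comp: "(x \<oplus> y) \<otimes> e = x" "(x \<oplus> y) \<otimes> ?f = y"
    if xy: "x \<in> carrier A" "x \<otimes> e = x" "y \<in> carrier A" "y \<otimes> ?f = y" for x y
  proof -
    have "x \<otimes> ?f = x \<otimes> (e \<otimes> ?f)" "y \<otimes> e = y \<otimes> (?f \<otimes> e)"
      using xy by (metis A.m_assoc e_closed f.e_closed)+
    then have "x \<otimes> ?f = \<zero>" "y \<otimes> e = \<zero>" using xy by (simp_all add: ef)
    then show "(x \<oplus> y) \<otimes> e = x" "(x \<oplus> y) \<otimes> ?f = y"
      using xy by (simp_all add: A.l_distr)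
  qed
  have "bij_betw ?s (carrier ?P) (carrier A)"
  proof (rule bij_betw_byWitness[where f' = "\<lambda>x. (x \<otimes> e, x \<otimes> ?f)"])
    show "\<forall>p\<in>carrier ?P. (?s p \<otimes> e, ?s p \<otimes> ?f) = p"
    proof
      fix p assume "p \<in> carrier ?P"
      then have "?s p \<otimes> e = fst p" "?s p \<otimes> ?f = snd p" unfolding P using comp by blast+
      then show "(?s p \<otimes> e, ?s p \<otimes> ?f) = p" by simp
    qed
    show "\<forall>x\<in>carrier A. ?s (x \<otimes> e, x \<otimes> ?f) = x"
      using sum1 by (simp flip: A.r_distr)
    show "?s ` carrier ?P \<subseteq> carrier A"
      by (rule image_subsetI) (simp add: P del: alg_prod_simps)
    show "(\<lambda>x. (x \<otimes> e, x \<otimes> ?f)) ` carrier A \<subseteq> carrier ?P"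
      by (rule image_subsetI) (simp add: P del: alg_prod_simps)
  qed
  then show ?thesis
    using hom k_algebra_idem f.k_algebra_idem ideal_idem f.ideal_idem k_algebra_axioms
    unfolding alg_direct_sum_def alg_iso_def s by blast
qed

end

section \<open>The weak quantum algebra\<close>

text \<open>As the \<open>K i\<close> are invertible, the relations of types 1 and 2 are both equivalent to the conjugation formulas
  of the quantum group, up to the symmetry of \<open>qc\<close>.\<close>

lemma (in uq_tuple) weak_universal:
  "\<exists>h\<in>alg_hom (weak_alg \<alpha> q \<kappa> \<kappa>') B. h (weak_gen \<alpha> q \<kappa> \<kappa>' WJ) = \<one> \<and>
    (\<forall>i. h (weak_gen \<alpha> q \<kappa> \<kappa>' (WE i)) = E i \<and> h (weak_gen \<alpha> q \<kappa> \<kappa>' (WF i)) = F i \<and>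
      h (weak_gen \<alpha> q \<kappa> \<kappa>' (WK i)) = K i \<and> h (weak_gen \<alpha> q \<kappa> \<kappa>' (WKbar i)) = K' i)"
proof -
  define g where "g = case_wgen E F K K' \<one>"
  have g: "g x \<in> carrier B" for x by (cases x) (auto simp: g_def)
  have gs: "g (WE i) = E i" "g (WF i) = F i" "g (WK i) = K i" "g (WKbar i) = K' i" "g WJ = \<one>" for i
    by (simp_all add: g_def)
  note ev = ev_simps[OF k_algebra_axioms g] and evq = ev_qad_free[OF k_algebra_axioms g]
    and dz = ev_diff_zero_iff[OF k_algebra_axioms g]
  have qc: "qpar \<alpha> q i powi cartan \<alpha> i j = qc j i" "qpar \<alpha> q i powi (- cartan \<alpha> i j) = inverse (qc j i)" for i j
    using qc_sym[of j i] by (simp_all add: qc_def power_int_minus)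
  have rel: "ev B g p = \<zero>" if "p \<in> weak_rels \<alpha> q \<kappa> \<kappa>'" for p
    using that
  proof (cases rule: weak_rels.cases)
    case (13 i j)
    have "ev B g (letter (WE i) * letter (WF j) - letter (WF j) * letter (WE i)) = lam i j \<odot> (K i \<oplus> (- 1) \<odot> K' i)"
      by (simp only: ev gs EF[of i j]) (simp add: add_sub_cancel)
    moreover have "ev B g (pm_scale (lam i j) (letter (WK i) - letter (WKbar i))) = lam i j \<odot> (K i \<oplus> (- 1) \<odot> K' i)"
      by (simp only: ev gs)
    ultimately show ?thesis unfolding 13 lam_def[symmetric] by (simp only: dz)
  next
    case (9 i j)
    show ?thesis unfolding 9 dz by (simp only: ev gs qc KEK')
  next
    case (12 i j)
    show ?thesis unfolding 12 dz by (simp only: ev gs qc KFK')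
  next
    case (14 i j)
    then show ?thesis using serreE[of i j] by (simp add: serre_qad evq ev gs)
  next
    case (15 i j)
    then show ?thesis using serreF[of i j] by (simp add: serre_qad evq ev gs)
  qed (simp_all only: dz ev gs qc, simp_all add: KE KF KK KK'_comm)
  obtain h where h: "h \<in> alg_hom (weak_alg \<alpha> q \<kappa> \<kappa>') B" "\<And>x. h (weak_gen \<alpha> q \<kappa> \<kappa>' x) = g x"
    using presented_universal[OF k_algebra_axioms g rel] by blast
  then show ?thesis by (intro bexI[of _ h]) (simp_all only: h gs simp_thms)
qed

locale weak_datum = q_datum \<alpha> q
  for \<alpha> :: "'i::finite \<Rightarrow> 'v::euclidean_space" and q :: "'k::field" +
  fixes \<kappa> \<kappa>' :: "'i \<Rightarrow> bool"
begin

abbreviation "w \<equiv> weak_alg \<alpha> q \<kappa> \<kappa>'"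
abbreviation "g \<equiv> weak_gen \<alpha> q \<kappa> \<kappa>'"
abbreviation "W \<equiv> wq \<alpha> q \<kappa> \<kappa>'"

sublocale w: k_algebra w by (rule k_algebra_presented)

lemma g_closed [simp]: "g x \<in> carrier w" by (rule presented_gen_closed)

lemma relations:
  "g WJ = g (WK i) \<otimes>\<^bsub>w\<^esub> g (WKbar i)"
  "g (WK i) \<otimes>\<^bsub>w\<^esub> g (WKbar j) = g (WKbar j) \<otimes>\<^bsub>w\<^esub> g (WK i)"
  "g (WK i) \<otimes>\<^bsub>w\<^esub> g (WK j) = g (WK j) \<otimes>\<^bsub>w\<^esub> g (WK i)"
  "g (WKbar i) \<otimes>\<^bsub>w\<^esub> g (WKbar j) = g (WKbar j) \<otimes>\<^bsub>w\<^esub> g (WKbar i)"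
  "g WJ \<otimes>\<^bsub>w\<^esub> g (WK i) = g (WK i)"
  "g WJ \<otimes>\<^bsub>w\<^esub> g (WKbar i) = g (WKbar i)"
  "\<kappa> i \<Longrightarrow> g (WK j) \<otimes>\<^bsub>w\<^esub> g (WE i) = qc i j \<odot>\<^bsub>w\<^esub> (g (WE i) \<otimes>\<^bsub>w\<^esub> g (WK j))"
  "\<kappa> i \<Longrightarrow> g (WE i) \<otimes>\<^bsub>w\<^esub> g (WKbar j) = qc i j \<odot>\<^bsub>w\<^esub> (g (WKbar j) \<otimes>\<^bsub>w\<^esub> g (WE i))"
  "\<not> \<kappa> i \<Longrightarrow> g (WK j) \<otimes>\<^bsub>w\<^esub> g (WE i) \<otimes>\<^bsub>w\<^esub> g (WKbar j) = qc i j \<odot>\<^bsub>w\<^esub> g (WE i)"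
  "\<kappa>' i \<Longrightarrow> g (WK j) \<otimes>\<^bsub>w\<^esub> g (WF i) = inverse (qc i j) \<odot>\<^bsub>w\<^esub> (g (WF i) \<otimes>\<^bsub>w\<^esub> g (WK j))"
  "\<kappa>' i \<Longrightarrow> g (WF i) \<otimes>\<^bsub>w\<^esub> g (WKbar j) = inverse (qc i j) \<odot>\<^bsub>w\<^esub> (g (WKbar j) \<otimes>\<^bsub>w\<^esub> g (WF i))"
  "\<not> \<kappa>' i \<Longrightarrow> g (WK j) \<otimes>\<^bsub>w\<^esub> g (WF i) \<otimes>\<^bsub>w\<^esub> g (WKbar j) = inverse (qc i j) \<odot>\<^bsub>w\<^esub> g (WF i)"
  "g (WE i) \<otimes>\<^bsub>w\<^esub> g (WF j) = g (WF j) \<otimes>\<^bsub>w\<^esub> g (WE i) \<oplus>\<^bsub>w\<^esub>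
     lam i j \<odot>\<^bsub>w\<^esub> (g (WK i) \<oplus>\<^bsub>w\<^esub> (- 1) \<odot>\<^bsub>w\<^esub> g (WKbar i))"
  "i \<noteq> j \<Longrightarrow> qad w (tw i j) (g (WE i)) (g (WE j)) (sdeg i j) = \<zero>\<^bsub>w\<^esub>"
  "i \<noteq> j \<Longrightarrow> qad w (tw i j) (g (WF i)) (g (WF j)) (sdeg i j) = \<zero>\<^bsub>w\<^esub>"
proof -
  note rels = weak_rels.intros[where \<alpha> = \<alpha> and q = q and \<kappa> = \<kappa> and \<kappa>' = \<kappa>']
  note ev = ev_simps[OF w.k_algebra_axioms g_closed] and evq = ev_qad_free[OF w.k_algebra_axioms g_closed]
  note eq = presented_eq[where P = "weak_rels \<alpha> q \<kappa> \<kappa>'"]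
  note norm = ev power_int_minus qc_def[symmetric]
  show "g WJ = g (WK i) \<otimes>\<^bsub>w\<^esub> g (WKbar i)"
    using eq[OF rels(1)] unfolding norm .
  show "g (WK i) \<otimes>\<^bsub>w\<^esub> g (WKbar j) = g (WKbar j) \<otimes>\<^bsub>w\<^esub> g (WK i)"
    using eq[OF rels(2)] unfolding norm .
  show "g (WK i) \<otimes>\<^bsub>w\<^esub> g (WK j) = g (WK j) \<otimes>\<^bsub>w\<^esub> g (WK i)"
    using eq[OF rels(3)] unfolding norm .
  show "g (WKbar i) \<otimes>\<^bsub>w\<^esub> g (WKbar j) = g (WKbar j) \<otimes>\<^bsub>w\<^esub> g (WKbar i)"
    using eq[OF rels(4)] unfolding norm .
  show "g WJ \<otimes>\<^bsub>w\<^esub> g (WK i) = g (WK i)"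
    using eq[OF rels(5)] unfolding norm .
  show "g WJ \<otimes>\<^bsub>w\<^esub> g (WKbar i) = g (WKbar i)"
    using eq[OF rels(6)] unfolding norm .
  show "\<kappa> i \<Longrightarrow> g (WK j) \<otimes>\<^bsub>w\<^esub> g (WE i) = qc i j \<odot>\<^bsub>w\<^esub> (g (WE i) \<otimes>\<^bsub>w\<^esub> g (WK j))"
    using eq[OF rels(7)] unfolding norm .
  show "\<kappa> i \<Longrightarrow> g (WE i) \<otimes>\<^bsub>w\<^esub> g (WKbar j) = qc i j \<odot>\<^bsub>w\<^esub> (g (WKbar j) \<otimes>\<^bsub>w\<^esub> g (WE i))"
    using eq[OF rels(8)] unfolding norm .
  show "\<not> \<kappa> i \<Longrightarrow> g (WK j) \<otimes>\<^bsub>w\<^esub> g (WE i) \<otimes>\<^bsub>w\<^esub> g (WKbar j) = qc i j \<odot>\<^bsub>w\<^esub> g (WE i)"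
    using eq[OF rels(9)] unfolding norm .
  show "\<kappa>' i \<Longrightarrow> g (WK j) \<otimes>\<^bsub>w\<^esub> g (WF i) = inverse (qc i j) \<odot>\<^bsub>w\<^esub> (g (WF i) \<otimes>\<^bsub>w\<^esub> g (WK j))"
    using eq[OF rels(10)] unfolding norm .
  show "\<kappa>' i \<Longrightarrow> g (WF i) \<otimes>\<^bsub>w\<^esub> g (WKbar j) = inverse (qc i j) \<odot>\<^bsub>w\<^esub> (g (WKbar j) \<otimes>\<^bsub>w\<^esub> g (WF i))"
    using eq[OF rels(11)] unfolding norm .
  show "\<not> \<kappa>' i \<Longrightarrow> g (WK j) \<otimes>\<^bsub>w\<^esub> g (WF i) \<otimes>\<^bsub>w\<^esub> g (WKbar j) = inverse (qc i j) \<odot>\<^bsub>w\<^esub> g (WF i)"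
    using eq[OF rels(12)] unfolding norm .
  have "g (WE i) \<otimes>\<^bsub>w\<^esub> g (WF j) \<oplus>\<^bsub>w\<^esub> (- 1) \<odot>\<^bsub>w\<^esub> (g (WF j) \<otimes>\<^bsub>w\<^esub> g (WE i))
      = lam i j \<odot>\<^bsub>w\<^esub> (g (WK i) \<oplus>\<^bsub>w\<^esub> (- 1) \<odot>\<^bsub>w\<^esub> g (WKbar i))"
    using eq[OF rels(13)] unfolding ev lam_def .
  then show "g (WE i) \<otimes>\<^bsub>w\<^esub> g (WF j) = g (WF j) \<otimes>\<^bsub>w\<^esub> g (WE i) \<oplus>\<^bsub>w\<^esub>
     lam i j \<odot>\<^bsub>w\<^esub> (g (WK i) \<oplus>\<^bsub>w\<^esub> (- 1) \<odot>\<^bsub>w\<^esub> g (WKbar i))"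
    by (intro w.eq_add_of_sub w.A.m_closed g_closed)
  show "qad w (tw i j) (g (WE i)) (g (WE j)) (sdeg i j) = \<zero>\<^bsub>w\<^esub>" if "i \<noteq> j"
    using presented_relation[OF rels(14)[OF that]] unfolding serre_qad[OF that] evq ev .
  show "qad w (tw i j) (g (WF i)) (g (WF j)) (sdeg i j) = \<zero>\<^bsub>w\<^esub>" if "i \<noteq> j"
    using presented_relation[OF rels(15)[OF that]] unfolding serre_qad[OF that] evq ev .
qed

lemma K_J: "g (WK i) \<otimes>\<^bsub>w\<^esub> g WJ = g (WK i)" "g (WKbar i) \<otimes>\<^bsub>w\<^esub> g WJ = g (WKbar i)"
proof -
  have "g (WK i) \<otimes>\<^bsub>w\<^esub> g WJ = g (WK i) \<otimes>\<^bsub>w\<^esub> (g (WKbar i) \<otimes>\<^bsub>w\<^esub> g (WK i))"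
    by (simp add: relations(1)[of i] relations(2)[of i i])
  also have "\<dots> = g WJ \<otimes>\<^bsub>w\<^esub> g (WK i)" by (simp add: relations(1)[of i] w.A.m_assoc)
  finally show "g (WK i) \<otimes>\<^bsub>w\<^esub> g WJ = g (WK i)" by (simp add: relations(5))
  have "g (WKbar i) \<otimes>\<^bsub>w\<^esub> g WJ = (g (WKbar i) \<otimes>\<^bsub>w\<^esub> g (WK i)) \<otimes>\<^bsub>w\<^esub> g (WKbar i)"
    by (simp add: relations(1)[of i] w.A.m_assoc)
  also have "\<dots> = g WJ \<otimes>\<^bsub>w\<^esub> g (WKbar i)" by (simp add: relations(1)[of i] flip: relations(2)[of i i])
  finally show "g (WKbar i) \<otimes>\<^bsub>w\<^esub> g WJ = g (WKbar i)" by (simp add: relations(6))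
qed

text \<open>Let \<open>y = K j * x * Kbar j\<close>.  In type 1, moving \<open>K j\<close> to the right gives \<open>y = c * x * J\<close>, and moving
  \<open>Kbar j\<close> to the left gives \<open>y = c * J * x\<close>.  In type 2, \<open>y = c * x\<close>, and \<open>y\<close> absorbs \<open>J\<close> on both sides.\<close>

lemma conj_of_type:
  assumes "x \<in> carrier w" "c \<noteq> 0"
    and "t \<Longrightarrow> g (WK j) \<otimes>\<^bsub>w\<^esub> x = c \<odot>\<^bsub>w\<^esub> (x \<otimes>\<^bsub>w\<^esub> g (WK j))"
    and "t \<Longrightarrow> x \<otimes>\<^bsub>w\<^esub> g (WKbar j) = c \<odot>\<^bsub>w\<^esub> (g (WKbar j) \<otimes>\<^bsub>w\<^esub> x)"
    and "\<not> t \<Longrightarrow> g (WK j) \<otimes>\<^bsub>w\<^esub> x \<otimes>\<^bsub>w\<^esub> g (WKbar j) = c \<odot>\<^bsub>w\<^esub> x"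
  shows "g (WK j) \<otimes>\<^bsub>w\<^esub> x \<otimes>\<^bsub>w\<^esub> g (WKbar j) = c \<odot>\<^bsub>w\<^esub> (x \<otimes>\<^bsub>w\<^esub> g WJ)"
    "g WJ \<otimes>\<^bsub>w\<^esub> x = x \<otimes>\<^bsub>w\<^esub> g WJ"
proof -
  let ?y = "g (WK j) \<otimes>\<^bsub>w\<^esub> x \<otimes>\<^bsub>w\<^esub> g (WKbar j)"
  have Jy: "g WJ \<otimes>\<^bsub>w\<^esub> ?y = ?y"
    using assms(1) relations(5) by (simp flip: w.A.m_assoc)
  have yJ: "?y \<otimes>\<^bsub>w\<^esub> g WJ = ?y"
    using assms(1) K_J(2) by (simp add: w.A.m_assoc)
  have y: "?y = c \<odot>\<^bsub>w\<^esub> (x \<otimes>\<^bsub>w\<^esub> g WJ) \<and> ?y = c \<odot>\<^bsub>w\<^esub> (g WJ \<otimes>\<^bsub>w\<^esub> x)"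
  proof (cases t)
    case True
    have "?y = c \<odot>\<^bsub>w\<^esub> (x \<otimes>\<^bsub>w\<^esub> g WJ)"
      using assms(1) by (simp add: assms(3)[OF True] relations(1)[of j] w.A.m_assoc)
    moreover have "?y = c \<odot>\<^bsub>w\<^esub> (g WJ \<otimes>\<^bsub>w\<^esub> x)"
      using assms(1) by (simp add: w.A.m_assoc assms(4)[OF True]) (simp add: relations(1)[of j] w.A.m_assoc)
    ultimately show ?thesis by simp
  next
    case False
    then show ?thesis using assms(1) Jy yJ by (simp add: assms(5))
  qed
  show "?y = c \<odot>\<^bsub>w\<^esub> (x \<otimes>\<^bsub>w\<^esub> g WJ)" using y by (rule conjunct1)
  have "c \<odot>\<^bsub>w\<^esub> (g WJ \<otimes>\<^bsub>w\<^esub> x) = c \<odot>\<^bsub>w\<^esub> (x \<otimes>\<^bsub>w\<^esub> g WJ)"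
    using conjunct2[OF y, symmetric] conjunct1[OF y] by (rule trans)
  then have "inverse c \<odot>\<^bsub>w\<^esub> (c \<odot>\<^bsub>w\<^esub> (g WJ \<otimes>\<^bsub>w\<^esub> x)) = inverse c \<odot>\<^bsub>w\<^esub> (c \<odot>\<^bsub>w\<^esub> (x \<otimes>\<^bsub>w\<^esub> g WJ))"
    by (simp only:)
  then show "g WJ \<otimes>\<^bsub>w\<^esub> x = x \<otimes>\<^bsub>w\<^esub> g WJ" using assms(1,2) by simp
qed

lemma conj_E: "g (WK i) \<otimes>\<^bsub>w\<^esub> g (WE j) \<otimes>\<^bsub>w\<^esub> g (WKbar i) = qc i j \<odot>\<^bsub>w\<^esub> (g (WE j) \<otimes>\<^bsub>w\<^esub> g WJ)"
  and J_E: "g WJ \<otimes>\<^bsub>w\<^esub> g (WE j) = g (WE j) \<otimes>\<^bsub>w\<^esub> g WJ"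
  using conj_of_type[of "g (WE j)" "qc j i" "\<kappa> j" i] relations(7,8,9)[of j i] qc_sym[of j i] by simp_all

lemma conj_F: "g (WK i) \<otimes>\<^bsub>w\<^esub> g (WF j) \<otimes>\<^bsub>w\<^esub> g (WKbar i) = inverse (qc i j) \<odot>\<^bsub>w\<^esub> (g (WF j) \<otimes>\<^bsub>w\<^esub> g WJ)"
  and J_F: "g WJ \<otimes>\<^bsub>w\<^esub> g (WF j) = g (WF j) \<otimes>\<^bsub>w\<^esub> g WJ"
  using conj_of_type[of "g (WF j)" "inverse (qc j i)" "\<kappa>' j" i] relations(10,11,12)[of j i] qc_sym[of j i] by simp_all

lemma J_central: "central_idempotent w (g WJ)"
proof unfold_locales
  \<comment> \<open>The index set is not empty, so \<open>J\<close> is some \<open>K i * Kbar i\<close>.\<close>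
  obtain i :: 'i where True by simp
  show JJ: "g WJ \<otimes>\<^bsub>w\<^esub> g WJ = g WJ"
    using w.A.m_assoc[of "g WJ" "g (WK i)" "g (WKbar i)"] by (simp add: relations(5) flip: relations(1))
  have g: "g WJ \<otimes>\<^bsub>w\<^esub> g x = g x \<otimes>\<^bsub>w\<^esub> g WJ" for x
    by (cases x) (simp_all add: J_E J_F relations(5,6) K_J)
  show "g WJ \<otimes>\<^bsub>w\<^esub> x = x \<otimes>\<^bsub>w\<^esub> g WJ" if "x \<in> carrier w" for x
    using that unfolding presented_generated
  proof induction
    case (add x y)
    then have "x \<in> carrier w" "y \<in> carrier w" unfolding presented_generated by auto
    then show ?case using add.IH by (simp add: w.A.l_distr w.A.r_distr)
  next
    case (mult x y)
    then have xy: "x \<in> carrier w" "y \<in> carrier w" unfolding presented_generated by auto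
    have "g WJ \<otimes>\<^bsub>w\<^esub> (x \<otimes>\<^bsub>w\<^esub> y) = (x \<otimes>\<^bsub>w\<^esub> g WJ) \<otimes>\<^bsub>w\<^esub> y" using xy mult.IH by (simp flip: w.A.m_assoc)
    then show ?case using xy mult.IH by (simp add: w.A.m_assoc)
  next
    case (smult x c)
    then have "x \<in> carrier w" unfolding presented_generated by auto
    then show ?case using smult.IH by simp
  qed (auto simp: g)
qed (rule g_closed)

sublocale J: central_idempotent w "g WJ" by (rule J_central)

abbreviation "EJ i \<equiv> g (WE i) \<otimes>\<^bsub>w\<^esub> g WJ"
abbreviation "FJ i \<equiv> g (WF i) \<otimes>\<^bsub>w\<^esub> g WJ"

lemma W_closed: "EJ i \<in> carrier W" "FJ i \<in> carrier W" "g (WK i) \<in> carrier W" "g (WKbar i) \<in> carrier W"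
  by (simp_all add: wq_def J.carrier_idem K_J)

lemma uq_tuple_W: "uq_tuple \<alpha> q W EJ FJ (\<lambda>i. g (WK i)) (\<lambda>i. g (WKbar i))"
proof -
  interpret W: k_algebra W unfolding wq_def by (rule J.k_algebra_idem)
  have Jx: "x \<otimes>\<^bsub>w\<^esub> g WJ \<otimes>\<^bsub>w\<^esub> (y \<otimes>\<^bsub>w\<^esub> g WJ) = x \<otimes>\<^bsub>w\<^esub> y \<otimes>\<^bsub>w\<^esub> g WJ"
    if "x \<in> carrier w" "y \<in> carrier w" for x y
    using alg_homD(4)[OF J.proj_hom that] by simp
  have K'J: "g WJ \<otimes>\<^bsub>w\<^esub> g (WKbar i) = g (WKbar i)" for i by (rule relations(6))
  have qadJ: "qad W t (x \<otimes>\<^bsub>w\<^esub> g WJ) (y \<otimes>\<^bsub>w\<^esub> g WJ) r = qad w t x y r \<otimes>\<^bsub>w\<^esub> g WJ"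
    if "x \<in> carrier w" "y \<in> carrier w" for x y t r
    using alg_hom_qad[OF w.k_algebra_axioms J.proj_hom that] by (simp add: wq_def)
  have conjJ: "g (WK i) \<otimes>\<^bsub>w\<^esub> (x \<otimes>\<^bsub>w\<^esub> g WJ) \<otimes>\<^bsub>w\<^esub> g (WKbar i) = g (WK i) \<otimes>\<^bsub>w\<^esub> x \<otimes>\<^bsub>w\<^esub> g (WKbar i)"
    if "x \<in> carrier w" for x i
    using that by (simp add: w.A.m_assoc K'J)
  show ?thesis
  proof unfold_locales
    fix i j
    show "g (WK i) \<otimes>\<^bsub>W\<^esub> EJ j \<otimes>\<^bsub>W\<^esub> g (WKbar i) = qc i j \<odot>\<^bsub>W\<^esub> EJ j"
      by (simp add: wq_def conjJ conj_E)
    show "g (WK i) \<otimes>\<^bsub>W\<^esub> FJ j \<otimes>\<^bsub>W\<^esub> g (WKbar i) = inverse (qc i j) \<odot>\<^bsub>W\<^esub> FJ j"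
      by (simp add: wq_def conjJ conj_F)
    show "EJ i \<otimes>\<^bsub>W\<^esub> FJ j = FJ j \<otimes>\<^bsub>W\<^esub> EJ i \<oplus>\<^bsub>W\<^esub> lam i j \<odot>\<^bsub>W\<^esub> (g (WK i) \<oplus>\<^bsub>W\<^esub> (- 1) \<odot>\<^bsub>W\<^esub> g (WKbar i))"
      by (simp add: wq_def Jx relations(13) w.A.l_distr K_J)
    show "i \<noteq> j \<Longrightarrow> qad W (tw i j) (EJ i) (EJ j) (sdeg i j) = \<zero>\<^bsub>W\<^esub>"
      by (simp add: qadJ relations(14)) (simp add: wq_def)
    show "i \<noteq> j \<Longrightarrow> qad W (tw i j) (FJ i) (FJ j) (sdeg i j) = \<zero>\<^bsub>W\<^esub>"
      by (simp add: qadJ relations(15)) (simp add: wq_def)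
    show "g (WK i) \<otimes>\<^bsub>W\<^esub> g (WK j) = g (WK j) \<otimes>\<^bsub>W\<^esub> g (WK i)"
      by (simp add: wq_def relations(3))
    show "g (WK i) \<otimes>\<^bsub>W\<^esub> g (WKbar i) = \<one>\<^bsub>W\<^esub>" by (simp add: wq_def flip: relations(1))
    show "g (WKbar i) \<otimes>\<^bsub>W\<^esub> g (WK i) = \<one>\<^bsub>W\<^esub>" by (simp add: wq_def flip: relations(1) relations(2))
  qed (rule W_closed)+
qed

sublocale W: uq_tuple \<alpha> q W EJ FJ "\<lambda>i. g (WK i)" "\<lambda>i. g (WKbar i)" by (rule uq_tuple_W)

text \<open>Multiplication by \<open>J\<close> is a homomorphism onto \<open>W\<close> and maps \<open>J\<close> itself to the identity of \<open>W\<close>.\<close>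

lemma W_generated: "carrier W = alg_gen W W.gens"
proof
  show "carrier W \<subseteq> alg_gen W W.gens"
  proof
    fix x assume "x \<in> carrier W"
    then have x: "x \<in> carrier w" "x \<otimes>\<^bsub>w\<^esub> g WJ = x" by (simp_all add: wq_def J.carrier_idem)
    have gens: "range g \<subseteq> carrier w" by auto
    have "(\<lambda>x. x \<otimes>\<^bsub>w\<^esub> g WJ) x \<in> alg_gen W ((\<lambda>x. x \<otimes>\<^bsub>w\<^esub> g WJ) ` range g)"
      unfolding wq_def using x(1)
      by (intro alg_gen_image[OF w.k_algebra_axioms J.proj_hom gens]) (simp add: presented_generated)
    moreover have "g y \<otimes>\<^bsub>w\<^esub> g WJ \<in> alg_gen W W.gens" for y
    proof (cases y)
      case WJ
      then show ?thesis using alg_gen.one[of W W.gens] by (simp add: wq_def)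
    qed (auto intro!: alg_gen.gen simp: W.gens_def K_J)
    then have "alg_gen W ((\<lambda>x. x \<otimes>\<^bsub>w\<^esub> g WJ) ` range g) \<subseteq> alg_gen W W.gens"
      by (intro alg_gen_subset) auto
    ultimately show "x \<in> alg_gen W W.gens" using x(2) by auto
  qed
  show "alg_gen W W.gens \<subseteq> carrier W"
    using W.alg_gen_carrier[OF W.gens_carrier] by auto
qed

sublocale U: uq_tuple \<alpha> q "Uq \<alpha> q" "\<lambda>i. presented_gen (Uq_rels \<alpha> q) (Ue i)" "\<lambda>i. presented_gen (Uq_rels \<alpha> q) (Uf i)"
  "\<lambda>i. presented_gen (Uq_rels \<alpha> q) (Uk i)" "\<lambda>i. presented_gen (Uq_rels \<alpha> q) (Ukinv i)"
  by (rule uq_tuple_Uq)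

lemma U_generated: "carrier (Uq \<alpha> q) = alg_gen (Uq \<alpha> q) U.gens"
proof -
  have "x \<in> U.gens" if "x \<in> range (presented_gen (Uq_rels \<alpha> q))" for x
  proof -
    from that obtain y where "x = presented_gen (Uq_rels \<alpha> q) y" by blast
    then show ?thesis by (cases y) (auto simp: U.gens_def)
  qed
  moreover have "U.gens \<subseteq> range (presented_gen (Uq_rels \<alpha> q))" by (auto simp: U.gens_def)
  ultimately have "range (presented_gen (Uq_rels \<alpha> q)) = U.gens" by blast
  then show ?thesis using presented_generated by metis
qed

lemma W_iso_U:
  "\<exists>\<phi>\<in>alg_iso W (Uq \<alpha> q). \<forall>i. \<phi> (EJ i) = presented_gen (Uq_rels \<alpha> q) (Ue i) \<and>
    \<phi> (FJ i) = presented_gen (Uq_rels \<alpha> q) (Uf i) \<and> \<phi> (g (WK i)) = presented_gen (Uq_rels \<alpha> q) (Uk i) \<and>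
    \<phi> (g (WKbar i)) = presented_gen (Uq_rels \<alpha> q) (Ukinv i)"
proof -
  let ?u = "presented_gen (Uq_rels \<alpha> q)"
  obtain h where h: "h \<in> alg_hom w (Uq \<alpha> q)" "h (g WJ) = \<one>\<^bsub>Uq \<alpha> q\<^esub>"
    "\<And>i. h (g (WE i)) = ?u (Ue i)" "\<And>i. h (g (WF i)) = ?u (Uf i)"
    "\<And>i. h (g (WK i)) = ?u (Uk i)" "\<And>i. h (g (WKbar i)) = ?u (Ukinv i)"
    using U.weak_universal[of \<kappa> \<kappa>'] by blast
  have hW: "h \<in> alg_hom W (Uq \<alpha> q)" unfolding wq_def by (rule J.restrict_hom[OF h(1,2)])
  have hEF: "h (EJ i) = ?u (Ue i)" "h (FJ i) = ?u (Uf i)" for i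
    by (simp_all add: alg_homD(4)[OF h(1)] h)
  obtain p where p: "p \<in> alg_hom (Uq \<alpha> q) W"
    "\<And>i. p (?u (Ue i)) = EJ i" "\<And>i. p (?u (Uf i)) = FJ i"
    "\<And>i. p (?u (Uk i)) = g (WK i)" "\<And>i. p (?u (Ukinv i)) = g (WKbar i)"
    using W.universal by blast
  have 1: "(p \<circ> h) x = id x" if "x \<in> carrier W" for x
    by (rule alg_hom_eqI[OF W.k_algebra_axioms alg_hom_comp[OF hW p(1)] alg_hom_id W.gens_carrier])
      (use that W_generated in \<open>auto simp: W.gens_def h hEF p\<close>)
  have 2: "(h \<circ> p) x = id x" if "x \<in> carrier (Uq \<alpha> q)" for x
    by (rule alg_hom_eqI[OF U.k_algebra_axioms alg_hom_comp[OF p(1) hW] alg_hom_id U.gens_carrier])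
      (use that U_generated in \<open>auto simp: U.gens_def h hEF p\<close>)
  have "bij_betw h (carrier W) (carrier (Uq \<alpha> q))"
    by (rule bij_betw_byWitness[where f' = p])
      (use 1 2 alg_homD(1)[OF hW] alg_homD(1)[OF p(1)] in auto)
  then have "h \<in> alg_iso W (Uq \<alpha> q)" using hW by (simp add: alg_iso_def)
  then show ?thesis using h hEF by (intro bexI[of _ h]) auto
qed

lemma wq_hopf_structureI:
  assumes "W.hopf_on \<Delta> \<epsilon> S"
  shows "wq_hopf_structure \<alpha> q \<kappa> \<kappa>' \<Delta> \<epsilon> S"
proof -
  have "\<one>\<^bsub>W\<^esub> = g WJ" by (simp add: wq_def)
  then show ?thesis
    using assms W_closed unfolding wq_hopf_structure_def W.hopf_on_def Let_def by (simp add: W.minus_eq_sc)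
qed

lemma Uq_hopf_structureI:
  assumes "U.hopf_on \<Delta> \<epsilon> S"
  shows "Uq_hopf_structure \<alpha> q \<Delta> \<epsilon> S"
  using assms U.closed unfolding Uq_hopf_structure_def U.hopf_on_def Let_def by (simp add: U.minus_eq_sc)

end

theorem proposition4p2:
  fixes R :: "'v::euclidean_space set"
    and \<alpha> :: "'i::finite \<Rightarrow> 'v"
    and q :: "'k::field_char_0"
    and \<kappa> \<kappa>' :: "'i \<Rightarrow> bool"
  assumes "simple_root_data R \<alpha>"
    and "\<And>i. qpar \<alpha> q i \<noteq> 0 \<and> qpar \<alpha> q i \<noteq> 1 \<and> qpar \<alpha> q i \<noteq> -1"
  shows "alg_direct_sum (weak_alg \<alpha> q \<kappa> \<kappa>') (wq \<alpha> q \<kappa> \<kappa>') (wq_bar \<alpha> q \<kappa> \<kappa>') \<and>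
    (\<exists>\<Delta> \<epsilon> S \<Delta>' \<epsilon>' S'.
       wq_hopf_structure \<alpha> q \<kappa> \<kappa>' \<Delta> \<epsilon> S \<and>
       Uq_hopf_structure \<alpha> q \<Delta>' \<epsilon>' S' \<and>
       (\<exists>\<phi>. \<phi> \<in> hopf_iso (wq \<alpha> q \<kappa> \<kappa>') \<Delta> \<epsilon> S (Uq \<alpha> q) \<Delta>' \<epsilon>' S'))"
proof -
  interpret weak_datum \<alpha> q \<kappa> \<kappa>'
    by unfold_locales
      (simp_all add: assms(2) qpar_cartan_sym[OF assms(1)] cartan_diag[OF assms(1)] cartan_nonpos[OF assms(1)])
  obtain \<phi> where \<phi>: "\<phi> \<in> alg_iso W (Uq \<alpha> q)"
    and \<phi>_gen: "\<And>i. \<phi> (EJ i) = presented_gen (Uq_rels \<alpha> q) (Ue i)" "\<And>i. \<phi> (FJ i) = presented_gen (Uq_rels \<alpha> q) (Uf i)"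
      "\<And>i. \<phi> (g (WK i)) = presented_gen (Uq_rels \<alpha> q) (Uk i)"
      "\<And>i. \<phi> (g (WKbar i)) = presented_gen (Uq_rels \<alpha> q) (Ukinv i)"
    using W_iso_U by blast
  have ph: "\<phi> \<in> alg_hom W (Uq \<alpha> q)" using \<phi> by (simp add: alg_iso_def)
  obtain \<Delta> \<epsilon> S where W: "W.hopf_on \<Delta> \<epsilon> S"
    using W.hopf_exists[OF ph \<phi>_gen W_generated] by blast
  obtain \<Delta>' \<epsilon>' S' where U: "U.hopf_on \<Delta>' \<epsilon>' S'"
    using U.hopf_exists[OF alg_hom_id _ _ _ _ U_generated] by auto
  have "\<phi> \<in> hopf_iso W \<Delta> \<epsilon> S (Uq \<alpha> q) \<Delta>' \<epsilon>' S'"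
    by (rule W.hopf_iso_of_alg_iso[OF uq_tuple_Uq W U \<phi> \<phi>_gen W_generated])
  moreover have "alg_direct_sum w W (wq_bar \<alpha> q \<kappa> \<kappa>')"
    unfolding wq_def wq_bar_def by (rule J.direct_sum)
  ultimately show ?thesis using wq_hopf_structureI[OF W] Uq_hopf_structureI[OF U] by blast
qed

end
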